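(* Let $\tau:M\to M_0$ be a graded bundle with associated weight vector field $\Delta$ and corresponding homogeneity structure (action by homotheties) $h:\mathbb R\times M\to M$, and let $X\in\mathfrak X(M)$ (resp., $Y\in\mathfrak X(M)$) be a complete vector field of weight $-1$ (resp., $+1$), i.e. $[\Delta,X]=-X$ (resp., $[\Delta,Y]=Y$). Then the formulas $$p.(a,b):=X^{b/a}(h_a(p))=h_a\big(X^{b/a^2}(p)\big)\qquad\Big(\text{resp., }(a,b).p:=h_a\big(Y^{b/a}(p)\big)=Y^{b/a^2}(h_a(p))\Big)$$ (in which the two displayed expressions agree) define a smooth right (resp., left) action on $M$ of the group $\mathcal G_2^{\mathrm{inv}}=\{(a,b)\in\mathcal G_2: a\neq0\}$ of invertible elements of $\mathcal G_2$. Here $t\mapsto X^t$ (resp., $t\mapsto Y^t$) denotes the flow of $X$ (resp., $Y$).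
   Context: $\mathcal G_2$ is the monoid of second jets at $0$ of maps $\phi:(\mathbb R,0)\to(\mathbb R,0)$ under composition; it is identified with $\mathbb R^2=\{(a,b)\}$ (the class of $\phi(t)=at+\frac12bt^2$), with multiplication $(a,b)(A,B)=(aA,\,aB+bA^2)$ and unit $(1,0)$. A (real) graded space of rank $\mathbf d=(d_1,\dots,d_k)$ is a manifold diffeomorphic to $\mathbb R^{d_1+\dots+d_k}$ with an equivalence class of global coordinate systems $(y^\alpha)$ with positive integer weights $w^\alpha$ ($d_i$ coordinates of weight $i$), two systems being equivalent if each new coordinate of weight $w$ is a real polynomial in the old ones all of whose monomials $y^{\alpha_1}\cdots y^{\alpha_j}$, $j\ge1$, satisfy $w^{\alpha_1}+\dots+w^{\alpha_j}=w$. A graded bundle is a smooth fiber bundle with typical fiber a graded space and with transition maps that are isomorphisms of graded spaces on fibers. Its action by homotheties $h$ of the monoid $(\mathbb R,\cdot)$ is $h_t(x,(y^\alpha))=(x,(t^{w^\alpha}y^\alpha))$, $h_t=h(t,\cdot)$, and its weight vector field is $\Delta(p)=\frac{d}{dt}|_{t=1}h_t(p)$. A vector field $Z$ has weight $w$ if $(h_t)_*Z(p)=t^{-w}Z(h_t(p))$ for all $p$ and $t>0$; equivalently $[\Delta,Z]=wZ$. *)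

theory Defs
  imports "HOL-Analysis.Analysis" "HOL-Algebra.Group"
begin

section \<open>Smooth functions\<close>

primrec Ck_on :: "nat \<Rightarrow> 'a::real_normed_vector set \<Rightarrow> ('a \<Rightarrow> 'b::real_normed_vector) \<Rightarrow> bool"
where
  "Ck_on 0 W f \<longleftrightarrow> continuous_on W f"
| "Ck_on (Suc k) W f \<longleftrightarrow>
     (\<forall>x\<in>W. f differentiable (at x)) \<and> (\<forall>v. Ck_on k W (\<lambda>x. frechet_derivative f (at x) v))"

text \<open>Smoothness on a set that need not be open: local extendability to a \<open>C\<^sup>\<infinity>\<close> function on an
  open set of the ambient space.  On a relatively open subset of a linear subspace this is
  ordinary smoothness in linear coordinates of the subspace.\<close>

definition smooth_on :: "'a::real_normed_vector set \<Rightarrow> ('a \<Rightarrow> 'b::real_normed_vector) \<Rightarrow> bool"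
where
  "smooth_on S f \<longleftrightarrow>
     (\<forall>x\<in>S. \<exists>W g. open W \<and> x \<in> W \<and> (\<forall>k. Ck_on k W g) \<and> (\<forall>y\<in>S \<inter> W. f y = g y))"


section \<open>Manifolds\<close>

text \<open>The points of a manifold form a subset of a Hausdorff, second countable type, with the
  subspace topology.  The model space is a linear subspace of a Euclidean space rather than a whole
  Euclidean space, because the types of class \<open>euclidean_space\<close> have positive dimension,
  and a base manifold or a fibre may well be zero-dimensional.\<close>

type_synonym ('a, 'e) chart = "'a set \<times> ('a \<Rightarrow> 'e)"

record ('a, 'e) mfd =
  model :: "'e set"
  atlas :: "('a, 'e) chart set"

definition points :: "('a, 'e) mfd \<Rightarrow> 'a set" where
  "points M = (\<Union>(U, \<phi>)\<in>atlas M. U)"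

abbreviation open_in :: "('a::topological_space, 'e) mfd \<Rightarrow> 'a set \<Rightarrow> bool" where
  "open_in M U \<equiv> openin (top_of_set (points M)) U"

definition smooth_manifold ::
  "('a::{t2_space,second_countable_topology}, 'e::euclidean_space) mfd \<Rightarrow> bool"
where
  "smooth_manifold M \<longleftrightarrow>
     subspace (model M) \<and>
     (\<forall>(U, \<phi>)\<in>atlas M.
        open_in M U \<and> openin (top_of_set (model M)) (\<phi> ` U) \<and>
        homeomorphism U (\<phi> ` U) \<phi> (inv_into U \<phi>)) \<and>
     (\<forall>(U, \<phi>)\<in>atlas M. \<forall>(V, \<psi>)\<in>atlas M. smooth_on (\<phi> ` (U \<inter> V)) (\<psi> \<circ> inv_into U \<phi>))"

definition smooth_map ::
  "('a::topological_space, 'e::euclidean_space) mfd \<Rightarrow>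
   ('b::topological_space, 'f::euclidean_space) mfd \<Rightarrow> ('a \<Rightarrow> 'b) \<Rightarrow> bool"
where
  "smooth_map M N f \<longleftrightarrow>
     f ` points M \<subseteq> points N \<and> continuous_on (points M) f \<and>
     (\<forall>(U, \<phi>)\<in>atlas M. \<forall>(V, \<psi>)\<in>atlas N.
        smooth_on (\<phi> ` (U \<inter> f -` V)) (\<psi> \<circ> f \<circ> inv_into U \<phi>))"

definition diffeo ::
  "('a::topological_space, 'e::euclidean_space) mfd \<Rightarrow>
   ('b::topological_space, 'f::euclidean_space) mfd \<Rightarrow> ('a \<Rightarrow> 'b) \<Rightarrow> bool"
where
  "diffeo M N f \<longleftrightarrow>
     bij_betw f (points M) (points N) \<and> smooth_map M N f \<and>
     smooth_map N M (inv_into (points M) f)"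

text \<open>\<open>eucl_mfd E S\<close> is a relatively open subset \<open>S\<close> of the linear subspace \<open>E\<close>;
  \<open>sub_mfd M S\<close> is the open submanifold of \<open>M\<close> on \<open>S\<close>.\<close>

definition eucl_mfd :: "'e set \<Rightarrow> 'e set \<Rightarrow> ('e, 'e) mfd" where
  "eucl_mfd E S = \<lparr>model = E, atlas = {(S, \<lambda>x. x)}\<rparr>"

definition sub_mfd :: "('a, 'e) mfd \<Rightarrow> 'a set \<Rightarrow> ('a, 'e) mfd" where
  "sub_mfd M S = \<lparr>model = model M, atlas = (\<lambda>(U, \<phi>). (U \<inter> S, \<phi>)) ` atlas M\<rparr>"

definition prod_mfd :: "('a, 'e) mfd \<Rightarrow> ('b, 'f) mfd \<Rightarrow> ('a \<times> 'b, 'e \<times> 'f) mfd" where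
  "prod_mfd M N =
     \<lparr>model = model M \<times> model N,
      atlas = {(U \<times> V, map_prod \<phi> \<psi>) | U \<phi> V \<psi>. (U, \<phi>) \<in> atlas M \<and> (V, \<psi>) \<in> atlas N}\<rparr>"

definition smooth_fun_on ::
  "('a::topological_space, 'e::euclidean_space) mfd \<Rightarrow> 'a set \<Rightarrow> ('a \<Rightarrow> real) \<Rightarrow> bool"
where
  "smooth_fun_on M U f \<longleftrightarrow> smooth_map (sub_mfd M U) (eucl_mfd UNIV UNIV) f"

definition smooth_fun_near ::
  "('a::topological_space, 'e::euclidean_space) mfd \<Rightarrow> 'a \<Rightarrow> ('a \<Rightarrow> real) \<Rightarrow> bool"
where
  "smooth_fun_near M p f \<longleftrightarrow> (\<exists>U. open_in M U \<and> p \<in> U \<and> smooth_fun_on M U f)"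


section \<open>Vector fields and their flows\<close>

text \<open>A tangent vector at \<open>p\<close> is the velocity at \<open>p\<close> of a smooth curve, regarded as the operator
  \<open>f \<mapsto> (f \<circ> \<gamma>)'(0)\<close>; only its values at functions smooth near \<open>p\<close> are meaningful.\<close>

type_synonym 'a tvec = "('a \<Rightarrow> real) \<Rightarrow> real"

definition tangent_vector ::
  "('a::topological_space, 'e::euclidean_space) mfd \<Rightarrow> 'a \<Rightarrow> 'a tvec \<Rightarrow> bool"
where
  "tangent_vector M p v \<longleftrightarrow>
     (\<exists>\<epsilon>>0. \<exists>\<gamma>. smooth_map (eucl_mfd UNIV {-\<epsilon><..<\<epsilon>}) M \<gamma> \<and> \<gamma> 0 = p \<and>
        (\<forall>f. smooth_fun_near M p f \<longrightarrow> ((\<lambda>t. f (\<gamma> t)) has_real_derivative v f) (at 0)))"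

definition vector_field ::
  "('a::topological_space, 'e::euclidean_space) mfd \<Rightarrow> ('a \<Rightarrow> 'a tvec) \<Rightarrow> bool"
where
  "vector_field M X \<longleftrightarrow>
     (\<forall>p\<in>points M. tangent_vector M p (X p)) \<and>
     (\<forall>U f. open_in M U \<and> smooth_fun_on M U f \<longrightarrow> smooth_fun_on M U (\<lambda>p. X p f))"

definition push_forward :: "('a \<Rightarrow> 'b) \<Rightarrow> 'a tvec \<Rightarrow> 'b tvec" where
  "push_forward \<phi> v = (\<lambda>f. v (\<lambda>q. f (\<phi> q)))"

definition integral_curve ::
  "('a::topological_space, 'e::euclidean_space) mfd \<Rightarrow> ('a \<Rightarrow> 'a tvec) \<Rightarrow> (real \<Rightarrow> 'a) \<Rightarrow> bool"
where
  "integral_curve M X \<gamma> \<longleftrightarrow>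
     range \<gamma> \<subseteq> points M \<and> continuous_on UNIV \<gamma> \<and>
     (\<forall>t f. smooth_fun_near M (\<gamma> t) f \<longrightarrow>
        ((\<lambda>s. f (\<gamma> s)) has_real_derivative X (\<gamma> t) f) (at t))"

definition complete_field ::
  "('a::topological_space, 'e::euclidean_space) mfd \<Rightarrow> ('a \<Rightarrow> 'a tvec) \<Rightarrow> bool"
where
  "complete_field M X \<longleftrightarrow> (\<forall>p\<in>points M. \<exists>\<gamma>. integral_curve M X \<gamma> \<and> \<gamma> 0 = p)"

definition flow ::
  "('a::topological_space, 'e::euclidean_space) mfd \<Rightarrow> ('a \<Rightarrow> 'a tvec) \<Rightarrow> real \<Rightarrow> 'a \<Rightarrow> 'a"
where
  "flow M X t p = (THE q. \<exists>\<gamma>. integral_curve M X \<gamma> \<and> \<gamma> 0 = p \<and> \<gamma> t = q)"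


section \<open>Graded spaces and graded bundles\<close>

text \<open>The graded space with weights \<open>w\<close> has one coordinate of weight \<open>w \<alpha>\<close> for each index \<open>\<alpha>\<close> with
  \<open>w \<alpha> > 0\<close>; an index with \<open>w \<alpha> = 0\<close> stands for no coordinate at all.  So the rank is
  \<open>d\<^sub>i = card {\<alpha>. w \<alpha> = i}\<close> for \<open>i \<ge> 1\<close>, and rank zero is allowed.\<close>

definition graded_space :: "('i::finite \<Rightarrow> nat) \<Rightarrow> (real^'i) set" where
  "graded_space w = {y. \<forall>\<alpha>. w \<alpha> = 0 \<longrightarrow> y $ \<alpha> = 0}"

abbreviation graded_mfd :: "('i::finite \<Rightarrow> nat) \<Rightarrow> (real^'i, real^'i) mfd" where
  "graded_mfd w \<equiv> eucl_mfd (graded_space w) (graded_space w)"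

definition dilation :: "('i::finite \<Rightarrow> nat) \<Rightarrow> real \<Rightarrow> real^'i \<Rightarrow> real^'i" where
  "dilation w t y = (\<chi> \<alpha>. t ^ w \<alpha> * y $ \<alpha>)"

text \<open>Exponents \<open>\<mu>\<close> of the monomials of weight \<open>k\<close> in the coordinates of the graded space;
  this is a finite set.\<close>

definition exponents :: "('i::finite \<Rightarrow> nat) \<Rightarrow> nat \<Rightarrow> ('i \<Rightarrow> nat) set" where
  "exponents w k = {\<mu>. (\<forall>\<alpha>. w \<alpha> = 0 \<longrightarrow> \<mu> \<alpha> = 0) \<and> (\<Sum>\<alpha>\<in>UNIV. \<mu> \<alpha> * w \<alpha>) = k}"

lemma finite_exponents: "finite (exponents w k)"
proof (rule finite_subset)
  show "exponents w k \<subseteq> Pi UNIV (\<lambda>_. {..k})"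
  proof (intro subsetI Pi_I)
    fix \<mu> \<alpha> assume \<mu>: "\<mu> \<in> exponents w k"
    show "\<mu> \<alpha> \<in> {..k}"
    proof (cases "w \<alpha> = 0")
      case False
      then have "\<mu> \<alpha> \<le> \<mu> \<alpha> * w \<alpha>" by simp
      also have "\<dots> \<le> (\<Sum>\<beta>\<in>UNIV. \<mu> \<beta> * w \<beta>)" by (rule member_le_sum) auto
      finally show ?thesis using \<mu> by (simp add: exponents_def)
    qed (use \<mu> in \<open>simp add: exponents_def\<close>)
  qed
  show "finite (Pi (UNIV :: 'a set) (\<lambda>_. {..k}))"
    by (simp add: PiE_UNIV_domain[symmetric] finite_PiE)
qed

definition poly_of_weight :: "('i::finite \<Rightarrow> nat) \<Rightarrow> nat \<Rightarrow> (real^'i \<Rightarrow> real) \<Rightarrow> bool" where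
  "poly_of_weight w k f \<longleftrightarrow>
     (\<exists>c. \<forall>y\<in>graded_space w. f y = (\<Sum>\<mu>\<in>exponents w k. c \<mu> * (\<Prod>\<alpha>\<in>UNIV. (y $ \<alpha>) ^ \<mu> \<alpha>)))"

definition graded_map :: "('i::finite \<Rightarrow> nat) \<Rightarrow> (real^'i \<Rightarrow> real^'i) \<Rightarrow> bool" where
  "graded_map w g \<longleftrightarrow>
     g ` graded_space w \<subseteq> graded_space w \<and>
     (\<forall>\<alpha>. w \<alpha> > 0 \<longrightarrow> poly_of_weight w (w \<alpha>) (\<lambda>y. g y $ \<alpha>))"

definition graded_iso :: "('i::finite \<Rightarrow> nat) \<Rightarrow> (real^'i \<Rightarrow> real^'i) \<Rightarrow> bool" where
  "graded_iso w g \<longleftrightarrow>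
     bij_betw g (graded_space w) (graded_space w) \<and> graded_map w g \<and>
     graded_map w (inv_into (graded_space w) g)"

text \<open>A local trivialization is a pair \<open>(U, \<psi>)\<close> with \<open>\<psi> : \<tau>\<^sup>-\<^sup>1(U) \<rightarrow> U \<times> F\<close>.\<close>

type_synonym ('a, 'b, 'f) triv = "'b set \<times> ('a \<Rightarrow> 'b \<times> 'f)"

definition over :: "('a, 'e) mfd \<Rightarrow> ('a \<Rightarrow> 'b) \<Rightarrow> 'b set \<Rightarrow> 'a set" where
  "over M \<tau> U = points M \<inter> \<tau> -` U"

definition fiber_bundle ::
  "('a::{t2_space,second_countable_topology}, 'e::euclidean_space) mfd \<Rightarrow>
   ('b::{t2_space,second_countable_topology}, 'c::euclidean_space) mfd \<Rightarrow>
   ('f::topological_space, 'g::euclidean_space) mfd \<Rightarrow>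
   ('a \<Rightarrow> 'b) \<Rightarrow> ('a, 'b, 'f) triv set \<Rightarrow> bool"
where
  "fiber_bundle M M0 F \<tau> \<Psi> \<longleftrightarrow>
     smooth_manifold M \<and> smooth_manifold M0 \<and> smooth_map M M0 \<tau> \<and>
     (\<Union>(U, \<psi>)\<in>\<Psi>. U) = points M0 \<and>
     (\<forall>(U, \<psi>)\<in>\<Psi>.
        open_in M0 U \<and>
        diffeo (sub_mfd M (over M \<tau> U)) (prod_mfd (sub_mfd M0 U) F) \<psi> \<and>
        (\<forall>p\<in>over M \<tau> U. fst (\<psi> p) = \<tau> p))"

definition graded_bundle ::
  "('a::{t2_space,second_countable_topology}, 'e::euclidean_space) mfd \<Rightarrow>
   ('b::{t2_space,second_countable_topology}, 'c::euclidean_space) mfd \<Rightarrow>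
   ('i::finite \<Rightarrow> nat) \<Rightarrow> ('a \<Rightarrow> 'b) \<Rightarrow> ('a, 'b, real^'i) triv set \<Rightarrow> bool"
where
  "graded_bundle M M0 w \<tau> \<Psi> \<longleftrightarrow>
     fiber_bundle M M0 (graded_mfd w) \<tau> \<Psi> \<and>
     (\<forall>(U, \<psi>)\<in>\<Psi>. \<forall>(V, \<psi>')\<in>\<Psi>. \<forall>x\<in>U \<inter> V.
        graded_iso w (\<lambda>y. snd (\<psi>' (inv_into (over M \<tau> U) \<psi> (x, y)))))"

text \<open>\<open>h\<^sub>t\<close> reads \<open>(x, y) \<mapsto> (x, (t\<^bsup>w \<alpha>\<^esup> y\<^sup>\<alpha>))\<close> in every trivialization over a
  neighbourhood of \<open>\<tau> p\<close>.\<close>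

definition homothety ::
  "('a, 'e) mfd \<Rightarrow> ('i::finite \<Rightarrow> nat) \<Rightarrow> ('a \<Rightarrow> 'b) \<Rightarrow> ('a, 'b, real^'i) triv set \<Rightarrow>
   real \<Rightarrow> 'a \<Rightarrow> 'a"
where
  "homothety M w \<tau> \<Psi> t p =
     (THE q. q \<in> points M \<and> \<tau> q = \<tau> p \<and>
        (\<forall>(U, \<psi>)\<in>\<Psi>. \<tau> p \<in> U \<longrightarrow> snd (\<psi> q) = dilation w t (snd (\<psi> p))))"

text \<open>\<open>Z\<close> has weight \<open>k\<close> if \<open>(h\<^sub>t)\<^sub>* Z(p) = t\<^bsup>-k\<^esup> Z(h\<^sub>t p)\<close> for all \<open>t > 0\<close>;
  this is equivalent to \<open>[\<Delta>, Z] = k Z\<close> for the weight vector field \<open>\<Delta>(p) = d/dt|\<^sub>t\<^sub>=\<^sub>1 h\<^sub>t(p)\<close>.\<close>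

definition has_weight ::
  "('a::topological_space, 'e::euclidean_space) mfd \<Rightarrow> (real \<Rightarrow> 'a \<Rightarrow> 'a) \<Rightarrow>
   ('a \<Rightarrow> 'a tvec) \<Rightarrow> int \<Rightarrow> bool"
where
  "has_weight M h Z k \<longleftrightarrow>
     (\<forall>p\<in>points M. \<forall>t>0. \<forall>f. smooth_fun_near M (h t p) f \<longrightarrow>
        push_forward (h t) (Z p) f = t powi (- k) * Z (h t p) f)"


section \<open>The monoid of second jets and smooth actions\<close>

definition G2 :: "(real \<times> real) monoid" where
  "G2 = \<lparr>carrier = UNIV, mult = (\<lambda>(a, b) (A, B). (a * A, a * B + b * A\<^sup>2)), one = (1, 0)\<rparr>"

lemma monoid_G2: "monoid G2"
  by (rule monoidI) (auto simp: G2_def algebra_simps power2_eq_square)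

lemma carrier_units_G2: "carrier (units_of G2) = {(a, b). a \<noteq> 0}"
proof -
  have "(a, b) \<in> Units G2" if "a \<noteq> 0" for a b
  proof -
    have "(1 / a, - b / a ^ 3) \<otimes>\<^bsub>G2\<^esub> (a, b) = \<one>\<^bsub>G2\<^esub>"
      and "(a, b) \<otimes>\<^bsub>G2\<^esub> (1 / a, - b / a ^ 3) = \<one>\<^bsub>G2\<^esub>"
      using that by (simp_all add: G2_def power2_eq_square power3_eq_cube)
    moreover have "x \<in> carrier G2" for x by (simp add: G2_def)
    ultimately show ?thesis unfolding Units_def by blast
  qed
  moreover have "a \<noteq> 0" if "(a, b) \<in> Units G2" for a b
    using that by (auto simp: Units_def G2_def)
  ultimately show ?thesis by (auto simp: units_of_carrier)
qed

lemma group_units_G2: "group (units_of G2)"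
  by (rule monoid.units_group[OF monoid_G2])

text \<open>Actions of a group \<open>G\<close> whose carrier is an open subset of a Euclidean space.\<close>

definition smooth_right_action ::
  "'g::euclidean_space monoid \<Rightarrow> ('a::topological_space, 'e::euclidean_space) mfd \<Rightarrow>
   ('a \<Rightarrow> 'g \<Rightarrow> 'a) \<Rightarrow> bool"
where
  "smooth_right_action G M act \<longleftrightarrow>
     (\<forall>p\<in>points M. act p \<one>\<^bsub>G\<^esub> = p) \<and>
     (\<forall>p\<in>points M. \<forall>g\<in>carrier G. \<forall>g'\<in>carrier G. act (act p g) g' = act p (g \<otimes>\<^bsub>G\<^esub> g')) \<and>
     smooth_map (prod_mfd M (eucl_mfd UNIV (carrier G))) M (\<lambda>(p, g). act p g)"

definition smooth_left_action ::
  "'g::euclidean_space monoid \<Rightarrow> ('a::topological_space, 'e::euclidean_space) mfd \<Rightarrow>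
   ('g \<Rightarrow> 'a \<Rightarrow> 'a) \<Rightarrow> bool"
where
  "smooth_left_action G M act \<longleftrightarrow>
     (\<forall>p\<in>points M. act \<one>\<^bsub>G\<^esub> p = p) \<and>
     (\<forall>p\<in>points M. \<forall>g\<in>carrier G. \<forall>g'\<in>carrier G. act g (act g' p) = act (g \<otimes>\<^bsub>G\<^esub> g') p) \<and>
     smooth_map (prod_mfd (eucl_mfd UNIV (carrier G)) M) M (\<lambda>(g, p). act g p)"

end

theory Submission
  imports Defs
begin

text \<open>A homothety of a nonzero parameter \<open>a\<close> maps a field of weight \<open>k\<close> to \<open>a\<^bsup>-k\<^esup>\<close> times itself.  For
  \<open>a > 0\<close> this is the hypothesis.  For \<open>a = -1\<close> it follows from smoothness at the zero section:
  in adapted coordinates the components of the field are smooth and homogeneous along each curve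
  \<open>t \<mapsto> h\<^sub>t(p)\<close>, and a smooth function that is homogeneous of degree \<open>n\<close> on both half-lines has the
  parity of \<open>n\<close>.  Hence \<open>h\<^sub>a\<close> maps integral curves to reparametrized integral curves, which is the
  commutation rule between \<open>h\<^sub>a\<close> and the flow, and the action axioms are a computation with it.
  Smoothness of the action reduces to smoothness of flows, that is, to smooth dependence of
  solutions of differential equations on initial values; only dependence has to be proved, as
  completeness provides the integral curves.\<close>

section \<open>Calculus of \<open>C\<^sup>k\<close> functions\<close>

text \<open>The weight condition is imposed only for \<open>t > 0\<close>, while the group has a
  second component \<open>a < 0\<close>. The two half-lines are linked because \<open>h\<close> is
  smooth in all real parameters, including the degenerate \<open>h 0\<close>. The parity argument
  applies to homogeneous functions only; since a tangent vector is a velocity, it sees a test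
  function through its differential, so checking homogeneous local coordinates suffices. The
  commutation rule reads \<open>flow M X t (h a p) = h a (flow M X (a powi k * t) p)\<close>. For
  \<open>k = -1\<close>, moving \<open>h A\<close> inward past a flow multiplies the time by
  \<open>A\<close>; for \<open>k = 1\<close>, moving it outward does. Either way the times in a
  product add up to \<open>B / A + (b / a) * A\<close>, the quotient of the components of the
  product of \<open>(a, b)\<close> and \<open>(A, B)\<close>; the direction of the move decides
  between right and left action. Two features of the encoding shape the rest. Charts take values in
  relatively open subsets of a linear subspace, so functions are extended to open sets before
  derivatives are taken. And \<open>flow\<close> is a definite description, so uniqueness of
  integral curves precedes every computation with it.\<close>

lemma Ck_on_subset: "Ck_on k W f \<Longrightarrow> V \<subseteq> W \<Longrightarrow> Ck_on k V f"
  by (induction k arbitrary: f) (auto intro: continuous_on_subset)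

lemma Ck_on_SucD: "Ck_on (Suc k) W f \<Longrightarrow> Ck_on k W f"
proof (induction k arbitrary: f)
  case 0
  then show ?case
    by (auto intro!: continuous_at_imp_continuous_on differentiable_imp_continuous_within)
next
  case (Suc k)
  then show ?case by (metis Ck_on.simps(2))
qed

lemma Ck_on_mono: "Ck_on k W f \<Longrightarrow> j \<le> k \<Longrightarrow> Ck_on j W f"
  by (induction k) (use Ck_on_SucD le_Suc_eq in blast)+

lemma Ck_on_imp_continuous_on: "Ck_on k W f \<Longrightarrow> continuous_on W f"
  using Ck_on_mono[of k W f 0] by simp

text \<open>Any explicitly known derivative may replace the one chosen by
  \<open>frechet_derivative\<close>. Openness of \<open>W\<close> matters: derivatives at points of
  \<open>W\<close> then depend only on values in \<open>W\<close>, so \<open>Ck_on\<close> cannot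
  tell apart functions that agree on \<open>W\<close>; the inner induction proves exactly
  this.\<close>

lemma Ck_on_SucI:
  assumes "\<And>x. x \<in> W \<Longrightarrow> (f has_derivative f' x) (at x)" "\<And>v. Ck_on k W (\<lambda>x. f' x v)"
    and "open W"
  shows "Ck_on (Suc k) W f"
proof -
  have eq: "frechet_derivative f (at x) = f' x" if "x \<in> W" for x
    using frechet_derivative_at[OF assms(1)[OF that]] by simp
  have "Ck_on k W (\<lambda>x. frechet_derivative f (at x) v) = Ck_on k W (\<lambda>x. f' x v)" for v
  proof -
    have *: "Ck_on k W g = Ck_on k W h" if "\<And>x. x \<in> W \<Longrightarrow> g x = h x" for g h :: "'a \<Rightarrow> 'b"
      using that
    proof (induction k arbitrary: g h)
      case 0
      then show ?case by (simp cong: continuous_on_cong)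
    next
      case (Suc k)
      have d: "(g has_derivative D) (at x) = (h has_derivative D) (at x)" if "x \<in> W" for x D
        using Suc.prems that assms(3) has_derivative_transform_within_open[of _ _ x UNIV W]
        by metis
      then have "frechet_derivative g (at x) = frechet_derivative h (at x)" if "x \<in> W" for x
        using that by (simp add: frechet_derivative_def)
      moreover have "g differentiable (at x) \<longleftrightarrow> h differentiable (at x)" if "x \<in> W" for x
        using d that by (simp add: differentiable_def)
      ultimately show ?case
        using Suc.IH[of "\<lambda>x. frechet_derivative g (at x) v" "\<lambda>x. frechet_derivative h (at x) v" for v]
        by simp
    qed
    show ?thesis by (rule *) (simp add: eq)
  qed
  then show ?thesis using assms by (auto simp: differentiable_def)
qed

lemma Ck_on_SucE:
  assumes "Ck_on (Suc k) W f"
  obtains f' where "\<And>x. x \<in> W \<Longrightarrow> (f has_derivative f' x) (at x)" "\<And>v. Ck_on k W (\<lambda>x. f' x v)"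
  using assms that[of "\<lambda>x. frechet_derivative f (at x)"] frechet_derivative_works by auto

lemma Ck_on_cong:
  assumes "Ck_on k W f" "open W" "\<And>x. x \<in> W \<Longrightarrow> f x = g x"
  shows "Ck_on k W g"
proof (cases k)
  case 0
  then show ?thesis using assms by (auto cong: continuous_on_cong)
next
  case (Suc j)
  from assms(1)[unfolded Suc] obtain f'
    where "\<And>x. x \<in> W \<Longrightarrow> (f has_derivative f' x) (at x)" "\<And>v. Ck_on j W (\<lambda>x. f' x v)"
    by (rule Ck_on_SucE) blast
  then show ?thesis unfolding Suc using assms(2,3)
    by (intro Ck_on_SucI) (auto intro: has_derivative_transform_within_open)
qed

lemma Ck_on_local:
  assumes "\<And>x. x \<in> W \<Longrightarrow> \<exists>V. open V \<and> x \<in> V \<and> Ck_on k V f"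
  shows "Ck_on k W f"
  using assms
proof (induction k arbitrary: f)
  case 0
  have "isCont f x" if "x \<in> W" for x
    using 0[OF that] continuous_on_eq_continuous_at by auto
  then show ?case by (simp add: continuous_at_imp_continuous_on)
next
  case (Suc k)
  have "f differentiable (at x)" if "x \<in> W" for x using Suc.prems[OF that] by auto
  moreover have "Ck_on k W (\<lambda>x. frechet_derivative f (at x) v)" for v
    by (rule Suc.IH) (use Suc.prems in fastforce)
  ultimately show ?case by simp
qed

lemma Ck_on_const: "Ck_on k W (\<lambda>x. c)"
  by (induction k arbitrary: c) (auto simp: frechet_derivative_const)

lemma Ck_on_linear:
  assumes "bounded_linear L" shows "Ck_on k W L"
proof (cases k)
  case 0
  then show ?thesis using assms by (auto intro: bounded_linear.continuous_on continuous_on_id)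
next
  case (Suc j)
  have "(L has_derivative L) (at x)" for x
    using bounded_linear.has_derivative[OF assms has_derivative_ident] by simp
  then have "Ck_on (Suc j) UNIV L"
    by (intro Ck_on_SucI[where f'="\<lambda>x. L"]) (auto intro: Ck_on_const)
  then show ?thesis using Suc Ck_on_subset by blast
qed

lemma Ck_on_linear_compose:
  assumes "bounded_linear L" "Ck_on k W f" "open W" shows "Ck_on k W (\<lambda>x. L (f x))"
  using assms(2)
proof (induction k arbitrary: f)
  case 0
  then show ?case using assms(1) by (auto intro: bounded_linear.continuous_on)
next
  case (Suc k)
  from Suc.prems obtain f'
    where "\<And>x. x \<in> W \<Longrightarrow> (f has_derivative f' x) (at x)" "\<And>v. Ck_on k W (\<lambda>x. f' x v)"
    by (rule Ck_on_SucE) blast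
  then show ?case using Suc.IH assms
    by (intro Ck_on_SucI[where f'="\<lambda>x v. L (f' x v)"]) (auto intro: bounded_linear.has_derivative)
qed

lemma Ck_on_add:
  assumes "Ck_on k W f" "Ck_on k W g" "open W" shows "Ck_on k W (\<lambda>x. f x + g x)"
  using assms(1,2)
proof (induction k arbitrary: f g)
  case 0
  then show ?case by (auto intro: continuous_on_add)
next
  case (Suc k)
  from Suc.prems(1) obtain f'
    where f: "\<And>x. x \<in> W \<Longrightarrow> (f has_derivative f' x) (at x)" "\<And>v. Ck_on k W (\<lambda>x. f' x v)"
    by (rule Ck_on_SucE) blast
  from Suc.prems(2) obtain g'
    where g: "\<And>x. x \<in> W \<Longrightarrow> (g has_derivative g' x) (at x)" "\<And>v. Ck_on k W (\<lambda>x. g' x v)"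
    by (rule Ck_on_SucE) blast
  show ?case using Suc.IH f g assms(3)
    by (intro Ck_on_SucI[where f'="\<lambda>x v. f' x v + g' x v"]) (auto intro: has_derivative_add)
qed

lemma Ck_on_sum:
  assumes "\<And>i. i \<in> I \<Longrightarrow> Ck_on k W (f i)" "open W"
  shows "Ck_on k W (\<lambda>x. \<Sum>i\<in>I. f i x)"
  using assms(1) by (induction I rule: infinite_finite_induct) (auto intro: Ck_on_const Ck_on_add assms(2))

lemma Ck_on_bilinear:
  assumes b: "bounded_bilinear B" and fg: "Ck_on k W f" "Ck_on k W g" and W: "open W"
  shows "Ck_on k W (\<lambda>x. B (f x) (g x))"
  using fg
proof (induction k arbitrary: f g)
  case 0
  then show ?case using b by (auto intro: bounded_bilinear.continuous_on)
next
  case (Suc k)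
  from Suc.prems(1) obtain f'
    where f: "\<And>x. x \<in> W \<Longrightarrow> (f has_derivative f' x) (at x)" "\<And>v. Ck_on k W (\<lambda>x. f' x v)"
    by (rule Ck_on_SucE) blast
  from Suc.prems(2) obtain g'
    where g: "\<And>x. x \<in> W \<Longrightarrow> (g has_derivative g' x) (at x)" "\<And>v. Ck_on k W (\<lambda>x. g' x v)"
    by (rule Ck_on_SucE) blast
  show ?case
    using Suc.IH[OF Ck_on_SucD[OF Suc.prems(1)] g(2)] Suc.IH[OF f(2) Ck_on_SucD[OF Suc.prems(2)]] f(1) g(1) W
    by (intro Ck_on_SucI[where f'="\<lambda>x v. B (f x) (g' x v) + B (f' x v) (g x)"])
      (auto intro!: bounded_bilinear.FDERIV[OF b] Ck_on_add simp del: Ck_on.simps)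
qed

lemma Ck_on_Pair:
  assumes "Ck_on k W f" "Ck_on k W g" "open W" shows "Ck_on k W (\<lambda>x. (f x, g x))"
proof -
  have "Ck_on k W (\<lambda>x. (f x, 0) + (0, g x))"
    by (intro Ck_on_add Ck_on_linear_compose[of "\<lambda>a. (a, 0)"] Ck_on_linear_compose[of "\<lambda>a. (0, a)"] assms)
      (auto intro!: bounded_linear_Pair bounded_linear_ident bounded_linear_zero)
  then show ?thesis by simp
qed

text \<open>\<open>Ck_on\<close> controls a derivative along fixed directions only, whereas the
  chain rule evaluates \<open>f'\<close> in the moving direction \<open>g' x v\<close>. Expanding
  that direction in the basis of the Euclidean middle space separates scalar factors from
  \<open>f' (g x) i\<close> with fixed \<open>i\<close>.\<close>

lemma Ck_on_compose:
  fixes g :: "'a::real_normed_vector \<Rightarrow> 'b::euclidean_space"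
  assumes "Ck_on k W g" "Ck_on k V f" "g ` W \<subseteq> V" "open W" "open V"
  shows "Ck_on k W (\<lambda>x. f (g x))"
  using assms(1,2)
proof (induction k arbitrary: f)
  case 0
  then show ?case using assms(3) by (auto intro: continuous_on_compose2)
next
  case (Suc k)
  from Suc.prems(2) obtain f'
    where f: "\<And>x. x \<in> V \<Longrightarrow> (f has_derivative f' x) (at x)" "\<And>v. Ck_on k V (\<lambda>x. f' x v)"
    by (rule Ck_on_SucE) blast
  from Suc.prems(1) obtain g'
    where g: "\<And>x. x \<in> W \<Longrightarrow> (g has_derivative g' x) (at x)" "\<And>v. Ck_on k W (\<lambda>x. g' x v)"
    by (rule Ck_on_SucE) blast
  show ?case
  proof (rule Ck_on_SucI[where f'="\<lambda>x v. \<Sum>i\<in>Basis. (g' x v \<bullet> i) *\<^sub>R f' (g x) i"])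
    fix x assume x: "x \<in> W"
    then have fx: "(f has_derivative f' (g x)) (at (g x))" using f assms(3) by auto
    interpret bounded_linear "f' (g x)" using fx by (rule has_derivative_bounded_linear)
    have "f' (g x) u = (\<Sum>i\<in>Basis. (u \<bullet> i) *\<^sub>R f' (g x) i)" for u
      by (subst euclidean_representation[of u, symmetric]) (simp only: sum scaleR)
    then have "(\<lambda>v. f' (g x) (g' x v)) = (\<lambda>v. \<Sum>i\<in>Basis. (g' x v \<bullet> i) *\<^sub>R f' (g x) i)"
      by (intro ext)
    then show "((\<lambda>x. f (g x)) has_derivative (\<lambda>v. \<Sum>i\<in>Basis. (g' x v \<bullet> i) *\<^sub>R f' (g x) i)) (at x)"
      using has_derivative_compose[OF g(1)[OF x] fx] by simp
  next
    fix v
    show "Ck_on k W (\<lambda>x. \<Sum>i\<in>Basis. (g' x v \<bullet> i) *\<^sub>R f' (g x) i)"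
      using Suc.IH[OF Ck_on_SucD[OF Suc.prems(1)] f(2)] assms(4)
      by (intro Ck_on_sum Ck_on_bilinear[OF bounded_bilinear_scaleR]
          Ck_on_linear_compose[OF bounded_linear_inner_left] g) auto
  qed (rule assms(4))
qed

lemma Ck_on_inverse: "Ck_on k (- {0}) (inverse :: real \<Rightarrow> real)"
proof (induction k)
  case 0
  then show ?case by (auto intro: continuous_on_inverse continuous_on_id)
next
  case (Suc k)
  show ?case
  proof (rule Ck_on_SucI)
    show "(inverse has_derivative (\<lambda>v. - (inverse x * v * inverse x))) (at x)" if "x \<in> - {0}" for x :: real
      using that by (auto intro: has_derivative_inverse')
    show "Ck_on k (- {0}) (\<lambda>x::real. - (inverse x * v * inverse x))" for v
      by (intro Ck_on_linear_compose[OF bounded_linear_minus[OF bounded_linear_ident]]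
          Ck_on_bilinear[OF bounded_bilinear_mult] Ck_on_const Suc) auto
  qed auto
qed

section \<open>Continuous partial derivatives\<close>

lemma has_vector_derivative_line_shift:
  fixes f :: "'a::real_normed_vector \<Rightarrow> 'b::real_normed_vector"
  assumes "((\<lambda>r. f ((z + s *\<^sub>R i) + r *\<^sub>R i)) has_vector_derivative D) (at 0)"
  shows "((\<lambda>r. f (z + r *\<^sub>R i)) has_vector_derivative D) (at s)"
proof -
  have 1: "((\<lambda>r. r - s) has_vector_derivative 1) (at s)"
    by (auto intro!: derivative_eq_intros)
  have "((\<lambda>r. f ((z + s *\<^sub>R i) + r *\<^sub>R i)) \<circ> (\<lambda>r. r - s) has_vector_derivative 1 *\<^sub>R D) (at s)"
    by (rule vector_diff_chain_at[OF 1]) (use assms in simp)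
  moreover have "(z + s *\<^sub>R i) + (r - s) *\<^sub>R i = z + r *\<^sub>R i" for r
    by (simp add: algebra_simps)
  ultimately show ?thesis by (simp add: o_def)
qed

text \<open>The increment \<open>v = y - x\<close> is walked through one coordinate at a time. On
  each leg a single partial derivative enters, and a mean value estimate compares it with its value
  at the start of the leg and then with its value at \<open>x\<close>.\<close>

lemma has_derivative_partials_Basis:
  fixes f :: "'a::euclidean_space \<Rightarrow> 'b::real_normed_vector"
  assumes W: "open W" "x \<in> W"
    and D: "\<And>i y. i \<in> Basis \<Longrightarrow> y \<in> W \<Longrightarrow> ((\<lambda>s. f (y + s *\<^sub>R i)) has_vector_derivative D i y) (at 0)"
    and cont: "\<And>i. i \<in> Basis \<Longrightarrow> continuous_on W (D i)"
  shows "(f has_derivative (\<lambda>v. \<Sum>i\<in>Basis. (v \<bullet> i) *\<^sub>R D i x)) (at x)"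
  unfolding has_derivative_at_alt
proof (intro conjI allI impI)
  show "bounded_linear (\<lambda>v. \<Sum>i\<in>Basis. (v \<bullet> i) *\<^sub>R D i x)"
    by (intro bounded_linear_sum bounded_linear_scaleR_const bounded_linear_inner_left)
  fix e :: real assume e: "e > 0"
  \<comment> \<open>Each leg costs \<open>3 * e'\<close> times its length: \<open>2 * e'\<close> for
    the variation of \<open>D i\<close> along the leg and \<open>e'\<close> for replacing its
    starting point by \<open>x\<close>. There is one leg per basis vector.\<close>
  define e' where "e' = e / (3 * DIM('a))"
  have e': "e' > 0" using e by (simp add: e'_def)
  have "\<exists>d>0. \<forall>y\<in>ball x d. y \<in> W \<and> norm (D i y - D i x) < e'" if "i \<in> Basis" for i
  proof -
    have "continuous (at x) (D i)" using cont[OF that] W by (simp add: continuous_on_eq_continuous_at)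
    then obtain d where d: "d > 0" "\<And>y. dist y x < d \<Longrightarrow> dist (D i y) (D i x) < e'"
      using e' by (auto simp: continuous_at_eps_delta)
    obtain d2 where d2: "d2 > 0" "ball x d2 \<subseteq> W" using W by (meson openE)
    show ?thesis using d d2
      by (intro exI[of _ "min d d2"]) (auto simp: dist_norm norm_minus_commute subset_eq)
  qed
  then obtain d where d: "\<And>i. i \<in> Basis \<Longrightarrow> d i > 0"
    "\<And>i y. i \<in> Basis \<Longrightarrow> y \<in> ball x (d i) \<Longrightarrow> y \<in> W \<and> norm (D i y - D i x) < e'"
    by metis
  define d0 where "d0 = Min (d ` Basis)"
  have d0: "d0 > 0" using d by (auto simp: d0_def)
  have near: "y \<in> W \<and> norm (D i y - D i x) < e'" if "i \<in> Basis" "y \<in> ball x d0" for i y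
  proof -
    have "d0 \<le> d i" using that by (auto simp: d0_def)
    then show ?thesis using d(2)[OF that(1)] that(2) by auto
  qed
  show "\<exists>d>0. \<forall>y. norm (y - x) < d \<longrightarrow>
      norm (f y - f x - (\<Sum>i\<in>Basis. ((y - x) \<bullet> i) *\<^sub>R D i x)) \<le> e * norm (y - x)"
  proof (intro exI[of _ d0] conjI d0 allI impI)
    fix y assume y: "norm (y - x) < d0"
    define v where "v = y - x"
    have claim: "norm (f (x + (\<Sum>i\<in>B. (v \<bullet> i) *\<^sub>R i)) - f x - (\<Sum>i\<in>B. (v \<bullet> i) *\<^sub>R D i x))
        \<le> (\<Sum>i\<in>B. \<bar>v \<bullet> i\<bar> * (3 * e'))" if "finite B" "B \<subseteq> Basis" for B
      using that
    proof (induction B)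
      case (insert i B)
      define z where "z = x + (\<Sum>i\<in>B. (v \<bullet> i) *\<^sub>R i)"
      have iB: "i \<in> Basis" "B \<subseteq> Basis" "i \<notin> B" "finite B" using insert by auto
      \<comment> \<open>Coordinatewise the displacement from \<open>x\<close> is dominated by that
        of \<open>v\<close>, so its norm is at most \<open>norm v\<close> and the whole path stays
        in the ball.\<close>
      have ball: "z + s *\<^sub>R i \<in> ball x d0" if "\<bar>s\<bar> \<le> \<bar>v \<bullet> i\<bar>" for s
      proof -
        have "norm ((\<Sum>i\<in>B. (v \<bullet> i) *\<^sub>R i) + s *\<^sub>R i) \<le> norm v"
        proof (rule norm_le_componentwise)
          fix b :: 'a assume b: "b \<in> Basis"
          have "(\<Sum>i\<in>B. (v \<bullet> i) *\<^sub>R i) \<bullet> b = (\<Sum>i\<in>B. if i = b then v \<bullet> i else 0)"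
            unfolding inner_sum_left
            by (intro sum.cong refl) (use b iB in \<open>auto simp: inner_Basis subset_eq\<close>)
          also have "\<dots> = (if b \<in> B then v \<bullet> b else 0)" using iB by simp
          finally show "\<bar>((\<Sum>i\<in>B. (v \<bullet> i) *\<^sub>R i) + s *\<^sub>R i) \<bullet> b\<bar> \<le> \<bar>v \<bullet> b\<bar>"
            using b iB that by (auto simp: inner_add_left inner_Basis)
        qed
        moreover have "dist x (x + u) = norm u" for u by (simp add: dist_norm)
        ultimately show ?thesis using y unfolding z_def v_def[symmetric] mem_ball add.assoc by simp
      qed
      have seg: "\<bar>s\<bar> \<le> \<bar>v \<bullet> i\<bar>" if "s \<in> closed_segment 0 (v \<bullet> i)" for s
        using that by (auto simp: closed_segment_eq_real_ivl split: if_splits)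
      define F where "F s = f (z + s *\<^sub>R i)" for s
      define F' where "F' s = D i (z + s *\<^sub>R i)" for s
      have "norm (F (v \<bullet> i) - F 0 - (v \<bullet> i - 0) *\<^sub>R F' 0) \<le> norm (v \<bullet> i - 0) * (2 * e')"
      proof (rule vector_differentiable_bound_linearization[where S="closed_segment 0 (v \<bullet> i)" and f=F and f'=F'])
        show "(F has_vector_derivative F' s) (at s within closed_segment 0 (v \<bullet> i))"
          if "s \<in> closed_segment 0 (v \<bullet> i)" for s
          using near[OF iB(1) ball[OF seg[OF that]]] D[OF iB(1)] unfolding F_def[abs_def] F'_def
          by - (rule has_vector_derivative_at_within, rule has_vector_derivative_line_shift, blast)
        show "norm (F' s - F' 0) \<le> 2 * e'" if "s \<in> closed_segment 0 (v \<bullet> i)" for s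
          using near[OF iB(1) ball[OF seg[OF that]]] near[OF iB(1) ball[of 0]]
            norm_triangle_ineq4[of "D i (z + s *\<^sub>R i) - D i x" "D i (z + 0 *\<^sub>R i) - D i x"]
          by (auto simp: F'_def)
      qed auto
      then have "norm (f (z + (v \<bullet> i) *\<^sub>R i) - f z - (v \<bullet> i) *\<^sub>R D i z) \<le> \<bar>v \<bullet> i\<bar> * (2 * e')"
        by (simp add: F_def F'_def)
      moreover have "norm ((v \<bullet> i) *\<^sub>R (D i z - D i x)) \<le> \<bar>v \<bullet> i\<bar> * e'"
        using near[OF iB(1) ball[of 0]] by (auto intro!: mult_left_mono)
      ultimately have "norm (f (z + (v \<bullet> i) *\<^sub>R i) - f z - (v \<bullet> i) *\<^sub>R D i x) \<le> \<bar>v \<bullet> i\<bar> * (3 * e')"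
        using norm_triangle_ineq[of "f (z + (v \<bullet> i) *\<^sub>R i) - f z - (v \<bullet> i) *\<^sub>R D i z" "(v \<bullet> i) *\<^sub>R (D i z - D i x)"]
        by (simp add: algebra_simps)
      moreover have "norm (f z - f x - (\<Sum>i\<in>B. (v \<bullet> i) *\<^sub>R D i x)) \<le> (\<Sum>i\<in>B. \<bar>v \<bullet> i\<bar> * (3 * e'))"
        using insert.IH iB by (simp add: z_def)
      moreover have e3: "f (x + (\<Sum>i\<in>insert i B. (v \<bullet> i) *\<^sub>R i)) - f x - (\<Sum>i\<in>insert i B. (v \<bullet> i) *\<^sub>R D i x)
          = (f (z + (v \<bullet> i) *\<^sub>R i) - f z - (v \<bullet> i) *\<^sub>R D i x) + (f z - f x - (\<Sum>i\<in>B. (v \<bullet> i) *\<^sub>R D i x))"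
        using iB by (simp add: z_def algebra_simps)
      moreover have "(\<Sum>j\<in>insert i B. \<bar>v \<bullet> j\<bar> * (3 * e')) = \<bar>v \<bullet> i\<bar> * (3 * e') + (\<Sum>j\<in>B. \<bar>v \<bullet> j\<bar> * (3 * e'))"
        using iB by simp
      ultimately show ?case unfolding e3
        using norm_triangle_ineq[of "f (z + (v \<bullet> i) *\<^sub>R i) - f z - (v \<bullet> i) *\<^sub>R D i x"
          "f z - f x - (\<Sum>i\<in>B. (v \<bullet> i) *\<^sub>R D i x)"]
        by linarith
    qed simp
    have "(\<Sum>i\<in>Basis. \<bar>v \<bullet> i\<bar> * (3 * e')) \<le> (\<Sum>i\<in>(Basis::'a set). norm v * (3 * e'))"
      using e' by (intro sum_mono mult_right_mono Basis_le_norm) auto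
    also have "\<dots> = e * norm v" by (simp add: e'_def)
    finally show "norm (f y - f x - (\<Sum>i\<in>Basis. ((y - x) \<bullet> i) *\<^sub>R D i x)) \<le> e * norm (y - x)"
      using claim[of Basis] by (simp add: euclidean_representation v_def)
  qed
qed

text \<open>Serves functions known only through their partial derivatives. For solutions of a
  differential equation, one partial comes from the equation itself and the others from its
  linearization.\<close>

lemma Ck_on_partials:
  fixes f :: "'a::euclidean_space \<Rightarrow> 'b::real_normed_vector"
  assumes W: "open W"
    and D: "\<And>i y. i \<in> Basis \<Longrightarrow> y \<in> W \<Longrightarrow> ((\<lambda>s. f (y + s *\<^sub>R i)) has_vector_derivative D i y) (at 0)"
    and Ck: "\<And>i. i \<in> Basis \<Longrightarrow> Ck_on k W (D i)"
  shows "Ck_on (Suc k) W f"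
proof (rule Ck_on_SucI[where f'="\<lambda>x v. \<Sum>i\<in>Basis. (v \<bullet> i) *\<^sub>R D i x"])
  show "(f has_derivative (\<lambda>v. \<Sum>i\<in>Basis. (v \<bullet> i) *\<^sub>R D i x)) (at x)" if "x \<in> W" for x
    by (rule has_derivative_partials_Basis[OF W that D Ck_on_imp_continuous_on[OF Ck]])
  show "Ck_on k W (\<lambda>x. \<Sum>i\<in>Basis. (v \<bullet> i) *\<^sub>R D i x)" for v
    by (intro Ck_on_sum Ck_on_linear_compose[OF bounded_linear_scaleR_right] Ck W)
qed (rule W)

section \<open>Smoothness on arbitrary sets\<close>

lemma smooth_onI: "open W \<Longrightarrow> (\<And>k. Ck_on k W f) \<Longrightarrow> S \<subseteq> W \<Longrightarrow> smooth_on S f"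
  unfolding smooth_on_def by blast

lemma smooth_onE:
  assumes "smooth_on S f" "x \<in> S"
  obtains W g where "open W" "x \<in> W" "\<And>k. Ck_on k W g" "\<And>y. y \<in> S \<Longrightarrow> y \<in> W \<Longrightarrow> f y = g y"
  using assms unfolding smooth_on_def by (meson Int_iff)

lemma smooth_on_subset_cong:
  assumes "smooth_on S f" "T \<subseteq> S" "\<And>x. x \<in> T \<Longrightarrow> f x = g x"
  shows "smooth_on T g"
  unfolding smooth_on_def
proof
  fix x assume x: "x \<in> T"
  then obtain W h where "open W" "x \<in> W" "\<And>k. Ck_on k W h" "\<And>y. y \<in> S \<Longrightarrow> y \<in> W \<Longrightarrow> f y = h y"
    using smooth_onE[OF assms(1)] assms(2) by (metis subsetD)
  then show "\<exists>W h. open W \<and> x \<in> W \<and> (\<forall>k. Ck_on k W h) \<and> (\<forall>y\<in>T \<inter> W. g y = h y)"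
    using assms(2,3) by (intro exI[of _ W] exI[of _ h]) force
qed

lemma smooth_on_subset: "smooth_on S f \<Longrightarrow> T \<subseteq> S \<Longrightarrow> smooth_on T f"
  by (erule smooth_on_subset_cong) auto

lemma smooth_on_cong: "smooth_on S f \<Longrightarrow> (\<And>x. x \<in> S \<Longrightarrow> f x = g x) \<Longrightarrow> smooth_on S g"
  by (erule smooth_on_subset_cong) auto

lemma smooth_on_local:
  assumes "\<And>x. x \<in> S \<Longrightarrow> \<exists>W. open W \<and> x \<in> W \<and> smooth_on (S \<inter> W) f"
  shows "smooth_on S f"
  unfolding smooth_on_def
proof
  fix x assume "x \<in> S"
  with assms obtain W where W: "open W" "x \<in> W" "smooth_on (S \<inter> W) f" by blast
  with \<open>x \<in> S\<close> obtain V g where "open V" "x \<in> V" "\<And>k. Ck_on k V g" "\<And>y. y \<in> S \<inter> W \<Longrightarrow> y \<in> V \<Longrightarrow> f y = g y"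
    using smooth_onE[OF W(3), of x] by (metis IntI)
  then show "\<exists>W g. open W \<and> x \<in> W \<and> (\<forall>k. Ck_on k W g) \<and> (\<forall>y\<in>S \<inter> W. f y = g y)"
    using W by (intro exI[of _ "W \<inter> V"] exI[of _ g]) (auto intro: Ck_on_subset)
qed

text \<open>On an open set a local extension coincides with \<open>f\<close> near the point, so
  extendability collapses to ordinary differentiability of all orders.\<close>

lemma smooth_on_open_imp_Ck:
  assumes "smooth_on S f" "open S" shows "Ck_on k S f"
proof (rule Ck_on_local)
  fix x assume "x \<in> S"
  obtain W g where W: "open W" "x \<in> W" "\<And>k. Ck_on k W g" "\<And>y. y \<in> S \<Longrightarrow> y \<in> W \<Longrightarrow> f y = g y"
    using smooth_onE[OF assms(1) \<open>x \<in> S\<close>] by metis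
  have "Ck_on k (S \<inter> W) f"
    by (rule Ck_on_cong[OF Ck_on_subset[OF W(3)]]) (use W assms(2) in auto)
  then show "\<exists>V. open V \<and> x \<in> V \<and> Ck_on k V f" using W assms(2) \<open>x \<in> S\<close> by blast
qed

lemma smooth_on_continuous_on:
  assumes "smooth_on S f" shows "continuous_on S f"
  unfolding continuous_on_eq_continuous_within
proof
  fix x assume x: "x \<in> S"
  obtain W g where W: "open W" "x \<in> W" "\<And>k. Ck_on k W g" "\<And>y. y \<in> S \<Longrightarrow> y \<in> W \<Longrightarrow> f y = g y"
    using smooth_onE[OF assms x] by metis
  have "continuous (at x within S) g"
    using Ck_on_imp_continuous_on[OF W(3)] W(1,2)
    by (simp add: continuous_at_imp_continuous_within continuous_on_eq_continuous_at)
  moreover have "\<forall>\<^sub>F y in at x within S. g y = f y"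
    using W x by (auto simp: eventually_at_topological)
  ultimately show "continuous (at x within S) f"
    using W x unfolding continuous_within by (metis tendsto_cong)
qed

lemma smooth_on_const: "smooth_on S (\<lambda>x. c)"
  by (rule smooth_onI[of UNIV]) (auto intro: Ck_on_const)

lemma smooth_on_linear: "bounded_linear L \<Longrightarrow> smooth_on S L"
  by (rule smooth_onI[of UNIV]) (auto intro: Ck_on_linear)

lemma smooth_on_id: "smooth_on S (\<lambda>x. x)"
  by (rule smooth_on_linear) (rule bounded_linear_ident)

lemma smooth_on_compose:
  fixes f :: "'a::real_normed_vector \<Rightarrow> 'b::euclidean_space"
  assumes "smooth_on S f" "smooth_on T g" "f ` S \<subseteq> T"
  shows "smooth_on S (\<lambda>x. g (f x))"
  unfolding smooth_on_def
proof
  fix x assume x: "x \<in> S"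
  obtain W f' where W: "open W" "x \<in> W" "\<And>k. Ck_on k W f'" "\<And>y. y \<in> S \<Longrightarrow> y \<in> W \<Longrightarrow> f y = f' y"
    using smooth_onE[OF assms(1) x] by metis
  obtain V g' where V: "open V" "f x \<in> V" "\<And>k. Ck_on k V g'" "\<And>y. y \<in> T \<Longrightarrow> y \<in> V \<Longrightarrow> g y = g' y"
    using smooth_onE[OF assms(2), of "f x"] assms(3) x by (metis imageI subsetD)
  have op: "open (W \<inter> f' -` V)"
    using continuous_open_preimage[OF Ck_on_imp_continuous_on[OF W(3)] W(1) V(1)] .
  show "\<exists>W h. open W \<and> x \<in> W \<and> (\<forall>k. Ck_on k W h) \<and> (\<forall>y\<in>S \<inter> W. g (f y) = h y)"
  proof (intro exI[of _ "W \<inter> f' -` V"] exI[of _ "\<lambda>x. g' (f' x)"] conjI op allI)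
    show "Ck_on k (W \<inter> f' -` V) (\<lambda>x. g' (f' x))" for k
      by (rule Ck_on_compose[OF Ck_on_subset[OF W(3)] V(3)]) (use op V in auto)
  qed (use W V x assms(3) in auto)
qed

lemma smooth_on_Pair:
  assumes "smooth_on S f" "smooth_on S g" shows "smooth_on S (\<lambda>x. (f x, g x))"
  unfolding smooth_on_def
proof
  fix x assume x: "x \<in> S"
  obtain W f' where W: "open W" "x \<in> W" "\<And>k. Ck_on k W f'" "\<And>y. y \<in> S \<Longrightarrow> y \<in> W \<Longrightarrow> f y = f' y"
    using smooth_onE[OF assms(1) x] by metis
  obtain V g' where V: "open V" "x \<in> V" "\<And>k. Ck_on k V g'" "\<And>y. y \<in> S \<Longrightarrow> y \<in> V \<Longrightarrow> g y = g' y"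
    using smooth_onE[OF assms(2) x] by metis
  show "\<exists>W h. open W \<and> x \<in> W \<and> (\<forall>k. Ck_on k W h) \<and> (\<forall>y\<in>S \<inter> W. (f y, g y) = h y)"
    using W V by (intro exI[of _ "W \<inter> V"] exI[of _ "\<lambda>x. (f' x, g' x)"])
      (auto intro!: Ck_on_Pair Ck_on_subset[OF W(3)] Ck_on_subset[OF V(3)])
qed

lemma smooth_on_linear_compose:
  fixes f :: "'a::real_normed_vector \<Rightarrow> 'b::euclidean_space"
  assumes "bounded_linear L" "smooth_on S f" shows "smooth_on S (\<lambda>x. L (f x))"
  by (rule smooth_on_compose[OF assms(2) smooth_on_linear[OF assms(1), of UNIV]]) simp

lemma smooth_on_bilinear:
  fixes f :: "'a::real_normed_vector \<Rightarrow> 'b::euclidean_space"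
    and g :: "'a::real_normed_vector \<Rightarrow> 'c::euclidean_space"
  assumes b: "bounded_bilinear B" and fg: "smooth_on S f" "smooth_on S g"
  shows "smooth_on S (\<lambda>x. B (f x) (g x))"
proof -
  have "smooth_on UNIV (\<lambda>z. B (fst z) (snd z))"
    by (rule smooth_onI[OF open_UNIV Ck_on_bilinear[OF b Ck_on_linear[OF bounded_linear_fst]
            Ck_on_linear[OF bounded_linear_snd] open_UNIV]]) simp
  from smooth_on_compose[OF smooth_on_Pair[OF fg] this] show ?thesis by simp
qed

lemma smooth_on_add:
  fixes f g :: "'a::real_normed_vector \<Rightarrow> 'b::euclidean_space"
  assumes "smooth_on S f" "smooth_on S g" shows "smooth_on S (\<lambda>x. f x + g x)"
proof -
  have "bounded_linear (\<lambda>z::'b \<times> 'b. fst z + snd z)"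
    by (intro bounded_linear_add bounded_linear_fst bounded_linear_snd)
  from smooth_on_linear_compose[OF this smooth_on_Pair[OF assms]] show ?thesis by simp
qed

lemma smooth_on_sum:
  fixes f :: "'i \<Rightarrow> 'a::real_normed_vector \<Rightarrow> 'b::euclidean_space"
  assumes "\<And>i. i \<in> I \<Longrightarrow> smooth_on S (f i)"
  shows "smooth_on S (\<lambda>x. \<Sum>i\<in>I. f i x)"
  using assms by (induction I rule: infinite_finite_induct) (auto intro: smooth_on_const smooth_on_add)

lemma smooth_on_componentwise:
  fixes f :: "'a::real_normed_vector \<Rightarrow> 'b::euclidean_space"
  assumes "\<And>i. i \<in> Basis \<Longrightarrow> smooth_on S (\<lambda>x. f x \<bullet> i)"
  shows "smooth_on S f"
proof -
  have "smooth_on S (\<lambda>x. \<Sum>i\<in>Basis. (f x \<bullet> i) *\<^sub>R i)"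
    by (intro smooth_on_sum smooth_on_linear_compose[OF bounded_linear_scaleR_left] assms)
  then show ?thesis by (simp add: euclidean_representation)
qed

lemma smooth_on_mult:
  fixes f g :: "'a::real_normed_vector \<Rightarrow> real"
  shows "smooth_on S f \<Longrightarrow> smooth_on S g \<Longrightarrow> smooth_on S (\<lambda>x. f x * g x)"
  by (rule smooth_on_bilinear[OF bounded_bilinear_mult])

lemma smooth_on_power:
  fixes f :: "'a::real_normed_vector \<Rightarrow> real"
  shows "smooth_on S f \<Longrightarrow> smooth_on S (\<lambda>x. f x ^ n)"
  by (induction n) (auto intro: smooth_on_const smooth_on_mult)

lemma smooth_on_divide:
  fixes f g :: "'a::real_normed_vector \<Rightarrow> real"
  assumes "smooth_on S f" "smooth_on S g" "\<And>x. x \<in> S \<Longrightarrow> g x \<noteq> 0"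
  shows "smooth_on S (\<lambda>x. f x / g x)"
proof -
  have "smooth_on (- {0}) (inverse :: real \<Rightarrow> real)"
    by (rule smooth_onI[of "- {0}"]) (auto intro: Ck_on_inverse)
  from smooth_on_compose[OF assms(2) this] have "smooth_on S (\<lambda>x. inverse (g x))"
    using assms(3) by (meson Compl_iff image_subsetI singletonD)
  from smooth_on_mult[OF assms(1) this] show ?thesis by (simp add: divide_inverse)
qed

section \<open>Differential equations with parameters\<close>

text \<open>The squared norm is used because the norm is not differentiable at zero. By
  \<open>2 * norm (u s) * e \<le> (norm (u s))^2 + e^2\<close>, the derivative of
  \<open>u s \<bullet> u s\<close> is at most
  \<open>(2 * L + 1) * (u s \<bullet> u s) + e^2\<close>, which explains the constant
  \<open>K\<close>; with the integrating factor, \<open>E\<close> becomes nonincreasing.\<close>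

lemma gronwall_nonneg:
  fixes u :: "real \<Rightarrow> 'a::real_inner"
  assumes t: "0 \<le> t" and u: "\<And>s. s \<in> {0..t} \<Longrightarrow> (u has_vector_derivative u' s) (at s)"
    and bd: "\<And>s. s \<in> {0..t} \<Longrightarrow> norm (u' s) \<le> L * norm (u s) + e" and "0 \<le> L" "0 \<le> e"
  shows "(norm (u t))\<^sup>2 \<le> exp ((2 * L + 1) * t) * ((norm (u 0))\<^sup>2 + e\<^sup>2 * t)"
proof -
  define K where "K = 2 * L + 1"
  define E where "E s = exp (- K * s) * (u s \<bullet> u s) - e\<^sup>2 * s" for s
  define E' where "E' s = exp (- K * s) * (2 * (u s \<bullet> u' s) - K * (u s \<bullet> u s)) - e\<^sup>2" for s
  have D: "(E has_real_derivative E' s) (at s)" if "s \<in> {0..t}" for s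
  proof -
    have d: "((\<lambda>s. u s \<bullet> u s) has_real_derivative 2 * (u s \<bullet> u' s)) (at s)"
      using bounded_bilinear.has_vector_derivative[OF bounded_bilinear_inner u[OF that] u[OF that]]
      by (simp add: has_real_derivative_iff_has_vector_derivative inner_commute)
    have e: "((\<lambda>s. exp (- K * s)) has_real_derivative exp (- K * s) * (- K)) (at s)"
      by (auto intro!: derivative_eq_intros)
    have "((\<lambda>s. e\<^sup>2 * s) has_real_derivative e\<^sup>2) (at s)"
      by (auto intro!: derivative_eq_intros)
    from DERIV_diff[OF DERIV_mult[OF e d] this] show ?thesis
      unfolding E_def[abs_def] E'_def by (simp add: algebra_simps)
  qed
  have neg: "E' s \<le> 0" if "s \<in> {0..t}" for s
  proof -
    have "u s \<bullet> u' s \<le> norm (u s) * norm (u' s)" by (rule norm_cauchy_schwarz)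
    also have "\<dots> \<le> norm (u s) * (L * norm (u s) + e)" by (intro mult_left_mono bd that) auto
    finally have "2 * (u s \<bullet> u' s) \<le> 2 * L * (norm (u s))\<^sup>2 + 2 * norm (u s) * e"
      by (simp add: power2_eq_square algebra_simps)
    moreover have "2 * norm (u s) * e \<le> (norm (u s))\<^sup>2 + e\<^sup>2" by (rule sum_squares_bound)
    ultimately have "2 * (u s \<bullet> u' s) - K * (u s \<bullet> u s) \<le> e\<^sup>2"
      by (simp add: K_def dot_square_norm algebra_simps)
    then have "exp (- K * s) * (2 * (u s \<bullet> u' s) - K * (u s \<bullet> u s)) \<le> exp (- K * s) * e\<^sup>2"
      by (rule mult_left_mono) simp
    also have "\<dots> \<le> 1 * e\<^sup>2"
    proof (rule mult_right_mono)
      have "0 \<le> K * s" using that \<open>0 \<le> L\<close> by (intro mult_nonneg_nonneg) (auto simp: K_def)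
      then show "exp (- K * s) \<le> 1" by simp
    qed simp
    finally show ?thesis by (simp add: E'_def)
  qed
  have "E t \<le> E 0"
    by (rule DERIV_nonpos_imp_nonincreasing[OF t]) (use D neg in \<open>meson atLeastAtMost_iff\<close>)
  then have "exp (- K * t) * (norm (u t))\<^sup>2 \<le> (norm (u 0))\<^sup>2 + e\<^sup>2 * t"
    by (simp add: E_def dot_square_norm)
  then have "exp (K * t) * (exp (- K * t) * (norm (u t))\<^sup>2) \<le> exp (K * t) * ((norm (u 0))\<^sup>2 + e\<^sup>2 * t)"
    by (rule mult_left_mono) simp
  moreover have "exp (K * t) * (exp (- K * t) * X) = X" for X
    by (simp add: mult.assoc[symmetric] flip: exp_add)
  ultimately show ?thesis by (simp only: flip: K_def)
qed

lemma gronwall: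
  fixes u :: "real \<Rightarrow> 'a::real_inner"
  assumes u: "\<And>s. s \<in> closed_segment 0 t \<Longrightarrow> (u has_vector_derivative u' s) (at s)"
    and bd: "\<And>s. s \<in> closed_segment 0 t \<Longrightarrow> norm (u' s) \<le> L * norm (u s) + e" and "0 \<le> L" "0 \<le> e"
  shows "(norm (u t))\<^sup>2 \<le> exp ((2 * L + 1) * \<bar>t\<bar>) * ((norm (u 0))\<^sup>2 + e\<^sup>2 * \<bar>t\<bar>)"
proof (cases "0 \<le> t")
  case True
  then show ?thesis using gronwall_nonneg[of t u u' L e] assms
    by (auto simp: closed_segment_eq_real_ivl)
next
  case False
  have "((\<lambda>s. u (- s)) has_vector_derivative - u' (- s)) (at s)" if "s \<in> {0..-t}" for s
  proof -
    have "(uminus has_vector_derivative - 1) (at s)" for s :: real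
      by (auto intro!: derivative_eq_intros)
    moreover have "(u has_vector_derivative u' (- s)) (at (- s))"
      using u[of "- s"] that False by (auto simp: closed_segment_eq_real_ivl)
    ultimately show ?thesis using vector_diff_chain_at[of uminus "-1" s u] by (simp add: o_def)
  qed
  moreover have "norm (- u' (- s)) \<le> L * norm (u (- s)) + e" if "s \<in> {0..-t}" for s
    using bd[of "- s"] that False by (auto simp: closed_segment_eq_real_ivl)
  ultimately show ?thesis
    using gronwall_nonneg[of "- t" "\<lambda>s. u (- s)" "\<lambda>s. - u' (- s)" L e] assms(3,4) False
    by simp
qed

section \<open>Uniform bounds and linearizations over compact sets\<close>

lemma linear_le_sum_Basis:
  fixes A :: "'a::euclidean_space \<Rightarrow> 'b::real_normed_vector"
  assumes "linear A" "\<And>i. i \<in> Basis \<Longrightarrow> norm (A i) \<le> B i"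
  shows "norm (A v) \<le> (\<Sum>i\<in>Basis. B i) * norm v"
proof -
  have "A v = (\<Sum>i\<in>Basis. (v \<bullet> i) *\<^sub>R A i)"
    by (subst (1) euclidean_representation[of v, symmetric])
      (simp only: linear_sum[OF assms(1)] linear_scale[OF assms(1)])
  also have "norm \<dots> \<le> (\<Sum>i\<in>Basis. norm ((v \<bullet> i) *\<^sub>R A i))" by (rule norm_sum)
  also have "\<dots> \<le> (\<Sum>i\<in>Basis. B i * norm v)"
  proof (rule sum_mono)
    fix i :: 'a assume i: "i \<in> Basis"
    have "\<bar>v \<bullet> i\<bar> * norm (A i) \<le> norm v * B i"
      using i assms(2)[OF i] by (intro mult_mono Basis_le_norm) auto
    then show "norm ((v \<bullet> i) *\<^sub>R A i) \<le> B i * norm v" by (simp add: mult.commute)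
  qed
  finally show ?thesis by (simp add: sum_distrib_right)
qed

text \<open>Continuity is available only for each fixed argument \<open>v\<close>. Bounds on the
  finitely many basis vectors already bound the operator norms uniformly over
  \<open>C\<close>.\<close>

lemma compact_linear_bound:
  fixes A :: "'c::topological_space \<Rightarrow> 'a::euclidean_space \<Rightarrow> 'b::real_normed_vector"
  assumes "compact C" "\<And>c. c \<in> C \<Longrightarrow> linear (A c)" "\<And>v. continuous_on C (\<lambda>c. A c v)"
  obtains L where "L \<ge> 0" "\<And>c v. c \<in> C \<Longrightarrow> norm (A c v) \<le> L * norm v"
proof -
  have "\<exists>B\<ge>0. \<forall>c\<in>C. norm (A c i) \<le> B" for i
  proof -
    have "bounded ((\<lambda>c. A c i) ` C)"
      by (intro compact_imp_bounded compact_continuous_image assms)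
    then obtain B where "\<forall>c\<in>C. norm (A c i) \<le> B" by (auto simp: bounded_iff)
    then show ?thesis by (intro exI[of _ "max 0 B"]) auto
  qed
  then obtain B where B: "\<And>i. B i \<ge> 0" "\<And>i c. c \<in> C \<Longrightarrow> norm (A c i) \<le> B i" by metis
  show ?thesis
    by (rule that[of "\<Sum>i\<in>Basis. B i"]) (use B linear_le_sum_Basis[OF assms(2)] in \<open>auto intro: sum_nonneg\<close>)
qed

text \<open>A set is \<open>good\<close> if the estimate holds with any of its points as base point,
  not merely one centre. Hence a Lebesgue number of the cover of \<open>C\<close> by good sets is a
  radius valid for all base points simultaneously.\<close>

lemma uniform_linearization:
  fixes f :: "'a::euclidean_space \<Rightarrow> 'b::real_normed_vector"
  assumes W: "open W" and f': "\<And>x. x \<in> W \<Longrightarrow> (f has_derivative f' x) (at x)"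
    and cont: "\<And>v. continuous_on W (\<lambda>x. f' x v)" and C: "compact C" "C \<subseteq> W" and e: "e > 0"
  obtains d where "d > 0" "\<And>c v. c \<in> C \<Longrightarrow> norm v < d \<Longrightarrow>
    c + v \<in> W \<and> norm (f (c + v) - f c - f' c v) \<le> e * norm v"
proof -
  define good where "good B \<longleftrightarrow> open B \<and> B \<subseteq> W \<and>
    (\<forall>y\<in>B. \<forall>z\<in>B. norm (f z - f y - f' y (z - y)) \<le> e * norm (z - y))" for B
  have "\<exists>B. good B \<and> c \<in> B" if c: "c \<in> C" for c
  proof -
    \<comment> \<open>On each basis vector both \<open>f' x\<close> and \<open>f' y\<close> lie
      within \<open>e'\<close> of \<open>f' c\<close>, so they differ there by at most
      \<open>2 * e'\<close>, and by at most \<open>e\<close> in operator norm.\<close>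
    define e' where "e' = e / (2 * DIM('a))"
    have e': "e' > 0" using e by (simp add: e'_def)
    have cW: "c \<in> W" using c C by auto
    have "open (W \<inter> (\<lambda>x. f' x i) -` ball (f' c i) e')" for i
      by (rule continuous_open_preimage[OF cont W]) simp
    then have "open (W \<inter> (\<Inter>i\<in>Basis. W \<inter> (\<lambda>x. f' x i) -` ball (f' c i) e'))"
      using W by (intro open_Int open_INT) auto
    then obtain r where r: "r > 0" "ball c r \<subseteq> W \<inter> (\<Inter>i\<in>Basis. W \<inter> (\<lambda>x. f' x i) -` ball (f' c i) e')"
      using cW e' by (metis (no_types, lifting) IntI INT_I centre_in_ball openE vimageI)
    have near: "norm (f' y i - f' c i) \<le> e'" if "y \<in> ball c r" "i \<in> Basis" for y i
    proof -
      have "dist (f' c i) (f' y i) < e'" using r(2) that by auto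
      then show ?thesis by (simp add: dist_norm norm_minus_commute)
    qed
    have "good (ball c r)" unfolding good_def
    proof (intro conjI ballI)
      show "ball c r \<subseteq> W" using r by auto
      fix y z assume yz: "y \<in> ball c r" "z \<in> ball c r"
      have "norm (f z - f y - f' y (z - y)) \<le> norm (z - y) * e"
      proof (rule differentiable_bound_linearization[where S="ball c r" and f=f and f'=f'])
        show "y + t *\<^sub>R (z - y) \<in> ball c r" if "t \<in> {0..1}" for t
          using convexD_alt[OF convex_ball[of c r] yz, of t] that by (simp add: algebra_simps)
        show "(f has_derivative f' x) (at x within ball c r)" if "x \<in> ball c r" for x
          using has_derivative_at_withinI[OF f'] that r(2) by (metis IntD1 subsetD)
        show "onorm (f' x - f' y) \<le> e" if x: "x \<in> ball c r" for x
          unfolding fun_diff_def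
        proof (rule onorm_le)
          fix v
          have lin: "linear (\<lambda>v. f' x v - f' y v)"
            using has_derivative_linear[OF f'] r(2) x yz(1)
            by (intro linear_compose_sub) (metis IntD1 subsetD)+
          have "norm (f' x v - f' y v) \<le> (\<Sum>i\<in>(Basis::'a set). 2 * e') * norm v"
          proof (rule linear_le_sum_Basis[OF lin])
            fix i :: 'a assume "i \<in> Basis"
            then show "norm (f' x i - f' y i) \<le> 2 * e'"
              using near[of x i] near[of y i] x yz
                norm_triangle_ineq4[of "f' x i - f' c i" "f' y i - f' c i"] by auto
          qed
          then show "norm (f' x v - f' y v) \<le> e * norm v" by (simp add: e'_def)
        qed
      qed (use yz in auto)
      then show "norm (f z - f y - f' y (z - y)) \<le> e * norm (z - y)" by (simp add: mult.commute)
    qed simp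
    then show ?thesis using r(1) by (intro exI[of _ "ball c r"]) auto
  qed
  then have "C \<subseteq> \<Union>{B. good B}" by blast
  moreover have "open B" if "B \<in> {B. good B}" for B using that by (simp add: good_def)
  ultimately obtain d where d: "d > 0" "\<And>c. c \<in> C \<Longrightarrow> \<exists>B\<in>{B. good B}. ball c d \<subseteq> B"
    using Heine_Borel_lemma[OF C(1)] by metis
  show ?thesis
  proof (rule that[OF d(1)])
    fix c v :: 'a assume cv: "c \<in> C" "norm v < d"
    then obtain B where B: "good B" "ball c d \<subseteq> B" using d(2) by auto
    have "c \<in> ball c d" "c + v \<in> ball c d" using cv d(1) by (auto simp: dist_norm)
    then have "c \<in> B" "c + v \<in> B" using B by auto
    then have "c + v \<in> W \<and> norm (f (c + v) - f c - f' c (c + v - c)) \<le> e * norm (c + v - c)"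
      using B(1) unfolding good_def by blast
    then show "c + v \<in> W \<and> norm (f (c + v) - f c - f' c v) \<le> e * norm v"
      by (simp only: add_diff_cancel_left')
  qed
qed


text \<open>The difference quotients \<open>Q h\<close> satisfy the linearized equation up to an error that tends to
  zero, so Gronwall's inequality makes them uniformly Cauchy as \<open>h \<rightarrow> 0\<close>.  No existence theorem for
  the linearized equation is needed: its solution arises as the limit.\<close>

lemma param_ode_local:
  fixes F :: "real \<times> 'p::euclidean_space \<times> 'e::euclidean_space \<Rightarrow> 'e" and y :: "real \<times> 'p \<Rightarrow> 'e"
  assumes ab: "a < 0" "0 < b" and r: "r > 0"
    and W: "open W" and F: "\<And>z. z \<in> W \<Longrightarrow> (F has_derivative F' z) (at z)"
    and F'c: "\<And>v. continuous_on W (\<lambda>z. F' z v)"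
    and yc: "continuous_on ({a..b} \<times> cball x0 (2 * r)) y"
    and gr: "\<And>t x. t \<in> {a..b} \<Longrightarrow> x \<in> cball x0 (2 * r) \<Longrightarrow> (t, x, y (t, x)) \<in> W"
    and ode: "\<And>t x. t \<in> {a..b} \<Longrightarrow> x \<in> cball x0 (2 * r) \<Longrightarrow>
      ((\<lambda>s. y (s, x)) has_vector_derivative F (t, x, y (t, x))) (at t)"
    and P: "open P" "cball x0 r \<subseteq> P"
    and y0: "\<And>x. x \<in> P \<Longrightarrow> ((\<lambda>x. y (0, x)) has_derivative D0 x) (at x)"
    and D0c: "\<And>v. continuous_on P (\<lambda>x. D0 x v)"
  obtains z where "continuous_on ({a..b} \<times> cball x0 r) z"
    "\<And>t x. t \<in> {a..b} \<Longrightarrow> x \<in> cball x0 r \<Longrightarrow>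
      ((\<lambda>s. y (t, x + s *\<^sub>R v)) has_vector_derivative z (t, x)) (at 0)"
    "\<And>t x. t \<in> {a..b} \<Longrightarrow> x \<in> cball x0 r \<Longrightarrow>
      ((\<lambda>s. z (s, x)) has_vector_derivative F' (t, x, y (t, x)) (0, v, z (t, x))) (at t within {a..b})"
proof -
  \<comment> \<open>\<open>K\<close> has parameter radius \<open>r\<close> while the solution is
    given over radius \<open>2 * r\<close>; the margin accommodates the displaced parameter
    \<open>x + h v\<close>.\<close>
  define K where "K = {a..b} \<times> cball x0 r"
  define c where "c p = (fst p, snd p, y p)" for p :: "real \<times> 'p"
  define T where "T = max (- a) b"
  have T: "T > 0" "\<And>t. t \<in> {a..b} \<Longrightarrow> \<bar>t\<bar> \<le> T" using ab by (auto simp: T_def)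
  have seg: "closed_segment 0 t \<subseteq> {a..b}" if "t \<in> {a..b}" for t
    using that ab by (auto simp: closed_segment_eq_real_ivl)
  have K: "compact K" by (auto simp: K_def intro: compact_Times)
  have KD: "K \<subseteq> {a..b} \<times> cball x0 (2 * r)" using r by (auto simp: K_def)
  have yK: "continuous_on K y" by (rule continuous_on_subset[OF yc KD])
  have cK: "continuous_on K c"
    unfolding c_def by (intro continuous_intros yK)
  have ccK: "compact (c ` K)" by (rule compact_continuous_image[OF cK K])
  have cW: "c ` K \<subseteq> W" using gr KD by (force simp: c_def)
  have linF: "linear (F' (c p))" if "p \<in> K" for p
    using F[of "c p"] cW that by (auto intro: has_derivative_linear)
  obtain L where L: "L \<ge> 0" "\<And>p w. p \<in> K \<Longrightarrow> norm (F' (c p) w) \<le> L * norm w"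
  proof (rule compact_linear_bound[OF K, of "\<lambda>p. F' (c p)"])
    show "continuous_on K (\<lambda>p. F' (c p) v)" for v
      using continuous_on_compose2[OF F'c cK cW] .
  qed (use linF in auto)
  define Q where "Q h p = (1 / h) *\<^sub>R (y (fst p, snd p + h *\<^sub>R v) - y p)" for h p
  define G where "G h p = (1 / h) *\<^sub>R (F (c (fst p, snd p + h *\<^sub>R v)) - F (c p))" for h p
  \<comment> \<open>\<open>G h\<close> is the time derivative of the quotient \<open>Q h\<close>.
    The error in the linearized equation is relative to \<open>norm (Q h p)\<close>, for which no
    bound is known at this stage.\<close>
  have st1: "\<exists>\<delta>>0. \<forall>h. 0 < \<bar>h\<bar> \<and> \<bar>h\<bar> < \<delta> \<longrightarrow> (\<forall>p\<in>K. snd p + h *\<^sub>R v \<in> cball x0 (2 * r) \<and>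
      norm (G h p - F' (c p) (0, v, Q h p)) \<le> \<eta> * (norm v + norm (Q h p)))" if \<eta>: "\<eta> > 0" for \<eta>
  proof -
    obtain d where d: "d > 0" "\<And>x w. x \<in> c ` K \<Longrightarrow> norm w < d \<Longrightarrow>
        x + w \<in> W \<and> norm (F (x + w) - F x - F' x w) \<le> \<eta> * norm w"
      using uniform_linearization[OF W F F'c ccK cW \<eta>] by metis
    have "uniformly_continuous_on ({a..b} \<times> cball x0 (2 * r)) y"
      by (rule compact_uniformly_continuous[OF yc]) (auto intro: compact_Times)
    then obtain d2 where d2: "d2 > 0" "\<And>p p'. p \<in> {a..b} \<times> cball x0 (2 * r) \<Longrightarrow>
        p' \<in> {a..b} \<times> cball x0 (2 * r) \<Longrightarrow> dist p' p < d2 \<Longrightarrow> dist (y p') (y p) < d / 2"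
      using d(1) unfolding uniformly_continuous_on_def by (metis half_gt_zero)
    define m where "m = min r (min d2 (d / 2))"
    have m: "m > 0" using r d d2 by (simp add: m_def)
    show ?thesis
    proof (intro exI[of _ "m / (norm v + 1)"] conjI allI impI ballI)
      \<comment> \<open>Adding 1 keeps the denominator positive when \<open>v = 0\<close>.\<close>
      show "0 < m / (norm v + 1)" using m by (simp add: add_nonneg_pos)
      fix h p assume h: "0 < \<bar>h\<bar> \<and> \<bar>h\<bar> < m / (norm v + 1)" and p: "p \<in> K"
      have "\<bar>h\<bar> * (norm v + 1) < m" using h by (simp add: pos_less_divide_eq add_nonneg_pos)
      moreover have "\<bar>h\<bar> * norm v \<le> \<bar>h\<bar> * (norm v + 1)" by (intro mult_left_mono) auto
      ultimately have hv: "norm (h *\<^sub>R v) < m" by simp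
      have "dist x0 (snd p + h *\<^sub>R v) \<le> dist x0 (snd p) + norm (h *\<^sub>R v)"
        using dist_triangle[of x0 "snd p + h *\<^sub>R v" "snd p"] by (simp add: dist_norm)
      then show in2: "snd p + h *\<^sub>R v \<in> cball x0 (2 * r)"
        using p hv by (auto simp: K_def m_def)
      define D where "D = y (fst p, snd p + h *\<^sub>R v) - y p"
      define w where "w = (0::real, h *\<^sub>R v, D)"
      have "dist (fst p, snd p + h *\<^sub>R v) p < d2"
        using hv by (cases p) (simp add: dist_Pair_Pair m_def, simp add: dist_norm)
      then have "norm D < d / 2"
        using d2(2)[of p "(fst p, snd p + h *\<^sub>R v)"] p KD in2
        by (auto simp: D_def dist_norm K_def)
      moreover have nw: "norm w \<le> norm (h *\<^sub>R v) + norm D"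
        unfolding w_def using norm_Pair_le[of "0::real" "(h *\<^sub>R v, D)"] norm_Pair_le[of "h *\<^sub>R v" D] by simp
      ultimately have wd: "norm w < d" using hv by (auto simp: m_def)
      have cw: "c p + w = c (fst p, snd p + h *\<^sub>R v)" by (simp add: c_def w_def D_def)
      have h0: "h \<noteq> 0" using h by auto
      have DQ: "D = h *\<^sub>R Q h p" using h0 by (simp add: D_def Q_def)
      have wQ: "w = h *\<^sub>R (0, v, Q h p)" by (simp add: w_def DQ)
      have lin: "F' (c p) w = h *\<^sub>R F' (c p) (0, v, Q h p)"
        unfolding wQ by (rule linear_scale[OF linF[OF p]])
      have "G h p - F' (c p) (0, v, Q h p) = (1 / h) *\<^sub>R (F (c p + w) - F (c p) - F' (c p) w)"
        using h0 by (simp add: G_def cw lin scaleR_diff_right)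
      also have "norm \<dots> = (1 / \<bar>h\<bar>) * norm (F (c p + w) - F (c p) - F' (c p) w)" by simp
      also have "\<dots> \<le> (1 / \<bar>h\<bar>) * (\<eta> * (norm (h *\<^sub>R v) + norm D))"
      proof (rule mult_left_mono)
        have "norm (F (c p + w) - F (c p) - F' (c p) w) \<le> \<eta> * norm w"
          using d(2)[of "c p" w] p wd by auto
        also have "\<dots> \<le> \<eta> * (norm (h *\<^sub>R v) + norm D)" using nw \<eta> by (intro mult_left_mono) auto
        finally show "norm (F (c p + w) - F (c p) - F' (c p) w) \<le> \<eta> * (norm (h *\<^sub>R v) + norm D)" .
      qed simp
      also have "\<dots> = \<eta> * (norm v + norm (Q h p))"
        using h0 by (simp add: DQ field_simps)
      finally show "norm (G h p - F' (c p) (0, v, Q h p)) \<le> \<eta> * (norm v + norm (Q h p))" .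
    qed
  qed
  \<comment> \<open>The same linearization at time zero: initial quotients approach the derivative
    \<open>D0\<close> of the initial values, uniformly in the parameter.\<close>
  have st0: "\<exists>\<delta>>0. \<forall>h. 0 < \<bar>h\<bar> \<and> \<bar>h\<bar> < \<delta> \<longrightarrow>
      (\<forall>x\<in>cball x0 r. norm (Q h (0, x) - D0 x v) \<le> \<eta> * norm v)" if \<eta>: "\<eta> > 0" for \<eta>
  proof -
    obtain d where d: "d > 0" "\<And>x w. x \<in> cball x0 r \<Longrightarrow> norm w < d \<Longrightarrow>
        x + w \<in> P \<and> norm (y (0, x + w) - y (0, x) - D0 x w) \<le> \<eta> * norm w"
      using uniform_linearization[OF P(1) y0 D0c compact_cball P(2) \<eta>] by metis
    show ?thesis
    proof (intro exI[of _ "d / (norm v + 1)"] conjI allI impI ballI)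
      show "0 < d / (norm v + 1)" using d(1) by (simp add: add_nonneg_pos)
      fix h x assume h: "0 < \<bar>h\<bar> \<and> \<bar>h\<bar> < d / (norm v + 1)" and x: "x \<in> cball x0 r"
      have "\<bar>h\<bar> * (norm v + 1) < d" using h by (simp add: pos_less_divide_eq add_nonneg_pos)
      moreover have "\<bar>h\<bar> * norm v \<le> \<bar>h\<bar> * (norm v + 1)" by (intro mult_left_mono) auto
      ultimately have hv: "norm (h *\<^sub>R v) < d" by simp
      have h0: "h \<noteq> 0" using h by auto
      have "linear (D0 x)" using has_derivative_linear[OF y0] x P(2) by blast
      then have lin: "D0 x (h *\<^sub>R v) = h *\<^sub>R D0 x v" by (rule linear_scale)
      have "Q h (0, x) - D0 x v = (1 / h) *\<^sub>R (y (0, x + h *\<^sub>R v) - y (0, x) - D0 x (h *\<^sub>R v))"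
        using h0 by (simp add: Q_def lin scaleR_diff_right)
      also have "norm \<dots> = (1 / \<bar>h\<bar>) * norm (y (0, x + h *\<^sub>R v) - y (0, x) - D0 x (h *\<^sub>R v))" by simp
      also have "\<dots> \<le> (1 / \<bar>h\<bar>) * (\<eta> * norm (h *\<^sub>R v))"
        using d(2)[OF x hv] by (intro mult_left_mono) auto
      also have "\<dots> = \<eta> * norm v" using h0 by (simp add: field_simps)
      finally show "norm (Q h (0, x) - D0 x v) \<le> \<eta> * norm v" .
    qed
  qed
  have dQ: "((\<lambda>s. Q h (s, x)) has_vector_derivative G h (t, x)) (at t)"
    if "(t, x) \<in> K" "x + h *\<^sub>R v \<in> cball x0 (2 * r)" for h t x
  proof -
    have t: "t \<in> {a..b}" "x \<in> cball x0 (2 * r)" using that KD by auto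
    show ?thesis unfolding Q_def G_def c_def fst_conv snd_conv
      by (intro bounded_linear.has_vector_derivative[OF bounded_linear_scaleR_right]
          has_vector_derivative_diff ode t that)
  qed
  have "bounded ((\<lambda>x. D0 x v) ` cball x0 r)"
    by (intro compact_imp_bounded compact_continuous_image continuous_on_subset[OF D0c P(2)]) simp
  then obtain M0 where M0: "\<And>x. x \<in> cball x0 r \<Longrightarrow> norm (D0 x v) \<le> M0"
    unfolding bounded_iff by (meson image_eqI)
  have M0pos: "M0 \<ge> 0" using order_trans[OF norm_ge_zero M0[of x0]] r by simp
  \<comment> \<open>First pass through Gronwall's inequality, with the crude tolerance 1. The error
    is absorbed by raising \<open>L\<close> to \<open>L + 1\<close>, and the resulting bound
    \<open>M\<close> on the quotients turns the relative error of \<open>st1\<close> into an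
    absolute one.\<close>
  obtain M \<delta>M where M: "M \<ge> 0" "\<delta>M > 0" "\<And>h p. 0 < \<bar>h\<bar> \<Longrightarrow> \<bar>h\<bar> < \<delta>M \<Longrightarrow> p \<in> K \<Longrightarrow>
      snd p + h *\<^sub>R v \<in> cball x0 (2 * r) \<and> norm (Q h p) \<le> M"
  proof -
    obtain \<delta>1 where \<delta>1: "\<delta>1 > 0" "\<And>h p. 0 < \<bar>h\<bar> \<Longrightarrow> \<bar>h\<bar> < \<delta>1 \<Longrightarrow> p \<in> K \<Longrightarrow>
        snd p + h *\<^sub>R v \<in> cball x0 (2 * r) \<and>
        norm (G h p - F' (c p) (0, v, Q h p)) \<le> 1 * (norm v + norm (Q h p))"
      using st1[of 1] by auto
    obtain \<delta>0 where \<delta>0: "\<delta>0 > 0" "\<And>h x. 0 < \<bar>h\<bar> \<Longrightarrow> \<bar>h\<bar> < \<delta>0 \<Longrightarrow> x \<in> cball x0 r \<Longrightarrow>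
        norm (Q h (0, x) - D0 x v) \<le> 1 * norm v"
      using st0[of 1] by auto
    define e where "e = (L + 1) * norm v"
    define M2 where "M2 = exp ((2 * (L + 1) + 1) * T) * ((M0 + norm v)\<^sup>2 + e\<^sup>2 * T)"
    have e: "e \<ge> 0" using L by (simp add: e_def)
    have "norm (Q h p) \<le> sqrt M2" if h: "0 < \<bar>h\<bar>" "\<bar>h\<bar> < min \<delta>1 \<delta>0" and p: "p \<in> K" for h p
    proof -
      obtain t x where tx: "p = (t, x)" "t \<in> {a..b}" "x \<in> cball x0 r" using p by (auto simp: K_def)
      have sK: "(s, x) \<in> K" if "s \<in> closed_segment 0 t" for s
        using that seg[OF tx(2)] tx(3) by (auto simp: K_def)
      have "(norm (Q h (t, x)))\<^sup>2 \<le> exp ((2 * (L + 1) + 1) * \<bar>t\<bar>) * ((norm (Q h (0, x)))\<^sup>2 + e\<^sup>2 * \<bar>t\<bar>)"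
      proof (rule gronwall[where u="\<lambda>s. Q h (s, x)" and u'="\<lambda>s. G h (s, x)"])
        fix s assume s: "s \<in> closed_segment 0 t"
        note b1 = \<delta>1(2)[OF h(1) _ sK[OF s]]
        show "((\<lambda>s. Q h (s, x)) has_vector_derivative G h (s, x)) (at s)"
          using b1 h sK[OF s] by (intro dQ) auto
        have "norm (G h (s, x)) \<le> norm (F' (c (s, x)) (0, v, Q h (s, x)))
            + norm (G h (s, x) - F' (c (s, x)) (0, v, Q h (s, x)))"
          by (metis norm_triangle_sub)
        also have "\<dots> \<le> L * norm (0::real, v, Q h (s, x)) + (norm v + norm (Q h (s, x)))"
          using b1 h by (intro add_mono L(2) sK[OF s]) auto
        also have "\<dots> \<le> L * (norm v + norm (Q h (s, x))) + (norm v + norm (Q h (s, x)))"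
          using norm_Pair_le[of v "Q h (s, x)"] L(1)
          by (intro add_right_mono mult_left_mono) (auto simp: norm_Pair)
        finally show "norm (G h (s, x)) \<le> (L + 1) * norm (Q h (s, x)) + e"
          by (simp add: e_def algebra_simps)
      qed (use L e in auto)
      also have "\<dots> \<le> M2"
        unfolding M2_def
      proof (intro mult_mono add_mono power_mono)
        show "norm (Q h (0, x)) \<le> M0 + norm v"
          using \<delta>0(2)[of h x] h tx(3) M0[OF tx(3)] norm_triangle_sub[of "Q h (0, x)" "D0 x v"] by auto
      qed (use L e T T(2)[OF tx(2)] in auto)
      finally show ?thesis unfolding tx(1) by (rule real_le_rsqrt)
    qed
    moreover have "M2 \<ge> 0" using T by (simp add: M2_def)
    ultimately show ?thesis using \<delta>1 \<delta>0
      by (intro that[of "sqrt M2" "min \<delta>1 \<delta>0"]) auto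
  qed
  \<comment> \<open>Second pass: in the difference of two quotients the inhomogeneity caused by
    \<open>v\<close> cancels, so it solves the homogeneous linearized equation up to an error of at
    most \<open>\<eta> * N\<close>, with initial difference at most
    \<open>\<eta> * (2 * norm v)\<close>.\<close>
  have cauchy: "\<exists>\<delta>>0. \<delta> \<le> \<delta>M \<and> (\<forall>h k p. 0 < \<bar>h\<bar> \<longrightarrow> \<bar>h\<bar> < \<delta> \<longrightarrow> 0 < \<bar>k\<bar> \<longrightarrow> \<bar>k\<bar> < \<delta> \<longrightarrow> p \<in> K \<longrightarrow>
      norm (Q h p - Q k p) \<le> \<epsilon>)" if \<epsilon>: "\<epsilon> > 0" for \<epsilon>
  proof -
    define N where "N = 2 * (norm v + M)"
    define S where "S = exp ((2 * L + 1) * T) * ((2 * norm v)\<^sup>2 + N\<^sup>2 * T)"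
    \<comment> \<open>Factoring the square of \<open>\<eta>\<close> out of the Gronwall bound leaves
      \<open>S\<close>; adding 1 to the root covers the case \<open>S = 0\<close>.\<close>
    define \<eta> where "\<eta> = \<epsilon> / (sqrt S + 1)"
    have S: "S \<ge> 0" using T by (simp add: S_def)
    have \<eta>: "\<eta> > 0" using \<epsilon> S by (simp add: \<eta>_def add_nonneg_pos)
    have "\<eta> * sqrt S \<le> \<eta> * (sqrt S + 1)" using \<eta> by (intro mult_left_mono) auto
    also have "\<dots> = \<epsilon>"
      using add_nonneg_pos[OF real_sqrt_ge_zero[OF S] zero_less_one] by (simp add: \<eta>_def)
    finally have \<eta>S: "\<eta> * sqrt S \<le> \<epsilon>" .
    have N: "N \<ge> 0" using M by (simp add: N_def)
    obtain \<delta>1 where \<delta>1: "\<delta>1 > 0" "\<And>h p. 0 < \<bar>h\<bar> \<Longrightarrow> \<bar>h\<bar> < \<delta>1 \<Longrightarrow> p \<in> K \<Longrightarrow>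
        norm (G h p - F' (c p) (0, v, Q h p)) \<le> \<eta> * (norm v + norm (Q h p))"
      using st1[OF \<eta>] by auto
    obtain \<delta>0 where \<delta>0: "\<delta>0 > 0" "\<And>h x. 0 < \<bar>h\<bar> \<Longrightarrow> \<bar>h\<bar> < \<delta>0 \<Longrightarrow> x \<in> cball x0 r \<Longrightarrow>
        norm (Q h (0, x) - D0 x v) \<le> \<eta> * norm v"
      using st0[OF \<eta>] by auto
    define \<delta> where "\<delta> = min \<delta>M (min \<delta>1 \<delta>0)"
    have "norm (Q h p - Q k p) \<le> \<epsilon>"
      if h: "0 < \<bar>h\<bar>" "\<bar>h\<bar> < \<delta>" and k: "0 < \<bar>k\<bar>" "\<bar>k\<bar> < \<delta>" and p: "p \<in> K" for h k p
    proof -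
      obtain t x where tx: "p = (t, x)" "t \<in> {a..b}" "x \<in> cball x0 r" using p by (auto simp: K_def)
      have sK: "(s, x) \<in> K" if "s \<in> closed_segment 0 t" for s
        using that seg[OF tx(2)] tx(3) by (auto simp: K_def)
      have err: "norm (G h q - F' (c q) (0, v, Q h q)) \<le> \<eta> * (norm v + M)"
        if "0 < \<bar>h\<bar>" "\<bar>h\<bar> < \<delta>" "q \<in> K" for h q
      proof -
        have "\<eta> * (norm v + norm (Q h q)) \<le> \<eta> * (norm v + M)"
          using M(3)[OF that(1) _ that(3)] that \<eta> by (intro mult_left_mono) (auto simp: \<delta>_def)
        then show ?thesis using \<delta>1(2)[OF that(1) _ that(3)] that by (auto simp: \<delta>_def)
      qed
      have "(norm (Q h (t, x) - Q k (t, x)))\<^sup>2 \<le> exp ((2 * L + 1) * \<bar>t\<bar>) *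
          ((norm (Q h (0, x) - Q k (0, x)))\<^sup>2 + (\<eta> * N)\<^sup>2 * \<bar>t\<bar>)"
      proof (rule gronwall[where u="\<lambda>s. Q h (s, x) - Q k (s, x)" and u'="\<lambda>s. G h (s, x) - G k (s, x)"])
        fix s assume s: "s \<in> closed_segment 0 t"
        show "((\<lambda>s. Q h (s, x) - Q k (s, x)) has_vector_derivative G h (s, x) - G k (s, x)) (at s)"
          using M(3)[OF h(1) _ sK[OF s]] M(3)[OF k(1) _ sK[OF s]] h k sK[OF s]
          by (intro has_vector_derivative_diff dQ) (auto simp: \<delta>_def)
        define A where "A = F' (c (s, x))"
        have "(0::real, v, Q h (s, x)) - (0, v, Q k (s, x)) = (0, 0, Q h (s, x) - Q k (s, x))" by simp
        then have "A (0, v, Q h (s, x)) - A (0, v, Q k (s, x)) = A (0, 0, Q h (s, x) - Q k (s, x))"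
          using linear_diff[OF linF[OF sK[OF s]]] unfolding A_def by metis
        moreover have "norm (A (0, 0, Q h (s, x) - Q k (s, x))) \<le> L * norm (Q h (s, x) - Q k (s, x))"
          using L(2)[OF sK[OF s], of "(0, 0, Q h (s, x) - Q k (s, x))"] by (simp add: A_def norm_Pair)
        moreover have "G h (s, x) - G k (s, x) = (A (0, v, Q h (s, x)) - A (0, v, Q k (s, x)))
            + (G h (s, x) - A (0, v, Q h (s, x))) - (G k (s, x) - A (0, v, Q k (s, x)))" by simp
        ultimately show "norm (G h (s, x) - G k (s, x)) \<le> L * norm (Q h (s, x) - Q k (s, x)) + \<eta> * N"
          using err[OF h sK[OF s]] err[OF k sK[OF s]]
            norm_triangle_ineq4[of "A (0, 0, Q h (s, x) - Q k (s, x)) + (G h (s, x) - A (0, v, Q h (s, x)))"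
              "G k (s, x) - A (0, v, Q k (s, x))"]
            norm_triangle_ineq[of "A (0, 0, Q h (s, x) - Q k (s, x))" "G h (s, x) - A (0, v, Q h (s, x))"]
          unfolding A_def[symmetric] N_def by (simp add: algebra_simps)
      qed (use L \<eta> N in auto)
      also have "\<dots> \<le> exp ((2 * L + 1) * T) * ((\<eta> * (2 * norm v))\<^sup>2 + (\<eta> * N)\<^sup>2 * T)"
      proof (intro mult_mono add_mono power_mono)
        show "norm (Q h (0, x) - Q k (0, x)) \<le> \<eta> * (2 * norm v)"
          using \<delta>0(2)[of h x] \<delta>0(2)[of k x] h k tx(3)
            norm_triangle_ineq4[of "Q h (0, x) - D0 x v" "Q k (0, x) - D0 x v"] by (auto simp: \<delta>_def)
      qed (use L T T(2)[OF tx(2)] \<eta> N in auto)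
      also have "\<dots> = \<eta>\<^sup>2 * S" by (simp add: S_def power_mult_distrib algebra_simps)
      finally have "norm (Q h p - Q k p) \<le> sqrt (\<eta>\<^sup>2 * S)" unfolding tx(1) by (rule real_le_rsqrt)
      also have "\<dots> = \<eta> * sqrt S" using \<eta> by (simp add: real_sqrt_mult)
      finally show ?thesis using \<eta>S by simp
    qed
    moreover have "\<delta> > 0" "\<delta> \<le> \<delta>M" using M \<delta>1 \<delta>0 by (auto simp: \<delta>_def)
    ultimately show ?thesis by blast
  qed
  \<comment> \<open>The sequence only serves to name the limit; convergence over all small
    \<open>h\<close> is recovered in \<open>close\<close>. The offset 2 keeps even the first step
    strictly below \<open>\<delta>M\<close>.\<close>
  define hn where "hn n = \<delta>M / real (n + 2)" for n
  have hn: "0 < \<bar>hn n\<bar>" "\<bar>hn n\<bar> < \<delta>M" for n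
  proof -
    have "\<delta>M * 1 < \<delta>M * real (n + 2)" using M(2) by (intro mult_strict_left_mono) auto
    then show "0 < \<bar>hn n\<bar>" "\<bar>hn n\<bar> < \<delta>M" using M(2) by (simp_all add: hn_def pos_divide_less_eq)
  qed
  have hn0: "hn \<longlonglongrightarrow> 0"
    unfolding hn_def using LIMSEQ_ignore_initial_segment[OF tendsto_divide_0[OF tendsto_const filterlim_real_at_infinity_sequentially], of _ 2]
    by simp
  have hn_small: "\<forall>\<^sub>F n in sequentially. 0 < \<bar>hn n\<bar> \<and> \<bar>hn n\<bar> < d" if "d > 0" for d
    using tendstoD[OF hn0 that] hn by (auto elim: eventually_mono simp: dist_norm)
  define z where "z p = lim (\<lambda>n. Q (hn n) p)" for p
  have lim: "(\<lambda>n. Q (hn n) p) \<longlonglongrightarrow> z p" if pK: "p \<in> K" for p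
  proof -
    have "Cauchy (\<lambda>n. Q (hn n) p)"
    proof (rule metric_CauchyI)
      fix e :: real assume "e > 0"
      then obtain \<delta> where \<delta>: "\<delta> > 0" "\<And>h k. 0 < \<bar>h\<bar> \<Longrightarrow> \<bar>h\<bar> < \<delta> \<Longrightarrow> 0 < \<bar>k\<bar> \<Longrightarrow> \<bar>k\<bar> < \<delta> \<Longrightarrow> norm (Q h p - Q k p) \<le> e / 2"
        using cauchy[of "e / 2"] pK by (metis half_gt_zero)
      obtain n0 where "\<And>n. n \<ge> n0 \<Longrightarrow> 0 < \<bar>hn n\<bar> \<and> \<bar>hn n\<bar> < \<delta>"
        using hn_small[OF \<delta>(1)] by (auto simp: eventually_sequentially)
      then show "\<exists>n0. \<forall>m\<ge>n0. \<forall>n\<ge>n0. dist (Q (hn m) p) (Q (hn n) p) < e"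
        using \<delta>(2) \<open>e > 0\<close> by (intro exI[of _ n0] allI impI) (smt (verit) dist_norm field_sum_of_halves)
    qed
    then show ?thesis by (simp add: z_def Cauchy_convergent_iff convergent_LIMSEQ_iff)
  qed
  have close: "\<exists>\<delta>>0. \<delta> \<le> \<delta>M \<and> (\<forall>h p. 0 < \<bar>h\<bar> \<longrightarrow> \<bar>h\<bar> < \<delta> \<longrightarrow> p \<in> K \<longrightarrow> norm (Q h p - z p) \<le> \<epsilon>)"
    if \<epsilon>: "\<epsilon> > 0" for \<epsilon>
  proof -
    obtain \<delta> where \<delta>: "\<delta> > 0" "\<delta> \<le> \<delta>M" "\<And>h k p. 0 < \<bar>h\<bar> \<Longrightarrow> \<bar>h\<bar> < \<delta> \<Longrightarrow> 0 < \<bar>k\<bar> \<Longrightarrow> \<bar>k\<bar> < \<delta> \<Longrightarrow> p \<in> K \<Longrightarrow>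
        norm (Q h p - Q k p) \<le> \<epsilon>"
      using cauchy[OF \<epsilon>] by metis
    have "norm (Q h p - z p) \<le> \<epsilon>" if "0 < \<bar>h\<bar>" "\<bar>h\<bar> < \<delta>" "p \<in> K" for h p
    proof (rule tendsto_upperbound)
      show "(\<lambda>n. norm (Q h p - Q (hn n) p)) \<longlonglongrightarrow> norm (Q h p - z p)"
        by (intro tendsto_intros lim that)
      show "\<forall>\<^sub>F n in sequentially. norm (Q h p - Q (hn n) p) \<le> \<epsilon>"
        using hn_small[OF \<delta>(1)] by eventually_elim (use \<delta>(3) that in auto)
    qed simp
    then show ?thesis using \<delta> by blast
  qed
  show ?thesis
  proof (rule that[of z])
    have ev: "\<forall>\<^sub>F h in at (0::real). 0 < \<bar>h\<bar> \<and> \<bar>h\<bar> < d" if "d > 0" for d :: real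
      using that by (auto simp: eventually_at dist_norm intro!: exI[of _ d])
    have "uniform_limit K Q z (at 0)"
    proof (rule uniform_limitI)
      fix e :: real assume "e > 0"
      then obtain \<delta> where \<delta>: "\<delta> > 0" "\<And>h p. 0 < \<bar>h\<bar> \<Longrightarrow> \<bar>h\<bar> < \<delta> \<Longrightarrow> p \<in> K \<Longrightarrow> norm (Q h p - z p) \<le> e / 2"
        using close[of "e / 2"] by (metis half_gt_zero)
      show "\<forall>\<^sub>F h in at 0. \<forall>p\<in>K. dist (Q h p) (z p) < e"
        using ev[OF \<delta>(1)]
      proof eventually_elim
        case (elim h)
        then have "norm (Q h p - z p) < e" if "p \<in> K" for p
          using \<delta>(2)[of h p] that \<open>e > 0\<close> by simp
        then show ?case by (simp add: dist_norm)
      qed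
    qed
    moreover have "\<forall>\<^sub>F h in at 0. continuous_on K (Q h)"
      using ev[OF M(2)]
    proof eventually_elim
      case (elim h)
      have "continuous_on K (\<lambda>p. y (fst p, snd p + h *\<^sub>R v))"
        by (rule continuous_on_compose2[OF yc])
          (use M(3)[of h] elim in \<open>auto intro!: continuous_intros simp: K_def\<close>)
      then show ?case unfolding Q_def by (intro continuous_intros yK)
    qed
    ultimately have "continuous_on K z"
      by (intro uniform_limit_theorem) auto
    then show "continuous_on ({a..b} \<times> cball x0 r) z" by (simp add: K_def)
  next
    fix t x assume tx: "t \<in> {a..b}" "x \<in> cball x0 r"
    then have p: "(t, x) \<in> K" by (simp add: K_def)
    show "((\<lambda>s. y (t, x + s *\<^sub>R v)) has_vector_derivative z (t, x)) (at 0)"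
      unfolding has_vector_derivative_def has_derivative_at_alt
    proof (intro conjI allI impI)
      show "bounded_linear (\<lambda>s. s *\<^sub>R z (t, x))" by (rule bounded_linear_scaleR_left)
      fix e :: real assume "e > 0"
      then obtain \<delta> where \<delta>: "\<delta> > 0" "\<And>h p. 0 < \<bar>h\<bar> \<Longrightarrow> \<bar>h\<bar> < \<delta> \<Longrightarrow> p \<in> K \<Longrightarrow> norm (Q h p - z p) \<le> e"
        using close by metis
      have "norm (y (t, x + h *\<^sub>R v) - y (t, x) - h *\<^sub>R z (t, x)) \<le> e * \<bar>h\<bar>" if "\<bar>h\<bar> < \<delta>" for h
      proof (cases "h = 0")
        case False
        then have "y (t, x + h *\<^sub>R v) - y (t, x) - h *\<^sub>R z (t, x) = h *\<^sub>R (Q h (t, x) - z (t, x))"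
          by (simp add: Q_def scaleR_diff_right)
        then show ?thesis
          using \<delta>(2)[of h "(t, x)"] that False p by (simp add: mult.commute mult_left_mono)
      qed simp
      then show "\<exists>d>0. \<forall>h. norm (h - 0) < d \<longrightarrow>
          norm (y (t, x + h *\<^sub>R v) - y (t, x + 0 *\<^sub>R v) - (h - 0) *\<^sub>R z (t, x)) \<le> e * norm (h - 0)"
        using \<delta>(1) by auto
    qed
    define g' where "g' s = F' (c (s, x)) (0, v, z (s, x))" for s
    have sK: "(s, x) \<in> K" if "s \<in> {a..b}" for s using that tx by (simp add: K_def)
    \<comment> \<open>The time derivatives \<open>G (hn n)\<close> converge uniformly to
      \<open>g'\<close>, so limit and derivative may be interchanged. At the ends of the interval
      the derivative is one-sided.\<close>
    have "\<exists>g. \<forall>s\<in>{a..b}. (\<lambda>n. Q (hn n) (s, x)) \<longlonglongrightarrow> g s \<and>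
        (g has_derivative (\<lambda>u. u *\<^sub>R g' s)) (at s within {a..b})"
    proof (rule has_derivative_sequence[where f="\<lambda>n s. Q (hn n) (s, x)" and
          f'="\<lambda>n s u. u *\<^sub>R G (hn n) (s, x)" and S="{a..b}" and g'="\<lambda>s u. u *\<^sub>R g' s"])
      show "((\<lambda>s. Q (hn n) (s, x)) has_derivative (\<lambda>u. u *\<^sub>R G (hn n) (s, x))) (at s within {a..b})"
        if "s \<in> {a..b}" for n s
        using M(3)[OF hn sK[OF that]]
        by (intro has_derivative_at_withinI[OF dQ[OF sK[OF that], unfolded has_vector_derivative_def]]) auto
      fix e :: real assume e: "e > 0"
      \<comment> \<open>\<open>\<eta>\<close> controls the linearization error and
        \<open>\<eta>2\<close> the distance of the quotient from its limit; each contributes at most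
        \<open>e / 2\<close>.\<close>
      define \<eta> where "\<eta> = e / (2 * (norm v + M + 1))"
      define \<eta>2 where "\<eta>2 = e / (2 * (L + 1))"
      have half: "e / (2 * X) * X = e / 2" if "X > 0" for X using that by simp
      have pos: "norm v + M + 1 > 0" "L + 1 > 0" using M(1) L(1) by (simp_all add: add_nonneg_pos)
      have \<eta>: "\<eta> > 0" "\<eta>2 > 0" using e pos by (simp_all add: \<eta>_def \<eta>2_def)
      have "\<eta> * (norm v + M) \<le> \<eta> * (norm v + M + 1)" using \<eta> by (intro mult_left_mono) auto
      also have "\<dots> = e / 2" unfolding \<eta>_def by (rule half[OF pos(1)])
      finally have e1: "\<eta> * (norm v + M) \<le> e / 2" .
      have "L * \<eta>2 \<le> (L + 1) * \<eta>2" using \<eta> by (intro mult_right_mono) auto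
      also have "\<dots> = e / 2" unfolding \<eta>2_def using half[OF pos(2)] by (simp add: mult.commute)
      finally have e2: "L * \<eta>2 \<le> e / 2" .
      obtain \<delta>1 where \<delta>1: "\<delta>1 > 0" "\<And>h p. 0 < \<bar>h\<bar> \<Longrightarrow> \<bar>h\<bar> < \<delta>1 \<Longrightarrow> p \<in> K \<Longrightarrow>
          norm (G h p - F' (c p) (0, v, Q h p)) \<le> \<eta> * (norm v + norm (Q h p))"
        using st1[OF \<eta>(1)] by auto
      obtain \<delta>2 where \<delta>2: "\<delta>2 > 0" "\<And>h p. 0 < \<bar>h\<bar> \<Longrightarrow> \<bar>h\<bar> < \<delta>2 \<Longrightarrow> p \<in> K \<Longrightarrow> norm (Q h p - z p) \<le> \<eta>2"
        using close[OF \<eta>(2)] by metis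
      have bd: "norm (G h p - F' (c p) (0, v, z p)) \<le> e"
        if "0 < \<bar>h\<bar>" "\<bar>h\<bar> < min \<delta>M (min \<delta>1 \<delta>2)" "p \<in> K" for h p
      proof -
        have "norm (G h p - F' (c p) (0, v, Q h p)) \<le> \<eta> * (norm v + norm (Q h p))"
          using \<delta>1(2) that by auto
        also have "\<dots> \<le> \<eta> * (norm v + M)" using M(3)[of h p] that \<eta> by (intro mult_left_mono) auto
        finally have b1: "norm (G h p - F' (c p) (0, v, Q h p)) \<le> e / 2" using e1 by simp
        have "(0::real, v, Q h p) - (0, v, z p) = (0, 0, Q h p - z p)" by simp
        then have "F' (c p) (0, v, Q h p) - F' (c p) (0, v, z p) = F' (c p) (0, 0, Q h p - z p)"
          using linear_diff[OF linF[OF that(3)]] by metis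
        moreover have "norm (F' (c p) (0, 0, Q h p - z p)) \<le> L * norm (Q h p - z p)"
          using L(2)[OF that(3), of "(0, 0, Q h p - z p)"] by (simp add: norm_Pair)
        moreover have "L * norm (Q h p - z p) \<le> L * \<eta>2"
          using \<delta>2(2) that L(1) by (intro mult_left_mono) auto
        moreover have "norm (G h p - F' (c p) (0, v, z p)) \<le> norm (G h p - F' (c p) (0, v, Q h p))
            + norm (F' (c p) (0, v, Q h p) - F' (c p) (0, v, z p))"
          using norm_triangle_ineq[of "G h p - F' (c p) (0, v, Q h p)"
              "F' (c p) (0, v, Q h p) - F' (c p) (0, v, z p)"] by simp
        ultimately show ?thesis using b1 e2 by simp
      qed
      have "min \<delta>M (min \<delta>1 \<delta>2) > 0" using M(2) \<delta>1(1) \<delta>2(1) by simp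
      from hn_small[OF this]
      show "\<forall>\<^sub>F n in sequentially. \<forall>s\<in>{a..b}. \<forall>u. norm (u *\<^sub>R G (hn n) (s, x) - u *\<^sub>R g' s) \<le> e * norm u"
      proof eventually_elim
        case (elim n)
        then have "norm (G (hn n) (s, x) - g' s) \<le> e" if "s \<in> {a..b}" for s
          using bd[OF _ _ sK[OF that]] by (simp add: g'_def)
        then show ?case
          by (simp add: scaleR_diff_right[symmetric] mult.commute[of e] mult_left_mono)
      qed
    next
      show "(\<lambda>n. Q (hn n) (t, x)) \<longlonglongrightarrow> z (t, x)" by (rule lim[OF p])
    qed (use tx in auto)
    then obtain g where g: "\<And>s. s \<in> {a..b} \<Longrightarrow> (\<lambda>n. Q (hn n) (s, x)) \<longlonglongrightarrow> g s"
      "\<And>s. s \<in> {a..b} \<Longrightarrow> (g has_derivative (\<lambda>u. u *\<^sub>R g' s)) (at s within {a..b})" by blast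
    have "g s = z (s, x)" if "s \<in> {a..b}" for s
      using LIMSEQ_unique[OF g(1)[OF that] lim[OF sK[OF that]]] .
    then have "((\<lambda>s. z (s, x)) has_vector_derivative g' t) (at t within {a..b})"
      using g(2)[OF tx(1)] tx(1) unfolding has_vector_derivative_def
      by (auto intro: has_derivative_transform[rotated 2])
    then show "((\<lambda>s. z (s, x)) has_vector_derivative F' (t, x, y (t, x)) (0, v, z (t, x))) (at t within {a..b})"
      by (simp add: g'_def c_def)
  qed
qed


text \<open>Compact cylinders cover the open domain, but each yields its own \<open>z\<close>.
  Defining \<open>z\<close> beforehand as the directional derivative of \<open>y\<close> makes the
  local functions agree with it, and hence with each other.\<close>

lemma Ck_on_param_ode_partial:
  fixes F :: "real \<times> 'p::euclidean_space \<times> 'e::euclidean_space \<Rightarrow> 'e" and y :: "real \<times> 'p \<Rightarrow> 'e"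
  assumes ab: "a < 0" "0 < b" and P: "open P"
    and W: "open W" and F: "\<And>z. z \<in> W \<Longrightarrow> (F has_derivative F' z) (at z)"
    and F'c: "\<And>v. continuous_on W (\<lambda>z. F' z v)"
    and yc: "continuous_on ({a<..<b} \<times> P) y"
    and gr: "\<And>t x. t \<in> {a<..<b} \<Longrightarrow> x \<in> P \<Longrightarrow> (t, x, y (t, x)) \<in> W"
    and ode: "\<And>t x. t \<in> {a<..<b} \<Longrightarrow> x \<in> P \<Longrightarrow>
      ((\<lambda>s. y (s, x)) has_vector_derivative F (t, x, y (t, x))) (at t)"
    and y0: "\<And>x. x \<in> P \<Longrightarrow> ((\<lambda>x. y (0, x)) has_derivative D0 x) (at x)"
    and D0c: "\<And>v. continuous_on P (\<lambda>x. D0 x v)"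
  obtains z where "continuous_on ({a<..<b} \<times> P) z"
    "\<And>t x. t \<in> {a<..<b} \<Longrightarrow> x \<in> P \<Longrightarrow>
      ((\<lambda>s. y (t, x + s *\<^sub>R v)) has_vector_derivative z (t, x)) (at 0)"
    "\<And>t x. t \<in> {a<..<b} \<Longrightarrow> x \<in> P \<Longrightarrow>
      ((\<lambda>s. z (s, x)) has_vector_derivative F' (t, x, y (t, x)) (0, v, z (t, x))) (at t)"
proof -
  define z where "z p = vector_derivative (\<lambda>s. y (fst p, snd p + s *\<^sub>R v)) (at 0)" for p
  have main: "isCont z (t, x) \<and>
      ((\<lambda>s. y (t, x + s *\<^sub>R v)) has_vector_derivative z (t, x)) (at 0) \<and>
      ((\<lambda>s. z (s, x)) has_vector_derivative F' (t, x, y (t, x)) (0, v, z (t, x))) (at t)"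
    if t: "t \<in> {a<..<b}" and x: "x \<in> P" for t x
  proof -
    obtain r' where r': "r' > 0" "cball x r' \<subseteq> P" using P x by (meson open_contains_cball)
    define r where "r = r' / 2"
    have r: "r > 0" "cball x (2 * r) \<subseteq> P" "cball x r \<subseteq> P"
      using r' by (auto simp: r_def subset_eq)
    \<comment> \<open>Midpoints place both 0 and \<open>t\<close> strictly inside the compact
      interval, so that the one-sided derivative at \<open>t\<close> becomes two-sided.\<close>
    define a' where "a' = (a + min 0 t) / 2"
    define b' where "b' = (b + max 0 t) / 2"
    have ab': "a' < 0" "0 < b'" "a < a'" "b' < b" "a' < t" "t < b'"
      using ab t by (auto simp: a'_def b'_def)
    obtain z' where z': "continuous_on ({a'..b'} \<times> cball x r) z'"
      and z'1: "\<And>t u. t \<in> {a'..b'} \<Longrightarrow> u \<in> cball x r \<Longrightarrow>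
        ((\<lambda>s. y (t, u + s *\<^sub>R v)) has_vector_derivative z' (t, u)) (at 0)"
      and z'2: "\<And>t u. t \<in> {a'..b'} \<Longrightarrow> u \<in> cball x r \<Longrightarrow>
        ((\<lambda>s. z' (s, u)) has_vector_derivative F' (t, u, y (t, u)) (0, v, z' (t, u))) (at t within {a'..b'})"
    proof -
      have "continuous_on ({a'..b'} \<times> cball x (2 * r)) y"
        by (rule continuous_on_subset[OF yc]) (use ab' r in auto)
      moreover have "(t, u, y (t, u)) \<in> W" if "t \<in> {a'..b'}" "u \<in> cball x (2 * r)" for t u
        using that ab' r by (intro gr) auto
      moreover have "((\<lambda>s. y (s, u)) has_vector_derivative F (t, u, y (t, u))) (at t)"
        if "t \<in> {a'..b'}" "u \<in> cball x (2 * r)" for t u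
        using that ab' r by (intro ode) auto
      ultimately show ?thesis
        using that param_ode_local[OF ab'(1,2) r(1) W F F'c _ _ _ P r(3) y0 D0c, where v=v] by metis
    qed
    have eq: "z (s, u) = z' (s, u)" if "s \<in> {a'..b'}" "u \<in> cball x r" for s u
      using vector_derivative_at[OF z'1[OF that]] by (simp add: z_def)
    define N where "N = {a'<..<b'} \<times> ball x r"
    have N: "open N" "(t, x) \<in> N" "N \<subseteq> {a'..b'} \<times> cball x r"
      using ab' r(1) by (auto simp: N_def intro: open_Times)
    have "continuous_on N z'" by (rule continuous_on_subset[OF z' N(3)])
    then have "continuous_on N z"
      by (rule continuous_on_eq) (use eq N(3) in auto)
    then have "isCont z (t, x)" using N by (simp add: continuous_on_eq_continuous_at)
    moreover have "((\<lambda>s. z' (s, x)) has_vector_derivative F' (t, x, y (t, x)) (0, v, z' (t, x))) (at t)"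
      using z'2[of t x] ab' r(1) by (simp add: at_within_Icc_at)
    then have "((\<lambda>s. z (s, x)) has_vector_derivative F' (t, x, y (t, x)) (0, v, z (t, x))) (at t)"
      using eq[of _ x] ab' r(1)
      by (auto intro: has_vector_derivative_transform_within_open[of _ _ _ "{a'<..<b'}"])
    ultimately show ?thesis using z'1[of t x] eq[of t x] ab' r(1) by simp
  qed
  show ?thesis
    by (rule that[of z]) (use main in \<open>auto intro!: continuous_at_imp_continuous_on\<close>)
qed

text \<open>The partial derivatives of a solution solve the linearized equation, which has the same form,
  with right-hand side of class one lower; so the regularity is improved by induction.\<close>

theorem Ck_on_param_ode:
  fixes F :: "real \<times> 'p::euclidean_space \<times> 'e::euclidean_space \<Rightarrow> 'e" and y :: "real \<times> 'p \<Rightarrow> 'e"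
  assumes ab: "a < 0" "0 < b" and P: "open P"
  assumes "open W" "Ck_on k W F" "continuous_on ({a<..<b} \<times> P) y"
    and "\<And>t x. t \<in> {a<..<b} \<Longrightarrow> x \<in> P \<Longrightarrow> (t, x, y (t, x)) \<in> W"
    and "\<And>t x. t \<in> {a<..<b} \<Longrightarrow> x \<in> P \<Longrightarrow>
      ((\<lambda>s. y (s, x)) has_vector_derivative F (t, x, y (t, x))) (at t)"
    and "Ck_on k P (\<lambda>x. y (0, x))"
  shows "Ck_on k ({a<..<b} \<times> P) y"
  using assms(4-)
proof (induction k arbitrary: F W y)
  case 0
  then show ?case by simp
next
  case (Suc k)
  define D where "D = {a<..<b} \<times> P"
  have D: "open D" using P by (auto simp: D_def intro: open_Times)
  obtain F' where F': "\<And>z. z \<in> W \<Longrightarrow> (F has_derivative F' z) (at z)" "\<And>v. Ck_on k W (\<lambda>z. F' z v)"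
    using Ck_on_SucE[OF Suc.prems(2)] by metis
  obtain D0 where D0: "\<And>x. x \<in> P \<Longrightarrow> ((\<lambda>x. y (0, x)) has_derivative D0 x) (at x)"
    "\<And>v. Ck_on k P (\<lambda>x. D0 x v)"
    using Ck_on_SucE[OF Suc.prems(6)] by metis
  \<comment> \<open>The lower regularity of \<open>y\<close> comes first, because the coefficients
    of the linearized equation contain \<open>y\<close>.\<close>
  have yk: "Ck_on k D y"
    unfolding D_def
    by (rule Suc.IH[OF Suc.prems(1) Ck_on_SucD[OF Suc.prems(2)] Suc.prems(3) Suc.prems(4) Suc.prems(5)
          Ck_on_SucD[OF Suc.prems(6)]])
  define g where "g p = (fst p, snd p, y p)" for p
  have g: "Ck_on k D g" unfolding g_def
    by (intro Ck_on_Pair yk D Ck_on_linear bounded_linear_fst bounded_linear_snd)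
  have gW: "g ` D \<subseteq> W" using Suc.prems(4) by (auto simp: g_def D_def)
  have "\<exists>z. Ck_on k D z \<and> (\<forall>t x. t \<in> {a<..<b} \<longrightarrow> x \<in> P \<longrightarrow>
      ((\<lambda>s. y (t, x + s *\<^sub>R v)) has_vector_derivative z (t, x)) (at 0))" for v
  proof -
    obtain z where z: "continuous_on ({a<..<b} \<times> P) z"
      "\<And>t x. t \<in> {a<..<b} \<Longrightarrow> x \<in> P \<Longrightarrow>
        ((\<lambda>s. y (t, x + s *\<^sub>R v)) has_vector_derivative z (t, x)) (at 0)"
      "\<And>t x. t \<in> {a<..<b} \<Longrightarrow> x \<in> P \<Longrightarrow>
        ((\<lambda>s. z (s, x)) has_vector_derivative F' (t, x, y (t, x)) (0, v, z (t, x))) (at t)"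
      using Ck_on_param_ode_partial[OF ab P Suc.prems(1) F'(1) Ck_on_imp_continuous_on[OF F'(2)]
          Suc.prems(3) Suc.prems(4) Suc.prems(5) D0(1) Ck_on_imp_continuous_on[OF D0(2)], of v]
      by metis
    \<comment> \<open>\<open>F2\<close> is the right-hand side
      \<open>F' (t, x, y (t, x)) (0, v, u)\<close>, expanded over the basis because \<open>u\<close>
      varies while \<open>Ck_on\<close> fixes directions. Here \<open>y\<close> is a known
      coefficient, entering through \<open>g\<close>, and \<open>u\<close> ranges over the whole
      space.\<close>
    define W2 where "W2 = {q :: real \<times> 'p \<times> 'e. (fst q, fst (snd q)) \<in> D}"
    define F2 where "F2 q = F' (g (fst q, fst (snd q))) (0, v, 0)
      + (\<Sum>i\<in>Basis. (snd (snd q) \<bullet> i) *\<^sub>R F' (g (fst q, fst (snd q))) (0, 0, i))" for q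
    have bl: "bounded_linear (\<lambda>q :: real \<times> 'p \<times> 'e. (fst q, fst (snd q)))"
      "bounded_linear (\<lambda>q :: real \<times> 'p \<times> 'e. snd (snd q))"
      by (intro bounded_linear_Pair bounded_linear_fst bounded_linear_snd
          bounded_linear_compose[OF bounded_linear_fst bounded_linear_snd]
          bounded_linear_compose[OF bounded_linear_snd bounded_linear_snd])+
    have W2: "open W2" unfolding W2_def
      using open_vimage[OF D bounded_linear.continuous_on[OF bl(1) continuous_on_id]]
      by (simp add: vimage_def)
    have gq: "Ck_on k W2 (\<lambda>q. F' (g (fst q, fst (snd q))) u)" for u
    proof (rule Ck_on_compose[where V=D and f="\<lambda>p. F' (g p) u"])
      show "Ck_on k D (\<lambda>p. F' (g p) u)" by (rule Ck_on_compose[OF g F'(2) gW D Suc.prems(1)])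
    qed (use bl W2 D Ck_on_linear in \<open>auto simp: W2_def\<close>)
    have F2: "Ck_on k W2 F2"
      unfolding F2_def
      by (intro Ck_on_add Ck_on_sum gq W2 Ck_on_bilinear[OF bounded_bilinear_scaleR]
          Ck_on_linear_compose[OF bounded_linear_inner_left] Ck_on_linear[OF bl(2)])
    have F2eq: "F2 (t, x, u) = F' (t, x, y (t, x)) (0, v, u)" if "t \<in> {a<..<b}" "x \<in> P" for t x u
    proof -
      have lin: "linear (F' (t, x, y (t, x)))"
        by (rule has_derivative_linear[OF F'(1)]) (rule Suc.prems(4)[OF that])
      have "(0::real, v, u) = (0, v, 0) + (0, 0, u)" by simp
      also have "(0::real, 0::'p, u) = (\<Sum>i\<in>Basis. (u \<bullet> i) *\<^sub>R (0, 0, i))"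
        by (simp add: sum_prod euclidean_representation flip: sum.distrib)
      finally have "F' (t, x, y (t, x)) (0, v, u) = F' (t, x, y (t, x)) (0, v, 0)
          + (\<Sum>i\<in>Basis. (u \<bullet> i) *\<^sub>R F' (t, x, y (t, x)) (0, 0, i))"
        by (simp only: linear_add[OF lin] linear_sum[OF lin] linear_scale[OF lin])
      then show ?thesis by (simp add: F2_def g_def)
    qed
    have "Ck_on k ({a<..<b} \<times> P) z"
    proof (rule Suc.IH[OF W2 F2 z(1)])
      show "(t, x, z (t, x)) \<in> W2" if "t \<in> {a<..<b}" "x \<in> P" for t x
        using that by (auto simp: W2_def D_def)
      show "((\<lambda>s. z (s, x)) has_vector_derivative F2 (t, x, z (t, x))) (at t)"
        if "t \<in> {a<..<b}" "x \<in> P" for t x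
        using z(3)[OF that] F2eq[OF that] by simp
      \<comment> \<open>At time zero \<open>z\<close> is the directional derivative of the initial
        values, whose class is one lower.\<close>
      show "Ck_on k P (\<lambda>x. z (0, x))"
      proof (rule Ck_on_cong[OF D0(2)[of v] P])
        fix x assume x: "x \<in> P"
        have "((\<lambda>s::real. x + s *\<^sub>R v) has_vector_derivative v) (at 0)"
          by (auto intro!: derivative_eq_intros)
        then have "((\<lambda>s. y (0, x + s *\<^sub>R v)) has_vector_derivative D0 x v) (at 0)"
          using vector_derivative_diff_chain_within[of "\<lambda>s. x + s *\<^sub>R v" v 0 UNIV "\<lambda>x. y (0, x)" "D0 x"]
            D0(1)[OF x] by (simp add: o_def has_derivative_at_withinI)
        with z(2)[of 0 x] ab x show "D0 x v = z (0, x)"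
          by (auto intro: vector_derivative_unique_at)
      qed
    qed
    then show ?thesis using z(2) unfolding D_def by blast
  qed
  then obtain z where z: "\<And>v. Ck_on k D (z v)"
    "\<And>v t x. t \<in> {a<..<b} \<Longrightarrow> x \<in> P \<Longrightarrow>
      ((\<lambda>s. y (t, x + s *\<^sub>R v)) has_vector_derivative z v (t, x)) (at 0)"
    by metis
  show ?case
    unfolding D_def[symmetric]
  \<comment> \<open>The only basis vector with vanishing second component is the time direction, and
    there the partial derivative is the right-hand side of the equation.\<close>
  proof (rule Ck_on_partials[OF D, where D="\<lambda>i. if snd i = 0 then (\<lambda>p. F (g p)) else z (snd i)"])
    fix i :: "real \<times> 'p" and p assume i: "i \<in> Basis" and p: "p \<in> D"
    obtain t x where tx: "p = (t, x)" "t \<in> {a<..<b}" "x \<in> P" using p by (auto simp: D_def)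
    show "((\<lambda>s. y (p + s *\<^sub>R i)) has_vector_derivative
        (if snd i = 0 then (\<lambda>p. F (g p)) else z (snd i)) p) (at 0)"
    proof (cases "snd i = 0")
      case True
      then have i1: "i = (1, 0)" using i by (auto simp: Basis_prod_def)
      have "((\<lambda>s. s + t) has_vector_derivative 1) (at 0)"
        by (auto intro!: derivative_eq_intros)
      from vector_diff_chain_at[OF this, of "\<lambda>s. y (s, x)"] Suc.prems(5)[OF tx(2,3)]
      show ?thesis by (simp add: i1 tx(1) g_def o_def add.commute)
    next
      case False
      then have "fst i = 0" using i by (auto simp: Basis_prod_def)
      then have "p + s *\<^sub>R i = (t, x + s *\<^sub>R snd i)" for s by (simp add: tx(1) prod_eq_iff)
      then show ?thesis using z(2)[OF tx(2,3)] False by (simp add: tx(1))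
    qed
  next
    fix i :: "real \<times> 'p"
    show "Ck_on k D (if snd i = 0 then (\<lambda>p. F (g p)) else z (snd i))"
      using Ck_on_compose[OF g Ck_on_SucD[OF Suc.prems(2)] gW D Suc.prems(1)] z(1) by auto
  qed
qed

section \<open>Smooth maps between manifolds, pointwise\<close>

abbreviation eucl :: "('e, 'e) mfd" where
  "eucl \<equiv> eucl_mfd UNIV UNIV"

text \<open>\<open>smooth_map\<close> quantifies over all pairs of charts, which is awkward for
  compositions. A single pair near the point is asked for here; continuity near the point is then a
  consequence, as the charts are homeomorphisms.\<close>

definition smooth_at ::
  "('a::topological_space, 'e::euclidean_space) mfd \<Rightarrow>
   ('b::topological_space, 'f::euclidean_space) mfd \<Rightarrow> ('a \<Rightarrow> 'b) \<Rightarrow> 'a \<Rightarrow> bool"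
where
  "smooth_at M N f p \<longleftrightarrow>
     (\<exists>U \<phi> V \<psi> S. (U, \<phi>) \<in> atlas M \<and> (V, \<psi>) \<in> atlas N \<and> open_in M S \<and> p \<in> S \<and> S \<subseteq> U \<and>
        f ` S \<subseteq> V \<and> smooth_on (\<phi> ` S) (\<lambda>x. \<psi> (f (inv_into U \<phi> x))))"

lemma points_iff: "p \<in> points M \<longleftrightarrow> (\<exists>U \<phi>. (U, \<phi>) \<in> atlas M \<and> p \<in> U)"
  by (auto simp: points_def)

lemma pointsE:
  assumes "p \<in> points M" obtains U \<phi> where "(U, \<phi>) \<in> atlas M" "p \<in> U"
  using assms points_iff by metis

lemma
  assumes "smooth_manifold M" "(U, \<phi>) \<in> atlas M"
  shows chart_open: "open_in M U"
    and chart_subset: "U \<subseteq> points M"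
    and chart_homeomorphism: "homeomorphism U (\<phi> ` U) \<phi> (inv_into U \<phi>)"
    and chart_image_open: "openin (top_of_set (model M)) (\<phi> ` U)"
    and chart_inj: "inj_on \<phi> U"
    and chart_cont: "continuous_on U \<phi>"
    and chart_inv_cont: "continuous_on (\<phi> ` U) (inv_into U \<phi>)"
    and chart_inv: "\<And>p. p \<in> U \<Longrightarrow> inv_into U \<phi> (\<phi> p) = p"
proof -
  show 1: "open_in M U" "homeomorphism U (\<phi> ` U) \<phi> (inv_into U \<phi>)"
    "openin (top_of_set (model M)) (\<phi> ` U)"
    using assms unfolding smooth_manifold_def by blast+
  show "U \<subseteq> points M" using assms(2) by (auto simp: points_def)
  show inv: "\<And>p. p \<in> U \<Longrightarrow> inv_into U \<phi> (\<phi> p) = p"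
    and "continuous_on U \<phi>" "continuous_on (\<phi> ` U) (inv_into U \<phi>)"
    using 1(2) by (auto simp: homeomorphism_def)
  show "inj_on \<phi> U" by (rule inj_on_inverseI) (rule inv)
qed

lemma chart_transition:
  assumes "smooth_manifold M" "(U, \<phi>) \<in> atlas M" "(V, \<psi>) \<in> atlas M"
  shows "smooth_on (\<phi> ` (U \<inter> V)) (\<lambda>x. \<psi> (inv_into U \<phi> x))"
  using assms unfolding smooth_manifold_def o_def by blast

lemma chart_open_image:
  assumes "smooth_manifold M" "(U, \<phi>) \<in> atlas M" "open_in M S" "S \<subseteq> U"
  shows "openin (top_of_set (model M)) (\<phi> ` S)"
    and "\<exists>W. open W \<and> \<phi> ` S = \<phi> ` U \<inter> W"
proof -
  have "openin (top_of_set U) S"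
    using openin_subset_trans[OF assms(3,4) chart_subset[OF assms(1,2)]] .
  then have *: "openin (top_of_set (\<phi> ` U)) (\<phi> ` S)"
    by (rule homeomorphism_imp_open_map[OF chart_homeomorphism[OF assms(1,2)]])
  then show "\<exists>W. open W \<and> \<phi> ` S = \<phi> ` U \<inter> W" by (simp add: openin_open)
  show "openin (top_of_set (model M)) (\<phi> ` S)"
    using openin_trans[OF * chart_image_open[OF assms(1,2)]] .
qed

lemma chart_open_preimage:
  assumes "smooth_manifold M" "(U, \<phi>) \<in> atlas M" "open W"
  shows "open_in M (U \<inter> \<phi> -` W)"
proof -
  have "openin (top_of_set U) (U \<inter> \<phi> -` W)"
    by (rule continuous_openin_preimage_gen[OF chart_cont[OF assms(1,2)] assms(3)])
  then show ?thesis using chart_open[OF assms(1,2)] by (rule openin_trans)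
qed

text \<open>The same charts witness smoothness at all points of \<open>S\<close>, and on
  \<open>S\<close> the map is a chart followed by a smooth coordinate expression and an inverse
  chart, hence continuous.\<close>

lemma smooth_atD:
  assumes M: "smooth_manifold M" and N: "smooth_manifold N" and f: "smooth_at M N f p"
  obtains S where "open_in M S" "p \<in> S" "S \<subseteq> points M" "f ` S \<subseteq> points N" "continuous_on S f"
    "\<And>q. q \<in> S \<Longrightarrow> smooth_at M N f q"
proof -
  from f obtain U \<phi> V \<psi> S where 1: "(U, \<phi>) \<in> atlas M" "(V, \<psi>) \<in> atlas N" "open_in M S" "p \<in> S" "S \<subseteq> U"
    "f ` S \<subseteq> V" "smooth_on (\<phi> ` S) (\<lambda>x. \<psi> (f (inv_into U \<phi> x)))"
    unfolding smooth_at_def by blast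
  have "continuous_on S (\<lambda>q. inv_into V \<psi> (\<psi> (f (inv_into U \<phi> (\<phi> q)))))"
  proof (rule continuous_on_compose2[OF chart_inv_cont[OF N 1(2)]])
    show "continuous_on S (\<lambda>q. \<psi> (f (inv_into U \<phi> (\<phi> q))))"
      by (rule continuous_on_compose2[OF smooth_on_continuous_on[OF 1(7)]
            continuous_on_subset[OF chart_cont[OF M 1(1)] 1(5)]]) simp
    show "(\<lambda>q. \<psi> (f (inv_into U \<phi> (\<phi> q)))) ` S \<subseteq> \<psi> ` V"
      using 1(5,6) chart_inv[OF M 1(1)] by force
  qed
  moreover have "inv_into V \<psi> (\<psi> (f (inv_into U \<phi> (\<phi> q)))) = f q" if "q \<in> S" for q
  proof -
    have "q \<in> U" "f q \<in> V" using that 1(5,6) by auto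
    then show ?thesis by (simp add: chart_inv[OF M 1(1)] chart_inv[OF N 1(2)])
  qed
  ultimately have "continuous_on S f" by (simp cong: continuous_on_cong)
  moreover have "smooth_at M N f q" if "q \<in> S" for q
    unfolding smooth_at_def using 1 that by blast
  moreover have "S \<subseteq> points M" "f ` S \<subseteq> points N"
    using 1(5,6) chart_subset[OF M 1(1)] chart_subset[OF N 1(2)] by auto
  ultimately show ?thesis using that 1 by blast
qed

lemma smooth_at_points:
  "smooth_manifold M \<Longrightarrow> smooth_manifold N \<Longrightarrow> smooth_at M N f p \<Longrightarrow> p \<in> points M \<and> f p \<in> points N"
  by (erule (2) smooth_atD) blast

text \<open>The charts, existential in \<open>smooth_at\<close>, may be prescribed: the coordinate
  expression changes by composition with transition maps on both sides, after \<open>S\<close> has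
  been shrunk to where old and new charts are all defined. The shrinking uses continuity of
  \<open>f\<close>.\<close>

lemma smooth_at_charts:
  assumes M: "smooth_manifold M" and N: "smooth_manifold N" and f: "smooth_at M N f p"
    and c: "(U', \<phi>') \<in> atlas M" "p \<in> U'" and d: "(V', \<psi>') \<in> atlas N" "f p \<in> V'"
  obtains S where "open_in M S" "p \<in> S" "S \<subseteq> U'" "f ` S \<subseteq> V'"
    "smooth_on (\<phi>' ` S) (\<lambda>x. \<psi>' (f (inv_into U' \<phi>' x)))"
proof -
  from f obtain U \<phi> V \<psi> S where 1: "(U, \<phi>) \<in> atlas M" "(V, \<psi>) \<in> atlas N" "open_in M S" "p \<in> S" "S \<subseteq> U"
    "f ` S \<subseteq> V" "smooth_on (\<phi> ` S) (\<lambda>x. \<psi> (f (inv_into U \<phi> x)))"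
    unfolding smooth_at_def by blast
  obtain T where T: "open_in M T" "p \<in> T" "f ` T \<subseteq> points N" "continuous_on T f"
    using smooth_atD[OF M N f] by metis
  have "openin (top_of_set T) (T \<inter> f -` V')"
    by (rule continuous_openin_preimage[OF T(4) _ chart_open[OF N d(1)]]) (use T(3) in auto)
  then have "open_in M (T \<inter> f -` V')" using openin_trans T(1) by blast
  then have S': "open_in M (S \<inter> U' \<inter> (T \<inter> f -` V'))"
    by (rule openin_Int[OF openin_Int[OF 1(3) chart_open[OF M c(1)]]])
  define S' where "S' = S \<inter> U' \<inter> (T \<inter> f -` V')"
  have sub: "S' \<subseteq> S" "S' \<subseteq> U'" "S' \<subseteq> U" "f ` S' \<subseteq> V'" "f ` S' \<subseteq> V"
    using 1 by (auto simp: S'_def)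
  have inv: "inv_into U \<phi> (\<phi> q) = q" "inv_into U' \<phi>' (\<phi>' q) = q" "inv_into V \<psi> (\<psi> (f q)) = f q"
    if "q \<in> S'" for q
    using that sub chart_inv[OF M 1(1), of q] chart_inv[OF M c(1), of q] chart_inv[OF N 1(2), of "f q"]
    by auto
  have a: "smooth_on (\<phi>' ` S') (\<lambda>x. \<phi> (inv_into U' \<phi>' x))"
    by (rule smooth_on_subset[OF chart_transition[OF M c(1) 1(1)]]) (use sub in auto)
  have "smooth_on (\<phi>' ` S') (\<lambda>x. \<psi> (f (inv_into U \<phi> (\<phi> (inv_into U' \<phi>' x)))))"
    by (rule smooth_on_compose[OF a 1(7)]) (use sub inv in auto)
  moreover have "\<psi> (f (inv_into U \<phi> (\<phi> (inv_into U' \<phi>' (\<phi>' q))))) \<in> \<psi> ` (V \<inter> V')" if "q \<in> S'" for q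
  proof -
    have "f q \<in> V \<inter> V'" using that sub by auto
    then show ?thesis using inv[OF that] by simp
  qed
  ultimately
  have "smooth_on (\<phi>' ` S') (\<lambda>x. \<psi>' (inv_into V \<psi> (\<psi> (f (inv_into U \<phi> (\<phi> (inv_into U' \<phi>' x)))))))"
    by (intro smooth_on_compose[OF _ chart_transition[OF N 1(2) d(1)]]) auto
  then have "smooth_on (\<phi>' ` S') (\<lambda>x. \<psi>' (f (inv_into U' \<phi>' x)))"
    by (rule smooth_on_cong) (use inv in auto)
  moreover have "p \<in> S'" using 1 T c d by (auto simp: S'_def)
  ultimately show ?thesis using that[of S'] S' sub by (simp add: S'_def)
qed

lemma smooth_atI_local:
  assumes "(U, \<phi>) \<in> atlas M" "(V, \<psi>) \<in> atlas N" "open_in M S" "p \<in> S" "S \<subseteq> U" "f ` S \<subseteq> V"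
    "smooth_on (\<phi> ` S) (\<lambda>x. \<psi> (f (inv_into U \<phi> x)))"
  shows "smooth_at M N f p"
  using assms unfolding smooth_at_def by blast

text \<open>From right to left, smoothness on the overlap of two given charts is a local matter, and
  around each point of the overlap these charts may be prescribed.\<close>

lemma smooth_map_iff:
  assumes M: "smooth_manifold M" and N: "smooth_manifold N"
  shows "smooth_map M N f \<longleftrightarrow> (\<forall>p\<in>points M. smooth_at M N f p)"
proof
  assume f: "smooth_map M N f"
  show "\<forall>p\<in>points M. smooth_at M N f p"
  proof
    fix p assume p: "p \<in> points M"
    obtain U \<phi> where U: "(U, \<phi>) \<in> atlas M" "p \<in> U" using p by (rule pointsE)
    have "f p \<in> points N" using f p by (auto simp: smooth_map_def)
    then obtain V \<psi> where V: "(V, \<psi>) \<in> atlas N" "f p \<in> V" by (rule pointsE)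
    have cont: "continuous_on U f" "f \<in> U \<rightarrow> points N"
      using f chart_subset[OF M U(1)] by (auto simp: smooth_map_def intro: continuous_on_subset)
    have "openin (top_of_set U) (U \<inter> f -` V)"
      by (rule continuous_openin_preimage[OF cont chart_open[OF N V(1)]])
    then have "open_in M (U \<inter> f -` V)" using openin_trans chart_open[OF M U(1)] by blast
    moreover have "smooth_on (\<phi> ` (U \<inter> f -` V)) (\<lambda>x. \<psi> (f (inv_into U \<phi> x)))"
      using f U(1) V(1) unfolding smooth_map_def o_def by blast
    ultimately show "smooth_at M N f p"
      using U V by (intro smooth_atI_local[OF U(1) V(1), of "U \<inter> f -` V"]) auto
  qed
next
  assume f: "\<forall>p\<in>points M. smooth_at M N f p"
  have "continuous_on (points M) f"
  proof -
    have "continuous (at p within points M) f" if p: "p \<in> points M" for p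
    proof -
      obtain S where S: "open_in M S" "p \<in> S" "continuous_on S f"
        using smooth_atD[OF M N bspec[OF f p]] by metis
      from S(1) obtain T where "open T" "S = points M \<inter> T" by (auto simp: openin_open)
      then have "at p within points M = at p within S"
        using S(2) by (intro at_within_nhd[of p T]) auto
      then show ?thesis using S by (simp add: continuous_on_eq_continuous_within)
    qed
    then show ?thesis by (simp add: continuous_on_eq_continuous_within)
  qed
  moreover have "f ` points M \<subseteq> points N"
    using smooth_at_points[OF M N] f by blast
  moreover have "smooth_on (\<phi> ` (U \<inter> f -` V)) (\<lambda>x. \<psi> (f (inv_into U \<phi> x)))"
    if U: "(U, \<phi>) \<in> atlas M" and V: "(V, \<psi>) \<in> atlas N" for U \<phi> V \<psi>
  proof (rule smooth_on_local)
    fix x assume "x \<in> \<phi> ` (U \<inter> f -` V)"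
    then obtain q where q: "q \<in> U" "f q \<in> V" "x = \<phi> q" by auto
    have fq: "smooth_at M N f q" using f q chart_subset[OF M U] by auto
    obtain S where S: "open_in M S" "q \<in> S" "S \<subseteq> U" "f ` S \<subseteq> V"
      "smooth_on (\<phi> ` S) (\<lambda>x. \<psi> (f (inv_into U \<phi> x)))"
      using smooth_at_charts[OF M N fq U q(1) V q(2)] by metis
    obtain W where W: "open W" "\<phi> ` S = \<phi> ` U \<inter> W"
      using chart_open_image(2)[OF M U S(1,3)] by blast
    have "smooth_on (\<phi> ` (U \<inter> f -` V) \<inter> W) (\<lambda>x. \<psi> (f (inv_into U \<phi> x)))"
      by (rule smooth_on_subset[OF S(5)]) (use W in auto)
    moreover have "x \<in> W" using W(2) S(2) q(3) by auto
    ultimately show "\<exists>W. open W \<and> x \<in> W \<and> smooth_on (\<phi> ` (U \<inter> f -` V) \<inter> W) (\<lambda>x. \<psi> (f (inv_into U \<phi> x)))"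
      using W(1) by blast
  qed
  ultimately show "smooth_map M N f" unfolding smooth_map_def o_def by blast
qed

lemma smooth_at_compose:
  assumes M: "smooth_manifold M" and N: "smooth_manifold N" and P: "smooth_manifold P"
    and f: "smooth_at M N f p" and g: "smooth_at N P g (f p)"
  shows "smooth_at M P (\<lambda>x. g (f x)) p"
proof -
  from g obtain V \<psi> Y \<kappa> T where g: "(V, \<psi>) \<in> atlas N" "(Y, \<kappa>) \<in> atlas P" "open_in N T" "f p \<in> T" "T \<subseteq> V"
    "g ` T \<subseteq> Y" "smooth_on (\<psi> ` T) (\<lambda>x. \<kappa> (g (inv_into V \<psi> x)))"
    unfolding smooth_at_def by blast
  obtain U \<phi> where U: "(U, \<phi>) \<in> atlas M" "p \<in> U"
    using smooth_at_points[OF M N f] by (auto elim: pointsE)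
  obtain S where S: "open_in M S" "p \<in> S" "S \<subseteq> U" "f ` S \<subseteq> V"
    "smooth_on (\<phi> ` S) (\<lambda>x. \<psi> (f (inv_into U \<phi> x)))"
    using smooth_at_charts[OF M N f U g(1)] g(4,5) by (metis subsetD)
  obtain S2 where S2: "open_in M S2" "p \<in> S2" "f ` S2 \<subseteq> points N" "continuous_on S2 f"
    using smooth_atD[OF M N f] by metis
  have "openin (top_of_set S2) (S2 \<inter> f -` T)"
    by (rule continuous_openin_preimage[OF S2(4) _ g(3)]) (use S2(3) in auto)
  then have "open_in M (S2 \<inter> f -` T)" using openin_trans S2(1) by blast
  then have op: "open_in M (S \<inter> (S2 \<inter> f -` T))" by (rule openin_Int[OF S(1)])
  define R where "R = S \<inter> (S2 \<inter> f -` T)"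
  have inv: "inv_into U \<phi> (\<phi> q) = q" "inv_into V \<psi> (\<psi> (f q)) = f q" if "q \<in> R" for q
    using that S chart_inv[OF M U(1), of q] chart_inv[OF N g(1), of "f q"] by (auto simp: R_def)
  have "smooth_on (\<phi> ` R) (\<lambda>x. \<psi> (f (inv_into U \<phi> x)))"
    by (rule smooth_on_subset[OF S(5)]) (auto simp: R_def)
  moreover have "\<psi> (f (inv_into U \<phi> (\<phi> q))) \<in> \<psi> ` T" if "q \<in> R" for q
  proof -
    have "f q \<in> T" using that by (simp add: R_def)
    then show ?thesis using inv[OF that] by simp
  qed
  ultimately
  have "smooth_on (\<phi> ` R) (\<lambda>x. \<kappa> (g (inv_into V \<psi> (\<psi> (f (inv_into U \<phi> x))))))"
    by (intro smooth_on_compose[OF _ g(7)]) auto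
  then have "smooth_on (\<phi> ` R) (\<lambda>x. \<kappa> (g (f (inv_into U \<phi> x))))"
    by (rule smooth_on_cong) (use inv in auto)
  then show ?thesis
    by (intro smooth_atI_local[OF U(1) g(2), of R]) (use op S S2 g(4,6) in \<open>auto simp: R_def\<close>)
qed

lemma smooth_at_cong:
  assumes M: "smooth_manifold M"
    and f: "smooth_at M N f p" and T: "open_in M T" "p \<in> T" "\<And>q. q \<in> T \<Longrightarrow> f q = g q"
  shows "smooth_at M N g p"
proof -
  from f obtain U \<phi> V \<psi> S where 1: "(U, \<phi>) \<in> atlas M" "(V, \<psi>) \<in> atlas N" "open_in M S" "p \<in> S" "S \<subseteq> U"
    "f ` S \<subseteq> V" "smooth_on (\<phi> ` S) (\<lambda>x. \<psi> (f (inv_into U \<phi> x)))"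
    unfolding smooth_at_def by blast
  have "smooth_on (\<phi> ` (S \<inter> T)) (\<lambda>x. \<psi> (g (inv_into U \<phi> x)))"
    by (rule smooth_on_subset_cong[OF 1(7)]) (use T(3) 1(5) chart_inv[OF M 1(1)] in \<open>auto simp: subset_eq\<close>)
  moreover have "open_in M (S \<inter> T)" using 1(3) T(1) by (rule openin_Int)
  ultimately show ?thesis
    by (intro smooth_atI_local[OF 1(1,2), of "S \<inter> T"]) (use 1 T in auto)
qed

section \<open>Open submanifolds, subsets of linear spaces, products\<close>

lemma points_sub_mfd: "points (sub_mfd M S) = points M \<inter> S"
  by (auto simp: points_def sub_mfd_def)

lemma points_eucl_mfd: "points (eucl_mfd E S) = S"
  by (auto simp: points_def eucl_mfd_def)

lemma atlas_eucl_mfd: "(S, \<lambda>x. x) \<in> atlas (eucl_mfd E S)"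
  by (simp add: eucl_mfd_def)

lemma atlas_sub_mfd: "(U, \<phi>) \<in> atlas M \<Longrightarrow> (U \<inter> S, \<phi>) \<in> atlas (sub_mfd M S)"
  by (force simp: sub_mfd_def)

lemma atlas_prod_mfd:
  "(U, \<phi>) \<in> atlas M \<Longrightarrow> (V, \<psi>) \<in> atlas N \<Longrightarrow> (U \<times> V, map_prod \<phi> \<psi>) \<in> atlas (prod_mfd M N)"
  by (force simp: prod_mfd_def)

lemma points_prod_mfd: "points (prod_mfd M N) = points M \<times> points N"
proof (rule Set.set_eqI)
  fix z
  show "z \<in> points (prod_mfd M N) \<longleftrightarrow> z \<in> points M \<times> points N"
  proof
    assume "z \<in> points (prod_mfd M N)"
    then obtain W \<kappa> where W: "(W, \<kappa>) \<in> atlas (prod_mfd M N)" "z \<in> W" by (rule pointsE)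
    then obtain U \<phi> V \<psi> where "(U, \<phi>) \<in> atlas M" "(V, \<psi>) \<in> atlas N" "W = U \<times> V"
      by (auto simp: prod_mfd_def)
    then show "z \<in> points M \<times> points N" using W(2) by (auto simp: points_def)
  next
    assume "z \<in> points M \<times> points N"
    then have "fst z \<in> points M" "snd z \<in> points N" by auto
    then obtain U \<phi> V \<psi> where U: "(U, \<phi>) \<in> atlas M" "fst z \<in> U" and V: "(V, \<psi>) \<in> atlas N" "snd z \<in> V"
      by (meson pointsE)
    have "z \<in> U \<times> V" using U V by (simp add: mem_Times_iff)
    then show "z \<in> points (prod_mfd M N)" using atlas_prod_mfd[OF U(1) V(1)] points_iff by metis
  qed
qed

lemma inv_into_ident: "x \<in> S \<Longrightarrow> inv_into S (\<lambda>x. x) x = x"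
  using f_inv_into_f[of x "\<lambda>x. x" S] by simp

lemma smooth_manifold_eucl_mfd:
  assumes "subspace E" "openin (top_of_set E) S"
  shows "smooth_manifold (eucl_mfd E S)"
proof -
  have "homeomorphism S S (\<lambda>x. x) (inv_into S (\<lambda>x. x))"
    by (auto simp: homeomorphism_def inv_into_ident cong: continuous_on_cong)
  moreover have "smooth_on S (\<lambda>x. inv_into S (\<lambda>x. x) x)"
    by (rule smooth_on_cong[OF smooth_on_id]) (simp add: inv_into_ident)
  ultimately show ?thesis using assms
    by (auto simp: smooth_manifold_def points_eucl_mfd) (auto simp: eucl_mfd_def o_def)
qed

lemma smooth_manifold_eucl: "smooth_manifold eucl"
  by (rule smooth_manifold_eucl_mfd) auto

lemma smooth_manifold_sub_mfd:
  assumes M: "smooth_manifold M" and S: "open_in M S"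
  shows "smooth_manifold (sub_mfd M S)"
proof -
  have pt: "points (sub_mfd M S) = S" using openin_subset[OF S] by (auto simp: points_sub_mfd)
  have inv: "inv_into (U \<inter> S) \<phi> x = inv_into U \<phi> x"
    if "(U, \<phi>) \<in> atlas M" "x \<in> \<phi> ` (U \<inter> S)" for U \<phi> x
    using that chart_inv[OF M that(1)]
    by (auto intro!: inv_into_f_eq inj_on_subset[OF chart_inj[OF M that(1)]])
  have "open_in (sub_mfd M S) (U \<inter> S) \<and> openin (top_of_set (model M)) (\<phi> ` (U \<inter> S)) \<and>
      homeomorphism (U \<inter> S) (\<phi> ` (U \<inter> S)) \<phi> (inv_into (U \<inter> S) \<phi>)"
    if U: "(U, \<phi>) \<in> atlas M" for U \<phi>
  proof (intro conjI)
    have US: "open_in M (U \<inter> S)" using chart_open[OF M U] S by (rule openin_Int)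
    show "openin (top_of_set (model M)) (\<phi> ` (U \<inter> S))"
      by (rule chart_open_image(1)[OF M U US]) auto
    show "open_in (sub_mfd M S) (U \<inter> S)"
      unfolding pt by (rule openin_subset_trans[OF US]) (use openin_subset[OF S] in auto)
    have "continuous_on (\<phi> ` (U \<inter> S)) (inv_into U \<phi>)"
      by (rule continuous_on_subset[OF chart_inv_cont[OF M U]]) auto
    then have "continuous_on (\<phi> ` (U \<inter> S)) (inv_into (U \<inter> S) \<phi>)"
      using inv[OF U] by (simp cong: continuous_on_cong)
    then show "homeomorphism (U \<inter> S) (\<phi> ` (U \<inter> S)) \<phi> (inv_into (U \<inter> S) \<phi>)"
      using inv[OF U] chart_inv[OF M U] continuous_on_subset[OF chart_cont[OF M U], of "U \<inter> S"]
      by (simp add: homeomorphism_def image_image)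
  qed
  moreover have "smooth_on (\<phi> ` (U \<inter> S \<inter> (V \<inter> S))) (\<lambda>x. \<psi> (inv_into (U \<inter> S) \<phi> x))"
    if "(U, \<phi>) \<in> atlas M" "(V, \<psi>) \<in> atlas M" for U \<phi> V \<psi>
    by (rule smooth_on_subset_cong[OF chart_transition[OF M that]])
      (use inv[OF that(1)] in auto)
  moreover have "subspace (model M)" using M by (simp add: smooth_manifold_def)
  ultimately show ?thesis
    by (auto simp: smooth_manifold_def o_def) (auto simp: sub_mfd_def)
qed

lemma inv_into_map_prod:
  assumes "inj_on \<phi> U" "inj_on \<psi> V" "p \<in> U" "q \<in> V"
  shows "inv_into (U \<times> V) (map_prod \<phi> \<psi>) (\<phi> p, \<psi> q) = (p, q)"
  using assms by (intro inv_into_f_eq) (auto simp: inj_on_def)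

lemma smooth_manifold_prod_mfd:
  assumes M: "smooth_manifold M" and N: "smooth_manifold N"
  shows "smooth_manifold (prod_mfd M N)"
proof -
  have inv: "inv_into (U \<times> V) (map_prod \<phi> \<psi>) z = (inv_into U \<phi> (fst z), inv_into V \<psi> (snd z))"
    if "(U, \<phi>) \<in> atlas M" "(V, \<psi>) \<in> atlas N" "z \<in> map_prod \<phi> \<psi> ` (U \<times> V)" for U \<phi> V \<psi> z
    using that(3) inv_into_map_prod[OF chart_inj[OF M that(1)] chart_inj[OF N that(2)]]
      chart_inv[OF M that(1)] chart_inv[OF N that(2)] by auto
  have "open_in (prod_mfd M N) (U \<times> V) \<and>
      openin (top_of_set (model M \<times> model N)) (map_prod \<phi> \<psi> ` (U \<times> V)) \<and>
      homeomorphism (U \<times> V) (map_prod \<phi> \<psi> ` (U \<times> V)) (map_prod \<phi> \<psi>) (inv_into (U \<times> V) (map_prod \<phi> \<psi>))"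
    if U: "(U, \<phi>) \<in> atlas M" and V: "(V, \<psi>) \<in> atlas N" for U \<phi> V \<psi>
  proof (intro conjI)
    have im: "map_prod \<phi> \<psi> ` (U \<times> V) = \<phi> ` U \<times> \<psi> ` V" by force
    show "open_in (prod_mfd M N) (U \<times> V)"
      unfolding points_prod_mfd by (rule openin_Times[OF chart_open[OF M U] chart_open[OF N V]])
    show "openin (top_of_set (model M \<times> model N)) (map_prod \<phi> \<psi> ` (U \<times> V))"
      unfolding im by (rule openin_Times[OF chart_image_open[OF M U] chart_image_open[OF N V]])
    have "continuous_on (U \<times> V) (map_prod \<phi> \<psi>)"
      unfolding map_prod_def case_prod_beta
      by (intro continuous_on_Pair continuous_on_compose2[OF chart_cont[OF M U]]
          continuous_on_compose2[OF chart_cont[OF N V]] continuous_intros) auto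
    moreover have "continuous_on (\<phi> ` U \<times> \<psi> ` V) (\<lambda>z. (inv_into U \<phi> (fst z), inv_into V \<psi> (snd z)))"
      by (intro continuous_on_Pair continuous_on_compose2[OF chart_inv_cont[OF M U]]
          continuous_on_compose2[OF chart_inv_cont[OF N V]] continuous_intros) auto
    then have "continuous_on (map_prod \<phi> \<psi> ` (U \<times> V)) (inv_into (U \<times> V) (map_prod \<phi> \<psi>))"
      using inv[OF U V] im by (simp cong: continuous_on_cong)
    ultimately show "homeomorphism (U \<times> V) (map_prod \<phi> \<psi> ` (U \<times> V)) (map_prod \<phi> \<psi>)
        (inv_into (U \<times> V) (map_prod \<phi> \<psi>))"
      using inv[OF U V] chart_inv[OF M U] chart_inv[OF N V]
      by (auto simp: homeomorphism_def image_iff) force+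
  qed
  moreover have "smooth_on (map_prod \<phi> \<psi> ` (U \<times> V \<inter> U' \<times> V'))
      (\<lambda>z. map_prod \<phi>' \<psi>' (inv_into (U \<times> V) (map_prod \<phi> \<psi>) z))"
    if U: "(U, \<phi>) \<in> atlas M" and V: "(V, \<psi>) \<in> atlas N"
      and U': "(U', \<phi>') \<in> atlas M" and V': "(V', \<psi>') \<in> atlas N" for U \<phi> V \<psi> U' \<phi>' V' \<psi>'
  proof -
    have "smooth_on (map_prod \<phi> \<psi> ` (U \<times> V \<inter> U' \<times> V'))
        (\<lambda>z. (\<phi>' (inv_into U \<phi> (fst z)), \<psi>' (inv_into V \<psi> (snd z))))"
      by (intro smooth_on_Pair smooth_on_compose[OF smooth_on_linear[OF bounded_linear_fst] chart_transition[OF M U U']]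
          smooth_on_compose[OF smooth_on_linear[OF bounded_linear_snd] chart_transition[OF N V V']]) auto
    then show ?thesis
      by (rule smooth_on_cong)
        (auto simp: inv_into_map_prod[OF chart_inj[OF M U] chart_inj[OF N V]] chart_inv[OF M U] chart_inv[OF N V])
  qed
  moreover have "subspace (model M \<times> model N)"
    using M N by (simp add: smooth_manifold_def subspace_Times)
  ultimately show ?thesis
    unfolding smooth_manifold_def o_def by (auto simp: prod_mfd_def)
qed

section \<open>Basic smooth maps: identity, constants, restrictions, pairs, projections\<close>

lemma smooth_at_ident:
  assumes M: "smooth_manifold M" and "p \<in> points M" shows "smooth_at M M (\<lambda>x. x) p"
proof -
  obtain U \<phi> where U: "(U, \<phi>) \<in> atlas M" "p \<in> U" using assms(2) by (rule pointsE)
  show ?thesis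
  proof (rule smooth_atI_local[OF U(1) U(1) chart_open[OF M U(1)] U(2)])
    show "smooth_on (\<phi> ` U) (\<lambda>x. \<phi> (inv_into U \<phi> x))"
      by (rule smooth_on_cong[OF smooth_on_id]) (simp add: f_inv_into_f)
  qed auto
qed

lemma smooth_at_const:
  assumes M: "smooth_manifold M" and N: "smooth_manifold N" and "p \<in> points M" "c \<in> points N"
  shows "smooth_at M N (\<lambda>x. c) p"
proof -
  obtain U \<phi> where U: "(U, \<phi>) \<in> atlas M" "p \<in> U" using assms(3) by (rule pointsE)
  obtain V \<psi> where V: "(V, \<psi>) \<in> atlas N" "c \<in> V" using assms(4) by (rule pointsE)
  show ?thesis
    by (rule smooth_atI_local[OF U(1) V(1) chart_open[OF M U(1)] U(2)])
      (use V in \<open>auto intro: smooth_on_const\<close>)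
qed

lemma
  assumes M: "smooth_manifold M" and S: "open_in M S" and p: "p \<in> S"
  shows smooth_at_sub_incl: "smooth_at (sub_mfd M S) M (\<lambda>x. x) p"
    and smooth_at_sub_restr: "smooth_at M (sub_mfd M S) (\<lambda>x. x) p"
proof -
  have "p \<in> points M" using openin_subset[OF S] p by auto
  then obtain U \<phi> where U: "(U, \<phi>) \<in> atlas M" "p \<in> U" by (rule pointsE)
  note US = atlas_sub_mfd[OF U(1), of S]
  have MS: "smooth_manifold (sub_mfd M S)" by (rule smooth_manifold_sub_mfd[OF M S])
  show "smooth_at (sub_mfd M S) M (\<lambda>x. x) p"
  proof (rule smooth_atI_local[OF US U(1) chart_open[OF MS US]])
    show "smooth_on (\<phi> ` (U \<inter> S)) (\<lambda>x. \<phi> (inv_into (U \<inter> S) \<phi> x))"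
      by (rule smooth_on_cong[OF smooth_on_id]) (simp add: f_inv_into_f)
  qed (use U p in auto)
  show "smooth_at M (sub_mfd M S) (\<lambda>x. x) p"
  proof (rule smooth_atI_local[OF U(1) US openin_Int[OF chart_open[OF M U(1)] S]])
    show "smooth_on (\<phi> ` (U \<inter> S)) (\<lambda>x. \<phi> (inv_into U \<phi> x))"
      by (rule smooth_on_cong[OF smooth_on_id]) (auto simp: chart_inv[OF M U(1)])
  qed (use U p in auto)
qed

lemma smooth_at_sub_domain:
  assumes M: "smooth_manifold M" and N: "smooth_manifold N" and S: "open_in M S" and p: "p \<in> S"
  shows "smooth_at (sub_mfd M S) N f p \<longleftrightarrow> smooth_at M N f p"
  using smooth_at_compose[where f="\<lambda>x. x" and g=f, OF M smooth_manifold_sub_mfd[OF M S] N smooth_at_sub_restr[OF M S p]]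
    smooth_at_compose[where f="\<lambda>x. x" and g=f, OF smooth_manifold_sub_mfd[OF M S] M N smooth_at_sub_incl[OF M S p]]
  by blast

lemma smooth_at_sub_range:
  assumes M: "smooth_manifold M" and N: "smooth_manifold N" and S: "open_in N S" and p: "f p \<in> S"
  shows "smooth_at M (sub_mfd N S) f p \<longleftrightarrow> smooth_at M N f p"
  using smooth_at_compose[where f=f and g="\<lambda>x. x", OF M N smooth_manifold_sub_mfd[OF N S] _ smooth_at_sub_restr[OF N S p]]
    smooth_at_compose[where f=f and g="\<lambda>x. x", OF M smooth_manifold_sub_mfd[OF N S] N _ smooth_at_sub_incl[OF N S p]]
  by blast

lemma smooth_at_Pair:
  assumes M: "smooth_manifold M" and N: "smooth_manifold N" and P: "smooth_manifold P"
    and f: "smooth_at P M f p" and g: "smooth_at P N g p"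
  shows "smooth_at P (prod_mfd M N) (\<lambda>x. (f x, g x)) p"
proof -
  obtain U \<phi> where U: "(U, \<phi>) \<in> atlas P" "p \<in> U"
    using smooth_at_points[OF P M f] by (auto elim: pointsE)
  obtain V \<psi> where V: "(V, \<psi>) \<in> atlas M" "f p \<in> V"
    using smooth_at_points[OF P M f] by (auto elim: pointsE)
  obtain V' \<psi>' where V': "(V', \<psi>') \<in> atlas N" "g p \<in> V'"
    using smooth_at_points[OF P N g] by (auto elim: pointsE)
  obtain S where S: "open_in P S" "p \<in> S" "S \<subseteq> U" "f ` S \<subseteq> V"
    "smooth_on (\<phi> ` S) (\<lambda>x. \<psi> (f (inv_into U \<phi> x)))"
    using smooth_at_charts[OF P M f U V] by metis
  obtain T where T: "open_in P T" "p \<in> T" "T \<subseteq> U" "g ` T \<subseteq> V'"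
    "smooth_on (\<phi> ` T) (\<lambda>x. \<psi>' (g (inv_into U \<phi> x)))"
    using smooth_at_charts[OF P N g U V'] by metis
  show ?thesis
  proof (rule smooth_atI_local[OF U(1) atlas_prod_mfd[OF V(1) V'(1)] openin_Int[OF S(1) T(1)]])
    have "smooth_on (\<phi> ` (S \<inter> T)) (\<lambda>x. (\<psi> (f (inv_into U \<phi> x)), \<psi>' (g (inv_into U \<phi> x))))"
      by (intro smooth_on_Pair smooth_on_subset[OF S(5)] smooth_on_subset[OF T(5)]) auto
    then show "smooth_on (\<phi> ` (S \<inter> T)) (\<lambda>x. map_prod \<psi> \<psi>' (f (inv_into U \<phi> x), g (inv_into U \<phi> x)))"
      by simp
  qed (use S T in auto)
qed

lemma
  assumes M: "smooth_manifold M" and N: "smooth_manifold N" and p: "p \<in> points M" "q \<in> points N"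
  shows smooth_at_fst: "smooth_at (prod_mfd M N) M fst (p, q)"
    and smooth_at_snd: "smooth_at (prod_mfd M N) N snd (p, q)"
proof -
  obtain U \<phi> where U: "(U, \<phi>) \<in> atlas M" "p \<in> U" using p(1) by (rule pointsE)
  obtain V \<psi> where V: "(V, \<psi>) \<in> atlas N" "q \<in> V" using p(2) by (rule pointsE)
  note UV = atlas_prod_mfd[OF U(1) V(1)]
  note op = chart_open[OF smooth_manifold_prod_mfd[OF M N] UV]
  note inv = inv_into_map_prod[OF chart_inj[OF M U(1)] chart_inj[OF N V(1)]]
  show "smooth_at (prod_mfd M N) M fst (p, q)"
  proof (rule smooth_atI_local[OF UV U(1) op])
    show "smooth_on (map_prod \<phi> \<psi> ` (U \<times> V)) (\<lambda>z. \<phi> (fst (inv_into (U \<times> V) (map_prod \<phi> \<psi>) z)))"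
      by (rule smooth_on_cong[OF smooth_on_linear[OF bounded_linear_fst]]) (auto simp: inv)
  qed (use U V in auto)
  show "smooth_at (prod_mfd M N) N snd (p, q)"
  proof (rule smooth_atI_local[OF UV V(1) op])
    show "smooth_on (map_prod \<phi> \<psi> ` (U \<times> V)) (\<lambda>z. \<psi> (snd (inv_into (U \<times> V) (map_prod \<phi> \<psi>) z)))"
      by (rule smooth_on_cong[OF smooth_on_linear[OF bounded_linear_snd]]) (auto simp: inv)
  qed (use U V in auto)
qed

section \<open>Maps between subsets of linear spaces, and charts as smooth maps\<close>

lemma smooth_at_eucl_mfd:
  assumes "openin (top_of_set S) T" "x \<in> T" "smooth_on T f" "f ` T \<subseteq> S'"
  shows "smooth_at (eucl_mfd E S) (eucl_mfd E' S') f x"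
proof (rule smooth_atI_local[where S=T, OF atlas_eucl_mfd atlas_eucl_mfd])
  show "smooth_on ((\<lambda>x. x) ` T) (\<lambda>x. f (inv_into S (\<lambda>x. x) x))"
    by (rule smooth_on_subset_cong[OF assms(3)])
      (use openin_subset[OF assms(1)] in \<open>auto simp: inv_into_ident subset_eq\<close>)
qed (use assms openin_subset[OF assms(1)] in \<open>auto simp: points_eucl_mfd\<close>)

lemma smooth_at_eucl_mfd_imp_smooth_on:
  assumes E: "smooth_manifold (eucl_mfd E S)" and E': "smooth_manifold (eucl_mfd E' S')"
    and "\<And>x. x \<in> T \<Longrightarrow> smooth_at (eucl_mfd E S) (eucl_mfd E' S') f x"
  shows "smooth_on T f"
proof (rule smooth_on_local)
  fix x assume "x \<in> T"
  then have f: "smooth_at (eucl_mfd E S) (eucl_mfd E' S') f x" using assms by blast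
  have pt: "x \<in> S" "f x \<in> S'" using smooth_at_points[OF E E' f] by (auto simp: points_eucl_mfd)
  obtain R where R: "open_in (eucl_mfd E S) R" "x \<in> R" "R \<subseteq> S" "f ` R \<subseteq> S'"
    "smooth_on ((\<lambda>x. x) ` R) (\<lambda>x. f (inv_into S (\<lambda>x. x) x))"
    using smooth_at_charts[OF E E' f atlas_eucl_mfd pt(1) atlas_eucl_mfd pt(2)] by metis
  obtain W where W: "open W" "R = S \<inter> W" using R(1) by (auto simp: points_eucl_mfd openin_open)
  have TS: "T \<subseteq> S" using assms(3) smooth_at_points[OF E E'] by (auto simp: points_eucl_mfd)
  have "smooth_on (T \<inter> W) f"
    by (rule smooth_on_subset_cong[OF R(5)]) (use W TS in \<open>auto simp: inv_into_ident\<close>)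
  then show "\<exists>W. open W \<and> x \<in> W \<and> smooth_on (T \<inter> W) f" using W R by blast
qed

text \<open>With identity charts a map into a linear space has the same coordinate expression
  whichever model space contains its values, so the codomain can be exchanged for any set containing
  the values near \<open>p\<close>.\<close>

lemma smooth_at_eucl_range:
  assumes M: "smooth_manifold M" and f: "smooth_at M (eucl_mfd E S) f p"
    and T: "open_in M T" "p \<in> T" "f ` T \<subseteq> S'"
  shows "smooth_at M (eucl_mfd E' S') f p"
proof -
  from f obtain U \<phi> R where 1: "(U, \<phi>) \<in> atlas M" "open_in M R" "p \<in> R" "R \<subseteq> U"
    "smooth_on (\<phi> ` R) (\<lambda>x. f (inv_into U \<phi> x))"
    unfolding smooth_at_def by (auto simp: eucl_mfd_def)
  show ?thesis
  proof (rule smooth_atI_local[OF 1(1) atlas_eucl_mfd openin_Int[OF 1(2) T(1)]])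
    show "smooth_on (\<phi> ` (R \<inter> T)) (\<lambda>x. f (inv_into U \<phi> x))"
      by (rule smooth_on_subset[OF 1(5)]) auto
  qed (use 1 T in auto)
qed

lemma smooth_at_imp_eucl:
  assumes M: "smooth_manifold M" and f: "smooth_at M (eucl_mfd E S) f p" and "p \<in> points M"
  shows "smooth_at M eucl f p"
  by (rule smooth_at_eucl_range[OF M f, of "points M"]) (use assms in auto)

text \<open>The chart is taken as a map into the full Euclidean space, where inner products extract
  coordinates. Its inverse starts from the relatively open image in the model space.\<close>

lemma
  assumes M: "smooth_manifold M" and U: "(U, \<phi>) \<in> atlas M" and p: "p \<in> U"
  shows smooth_at_chart: "smooth_at M eucl \<phi> p"
    and smooth_at_chart_inv: "smooth_at (eucl_mfd (model M) (\<phi> ` U)) M (inv_into U \<phi>) (\<phi> p)"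
proof -
  have eq: "smooth_on (\<phi> ` U) (\<lambda>x. \<phi> (inv_into U \<phi> x))"
    by (rule smooth_on_cong[OF smooth_on_id]) (simp add: f_inv_into_f)
  then show "smooth_at M eucl \<phi> p"
    by (intro smooth_atI_local[OF U atlas_eucl_mfd chart_open[OF M U] p]) auto
  show "smooth_at (eucl_mfd (model M) (\<phi> ` U)) M (inv_into U \<phi>) (\<phi> p)"
  proof (rule smooth_atI_local[OF atlas_eucl_mfd U])
    show "smooth_on ((\<lambda>x. x) ` \<phi> ` U) (\<lambda>x. \<phi> (inv_into U \<phi> (inv_into (\<phi> ` U) (\<lambda>x. x) x)))"
      by (rule smooth_on_subset_cong[OF eq]) (auto simp: inv_into_ident)
  qed (use p in \<open>auto simp: points_eucl_mfd inv_into_into\<close>)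
qed

lemma smooth_at_eucl_compose:
  fixes f :: "'a::{t2_space,second_countable_topology} \<Rightarrow> 'd::euclidean_space" and g :: "'d \<Rightarrow> 'f::euclidean_space"
  assumes M: "smooth_manifold M" and f: "smooth_at M eucl f p" and g: "smooth_on W g" "open W" "f p \<in> W"
  shows "smooth_at M eucl (\<lambda>x. g (f x)) p"
  by (rule smooth_at_compose[OF M smooth_manifold_eucl smooth_manifold_eucl f])
    (rule smooth_at_eucl_mfd[of _ W]; use g in \<open>auto\<close>)

lemma smooth_at_eucl_Pair:
  fixes f :: "'a::{t2_space,second_countable_topology} \<Rightarrow> 'd::euclidean_space" and g :: "'a \<Rightarrow> 'f::euclidean_space"
  assumes M: "smooth_manifold M" and f: "smooth_at M eucl f p" and g: "smooth_at M eucl g p"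
  shows "smooth_at M eucl (\<lambda>x. (f x, g x)) p"
proof -
  obtain U \<phi> where U: "(U, \<phi>) \<in> atlas M" "p \<in> U"
    using smooth_at_points[OF M smooth_manifold_eucl f] by (auto elim: pointsE)
  obtain S where S: "open_in M S" "p \<in> S" "S \<subseteq> U" "smooth_on (\<phi> ` S) (\<lambda>x. f (inv_into U \<phi> x))"
    using smooth_at_charts[OF M smooth_manifold_eucl f U atlas_eucl_mfd] by (metis UNIV_I)
  obtain T where T: "open_in M T" "p \<in> T" "T \<subseteq> U" "smooth_on (\<phi> ` T) (\<lambda>x. g (inv_into U \<phi> x))"
    using smooth_at_charts[OF M smooth_manifold_eucl g U atlas_eucl_mfd] by (metis UNIV_I)
  show ?thesis
  proof (rule smooth_atI_local[OF U(1) atlas_eucl_mfd openin_Int[OF S(1) T(1)]])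
    show "smooth_on (\<phi> ` (S \<inter> T)) (\<lambda>x. (f (inv_into U \<phi> x), g (inv_into U \<phi> x)))"
      by (intro smooth_on_Pair smooth_on_subset[OF S(4)] smooth_on_subset[OF T(4)]) auto
  qed (use S T in auto)
qed

lemma smooth_fun_on_iff:
  assumes M: "smooth_manifold M" and U: "open_in M U"
  shows "smooth_fun_on M U f \<longleftrightarrow> (\<forall>p\<in>U. smooth_at M eucl f p)"
proof -
  have "points (sub_mfd M U) = U" using openin_subset[OF U] by (auto simp: points_sub_mfd)
  then show ?thesis
    unfolding smooth_fun_on_def
    by (simp add: smooth_map_iff[OF smooth_manifold_sub_mfd[OF M U] smooth_manifold_eucl]
        smooth_at_sub_domain[OF M smooth_manifold_eucl U])
qed

lemma smooth_fun_near_iff: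
  assumes M: "smooth_manifold M"
  shows "smooth_fun_near M p f \<longleftrightarrow> smooth_at M eucl f p"
proof
  assume "smooth_fun_near M p f"
  then show "smooth_at M eucl f p"
    unfolding smooth_fun_near_def using smooth_fun_on_iff[OF M] by blast
next
  assume "smooth_at M eucl f p"
  then obtain S where "open_in M S" "p \<in> S" "\<And>q. q \<in> S \<Longrightarrow> smooth_at M eucl f q"
    using smooth_atD[OF M smooth_manifold_eucl] by metis
  then show "smooth_fun_near M p f"
    unfolding smooth_fun_near_def using smooth_fun_on_iff[OF M] by blast
qed

section \<open>Flows of complete vector fields\<close>

text \<open>The coordinate representative of the field. A tangent vector is accessible only through
  its values on functions, so its components are read off from the chart coordinates.\<close>

definition chart_field :: "'a set \<Rightarrow> ('a \<Rightarrow> 'e::euclidean_space) \<Rightarrow> ('a \<Rightarrow> 'a tvec) \<Rightarrow> 'e \<Rightarrow> 'e" where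
  "chart_field U \<phi> X c = (\<Sum>i\<in>Basis. X (inv_into U \<phi> c) (\<lambda>q. \<phi> q \<bullet> i) *\<^sub>R i)"

lemma smooth_at_inner:
  assumes M: "smooth_manifold M" and f: "smooth_at M eucl f p"
  shows "smooth_at M eucl (\<lambda>q. f q \<bullet> i) p"
  by (rule smooth_at_eucl_compose[OF M f smooth_on_linear[OF bounded_linear_inner_left], of UNIV]) auto

lemma chart_field_smooth:
  assumes M: "smooth_manifold M" and X: "vector_field M X" and U: "(U, \<phi>) \<in> atlas M"
  shows "smooth_on (\<phi> ` U) (chart_field U \<phi> X)"
proof -
  have E: "smooth_manifold (eucl_mfd (model M) (\<phi> ` U))"
    using M chart_image_open[OF M U] by (intro smooth_manifold_eucl_mfd) (auto simp: smooth_manifold_def)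
  have "smooth_on (\<phi> ` U) (\<lambda>c. X (inv_into U \<phi> c) (\<lambda>q. \<phi> q \<bullet> i))" for i
  proof (rule smooth_at_eucl_mfd_imp_smooth_on[OF E smooth_manifold_eucl])
    fix c assume "c \<in> \<phi> ` U"
    then obtain p where p: "p \<in> U" "c = \<phi> p" by auto
    have "smooth_fun_on M U (\<lambda>q. \<phi> q \<bullet> i)"
      unfolding smooth_fun_on_iff[OF M chart_open[OF M U]]
      using smooth_at_inner[OF M smooth_at_chart[OF M U]] by blast
    then have "smooth_fun_on M U (\<lambda>p. X p (\<lambda>q. \<phi> q \<bullet> i))"
      using X chart_open[OF M U] unfolding vector_field_def by blast
    then have "smooth_at M eucl (\<lambda>p. X p (\<lambda>q. \<phi> q \<bullet> i)) p"
      using p unfolding smooth_fun_on_iff[OF M chart_open[OF M U]] by blast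
    then show "smooth_at (eucl_mfd (model M) (\<phi> ` U)) eucl (\<lambda>c. X (inv_into U \<phi> c) (\<lambda>q. \<phi> q \<bullet> i)) c"
      using smooth_at_compose[OF E M smooth_manifold_eucl smooth_at_chart_inv[OF M U p(1)],
          of "\<lambda>p. X p (\<lambda>q. \<phi> q \<bullet> i)"] chart_inv[OF M U p(1)]
      unfolding p(2) by simp
  qed
  then show ?thesis
    unfolding chart_field_def[abs_def]
    by (intro smooth_on_sum smooth_on_linear_compose[OF bounded_linear_scaleR_left])
qed

lemma integral_curve_chart:
  assumes M: "smooth_manifold M" and U: "(U, \<phi>) \<in> atlas M"
    and g: "integral_curve M X \<gamma>" and t: "\<gamma> t \<in> U"
  shows "((\<lambda>s. \<phi> (\<gamma> s)) has_vector_derivative chart_field U \<phi> X (\<phi> (\<gamma> t))) (at t)"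
proof -
  have "((\<lambda>s. \<phi> (\<gamma> s) \<bullet> i) has_vector_derivative X (\<gamma> t) (\<lambda>q. \<phi> q \<bullet> i)) (at t)" for i
  proof -
    have "smooth_fun_near M (\<gamma> t) (\<lambda>q. \<phi> q \<bullet> i)"
      unfolding smooth_fun_near_iff[OF M] by (rule smooth_at_inner[OF M smooth_at_chart[OF M U t]])
    then have "((\<lambda>s. \<phi> (\<gamma> s) \<bullet> i) has_real_derivative X (\<gamma> t) (\<lambda>q. \<phi> q \<bullet> i)) (at t)"
      using g unfolding integral_curve_def by blast
    then show ?thesis by (simp add: has_real_derivative_iff_has_vector_derivative)
  qed
  then have "((\<lambda>s. \<Sum>i\<in>Basis. (\<phi> (\<gamma> s) \<bullet> i) *\<^sub>R i) has_vector_derivative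
      (\<Sum>i\<in>Basis. X (\<gamma> t) (\<lambda>q. \<phi> q \<bullet> i) *\<^sub>R i)) (at t)"
    by (intro has_vector_derivative_sum bounded_linear.has_vector_derivative[OF bounded_linear_scaleR_left])
  then show ?thesis
    by (simp add: euclidean_representation chart_field_def chart_inv[OF M U t])
qed

text \<open>Collects what the local theory of differential equations needs. The representative is
  extended from the relatively open chart image to an ambient function \<open>g\<close>; compactness
  of the ball gives the speed bound \<open>K\<close> and the Lipschitz constant \<open>L\<close>;
  integral curves inside the ball solve the autonomous equation of \<open>g\<close>.\<close>

lemma local_chart_field:
  fixes M :: "('a::{t2_space,second_countable_topology}, 'e::euclidean_space) mfd"
  assumes M: "smooth_manifold M" and X: "vector_field M X" and U: "(U, \<phi>) \<in> atlas M" and p0: "p0 \<in> U"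
  obtains R K L g where "R > 0" "K > 0" "L \<ge> 0" "cball (\<phi> p0) R \<inter> model M \<subseteq> \<phi> ` U"
    "\<And>k. Ck_on k (ball (\<phi> p0) R) g" "\<And>c. c \<in> cball (\<phi> p0) R \<Longrightarrow> norm (g c) \<le> K"
    "\<And>c c'. c \<in> cball (\<phi> p0) R \<Longrightarrow> c' \<in> cball (\<phi> p0) R \<Longrightarrow> norm (g c - g c') \<le> L * norm (c - c')"
    "\<And>\<gamma> t. integral_curve M X \<gamma> \<Longrightarrow> \<gamma> t \<in> U \<Longrightarrow> \<phi> (\<gamma> t) \<in> cball (\<phi> p0) R \<Longrightarrow>
      ((\<lambda>s. \<phi> (\<gamma> s)) has_vector_derivative g (\<phi> (\<gamma> t))) (at t)"
proof -
  define c0 where "c0 = \<phi> p0"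
  have c0: "c0 \<in> \<phi> ` U" using p0 by (simp add: c0_def)
  obtain W g where W: "open W" "c0 \<in> W" "\<And>k. Ck_on k W g"
    "\<And>c. c \<in> \<phi> ` U \<Longrightarrow> c \<in> W \<Longrightarrow> chart_field U \<phi> X c = g c"
    using smooth_onE[OF chart_field_smooth[OF M X U] c0] by metis
  obtain V where V: "open V" "\<phi> ` U = model M \<inter> V"
    using chart_image_open[OF M U] by (auto simp: openin_open)
  have "open (W \<inter> V)" "c0 \<in> W \<inter> V" using W V c0 by auto
  then obtain R where R: "R > 0" "cball c0 R \<subseteq> W \<inter> V" by (meson open_contains_cball)
  have cW: "cball c0 R \<subseteq> W" using R(2) by simp
  have "compact (g ` cball c0 R)"
    by (rule compact_continuous_image[OF continuous_on_subset[OF Ck_on_imp_continuous_on[OF W(3)[of 0]] cW]]) simp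
  then have "bounded (g ` cball c0 R)" by (rule compact_imp_bounded)
  then obtain K where K0: "K > 0" "\<forall>x\<in>g ` cball c0 R. norm x \<le> K" unfolding bounded_pos by blast
  have K: "K > 0" "\<And>c. c \<in> cball c0 R \<Longrightarrow> norm (g c) \<le> K" using K0 by auto
  obtain g' where g': "\<And>x. x \<in> W \<Longrightarrow> (g has_derivative g' x) (at x)" "\<And>v. Ck_on 0 W (\<lambda>x. g' x v)"
    using Ck_on_SucE[OF W(3)[of 1, unfolded One_nat_def]] by metis
  have g'W: "(g has_derivative g' x) (at x)" if "x \<in> cball c0 R" for x
    by (rule g'(1)[OF subsetD[OF cW that]])
  obtain L where L: "L \<ge> 0" "\<And>c v. c \<in> cball c0 R \<Longrightarrow> norm (g' c v) \<le> L * norm v"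
  proof (rule compact_linear_bound[of "cball c0 R" g'])
    show "linear (g' c)" if "c \<in> cball c0 R" for c
      by (rule has_derivative_linear[OF g'W[OF that]])
    show "continuous_on (cball c0 R) (\<lambda>c. g' c v)" for v
      by (rule continuous_on_subset[OF Ck_on_imp_continuous_on[OF g'(2)] cW])
  qed auto
  have Lip: "norm (g c - g c') \<le> L * norm (c - c')" if "c \<in> cball c0 R" "c' \<in> cball c0 R" for c c'
  proof (rule differentiable_bound[OF convex_cball _ _ that])
    show "(g has_derivative g' x) (at x within cball c0 R)" if "x \<in> cball c0 R" for x
      by (rule has_derivative_at_withinI[OF g'W[OF that]])
    show "onorm (g' x) \<le> L" if "x \<in> cball c0 R" for x
      by (rule onorm_le) (rule L(2)[OF that])
  qed
  have D: "((\<lambda>s. \<phi> (\<gamma> s)) has_vector_derivative g (\<phi> (\<gamma> t))) (at t)"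
    if "integral_curve M X \<gamma>" "\<gamma> t \<in> U" "\<phi> (\<gamma> t) \<in> cball c0 R" for \<gamma> t
  proof -
    have "\<phi> (\<gamma> t) \<in> W" using that(3) R(2) by blast
    then show ?thesis using integral_curve_chart[OF M U that(1,2)] W(4)[of "\<phi> (\<gamma> t)"] that(2) by simp
  qed
  show ?thesis
  proof (rule that[of R K L g, folded c0_def, OF R(1) K(1) L(1) _ _ K(2) Lip D])
    show "cball c0 R \<inter> model M \<subseteq> \<phi> ` U" using R(2) V(2) by blast
    have "ball c0 R \<subseteq> W" using R(2) ball_subset_cball by blast
    then show "Ck_on k (ball c0 R) g" for k by (rule Ck_on_subset[OF W(3)])
  qed
qed

text \<open>At speed at most \<open>K\<close>, a curve starting within \<open>R / 2\<close> of the
  centre needs at least time \<open>R / (2 * K)\<close> to reach distance \<open>R\<close>.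
  Coordinates alone do not prevent it from leaving the chart domain; a compact set containing the
  curve before the first exit time excludes this.\<close>

lemma curve_stays_nonneg:
  fixes M :: "('a::{t2_space,second_countable_topology}, 'e::euclidean_space) mfd"
  assumes M: "smooth_manifold M" and U: "(U, \<phi>) \<in> atlas M"
    and g: "continuous_on UNIV \<gamma>" "range \<gamma> \<subseteq> points M"
    and R: "cball c0 R \<inter> model M \<subseteq> \<phi> ` U" and K: "K > 0"
    and g0: "\<gamma> 0 \<in> U" "norm (\<phi> (\<gamma> 0) - c0) < R / 2"
    and D: "\<And>s. \<gamma> s \<in> U \<Longrightarrow> \<phi> (\<gamma> s) \<in> cball c0 R \<Longrightarrow>
      ((\<lambda>s. \<phi> (\<gamma> s)) has_vector_derivative d s) (at s) \<and> norm (d s) \<le> K"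
    and t: "0 \<le> t" "t < R / (2 * K)"
  shows "\<gamma> t \<in> U \<and> \<phi> (\<gamma> t) \<in> ball c0 R"
proof (rule ccontr)
  assume neg: "\<not> (\<gamma> t \<in> U \<and> \<phi> (\<gamma> t) \<in> ball c0 R)"
  define N where "N = U \<inter> \<phi> -` ball c0 R"
  have N: "open_in M N" unfolding N_def by (rule chart_open_preimage[OF M U open_ball])
  have "openin (top_of_set UNIV) (UNIV \<inter> \<gamma> -` N)"
    by (rule continuous_openin_preimage[OF g(1) _ N]) (use g(2) in auto)
  then have opN: "open (\<gamma> -` N)" by simp
  \<comment> \<open>The bad times form a compact set; its minimum \<open>s0\<close> is the first
    exit time.\<close>
  define B where "B = {0..t} - \<gamma> -` N"
  have "compact B" unfolding B_def using opN by (intro compact_diff) auto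
  moreover have "t \<in> B" using neg t by (auto simp: B_def N_def)
  ultimately obtain s0 where s0: "s0 \<in> B" "\<And>s. s \<in> B \<Longrightarrow> s0 \<le> s"
    using compact_attains_inf[of B] by blast
  have R0: "R > 0" using g0(2) norm_ge_zero[of "\<phi> (\<gamma> 0) - c0"] by linarith
  have "\<gamma> 0 \<in> N" using g0 R0 by (auto simp: N_def dist_norm norm_minus_commute)
  then have "s0 \<noteq> 0" using s0(1) by (auto simp: B_def)
  then have s0': "0 < s0" "s0 \<le> t" "\<gamma> s0 \<notin> N" using s0(1) by (auto simp: B_def)
  have inN: "\<gamma> s \<in> N" if "0 \<le> s" "s < s0" for s
  proof (rule ccontr)
    assume "\<gamma> s \<notin> N"
    then have "s \<in> B" using that s0' by (auto simp: B_def)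
    then show False using s0(2)[of s] that by simp
  qed
  \<comment> \<open>Before \<open>s0\<close> the coordinates lie in this compact part of the chart
    image. Its image under the inverse chart is compact, hence closed by the Hausdorff property, and
    so contains \<open>\<gamma> s0\<close> as well.\<close>
  define D0 where "D0 = cball (\<phi> (\<gamma> 0)) (K * s0) \<inter> model M"
  have Ks0: "K * s0 < R / 2"
  proof -
    have "K * s0 \<le> K * t" using s0' K by (intro mult_left_mono) auto
    also have "\<dots> < K * (R / (2 * K))" using t K by (intro mult_strict_left_mono) auto
    also have "\<dots> = R / 2" using K by simp
    finally show ?thesis .
  qed
  have D0ball: "D0 \<subseteq> ball c0 R"
  proof
    fix c assume "c \<in> D0"
    then have "dist (\<phi> (\<gamma> 0)) c < R / 2" using Ks0 by (auto simp: D0_def)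
    moreover have "dist c0 (\<phi> (\<gamma> 0)) < R / 2" using g0(2) by (simp add: dist_norm norm_minus_commute)
    ultimately show "c \<in> ball c0 R" using dist_triangle[of c0 c "\<phi> (\<gamma> 0)"] by simp
  qed
  have D0U: "D0 \<subseteq> \<phi> ` U"
    using D0ball R ball_subset_cball[of c0 R] unfolding D0_def by blast
  have "closed (model M)" using M by (auto simp: smooth_manifold_def intro: closed_subspace)
  then have "compact D0" unfolding D0_def by (intro compact_Int_closed) auto
  then have "compact (inv_into U \<phi> ` D0)"
    by (intro compact_continuous_image continuous_on_subset[OF chart_inv_cont[OF M U] D0U])
  then have "closed (inv_into U \<phi> ` D0)" by (rule compact_imp_closed)
  then have clo: "closed (\<gamma> -` (inv_into U \<phi> ` D0))"
    using g(1) by (intro closed_vimage) (auto simp: continuous_on_eq_continuous_at)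
  have "\<gamma> s \<in> inv_into U \<phi> ` D0" if s: "s \<in> {0..<s0}" for s
  proof -
    have "norm (\<phi> (\<gamma> s) - \<phi> (\<gamma> 0)) \<le> K * norm (s - 0)"
    proof (rule differentiable_bound[where S="{0..s}" and f="\<lambda>s. \<phi> (\<gamma> s)" and f'="\<lambda>s h. h *\<^sub>R d s"])
      fix x assume x: "x \<in> {0..s}"
      then have "\<gamma> x \<in> N" using s inN by auto
      then have dx: "((\<lambda>s. \<phi> (\<gamma> s)) has_vector_derivative d x) (at x) \<and> norm (d x) \<le> K"
        by (intro D) (auto simp: N_def)
      show "((\<lambda>s. \<phi> (\<gamma> s)) has_derivative (\<lambda>h. h *\<^sub>R d x)) (at x within {0..s})"
        by (rule has_derivative_at_withinI) (use dx in \<open>simp add: has_vector_derivative_def\<close>)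
      show "onorm (\<lambda>h. h *\<^sub>R d x) \<le> K"
      proof (rule onorm_le)
        fix h :: real
        have "\<bar>h\<bar> * norm (d x) \<le> \<bar>h\<bar> * K" using dx by (intro mult_left_mono) auto
        then show "norm (h *\<^sub>R d x) \<le> K * norm h" by (simp add: mult.commute)
      qed
    qed (use s in auto)
    also have "\<dots> \<le> K * s0" using s K by (intro mult_left_mono) auto
    finally have "\<phi> (\<gamma> s) \<in> cball (\<phi> (\<gamma> 0)) (K * s0)" by (simp add: dist_norm norm_minus_commute)
    moreover have sU: "\<gamma> s \<in> U" using inN s by (auto simp: N_def)
    moreover have "\<phi> (\<gamma> s) \<in> model M" using sU openin_subset[OF chart_image_open[OF M U]] by auto
    ultimately have "\<phi> (\<gamma> s) \<in> D0" by (simp add: D0_def)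
    then have "inv_into U \<phi> (\<phi> (\<gamma> s)) \<in> inv_into U \<phi> ` D0" by (rule imageI)
    then show ?thesis by (simp add: chart_inv[OF M U sU])
  qed
  then have "{0..<s0} \<subseteq> \<gamma> -` (inv_into U \<phi> ` D0)" by auto
  then have "closure {0..<s0} \<subseteq> \<gamma> -` (inv_into U \<phi> ` D0)" using clo by (rule closure_minimal)
  moreover have "s0 \<in> closure {0..<s0}" using s0'(1) by simp
  ultimately have "\<gamma> s0 \<in> inv_into U \<phi> ` D0" by blast
  then obtain c where c: "c \<in> D0" "\<gamma> s0 = inv_into U \<phi> c" by auto
  have "c \<in> \<phi> ` U" using c(1) D0U by auto
  then have "\<gamma> s0 \<in> U" "\<phi> (\<gamma> s0) = c" unfolding c(2) by (auto simp: inv_into_into f_inv_into_f)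
  then show False using s0'(3) c(1) D0ball by (auto simp: N_def)
qed

lemma has_vector_derivative_reflect:
  assumes "(f has_vector_derivative d) (at (- s))"
  shows "((\<lambda>s. f (- s)) has_vector_derivative - d) (at s)"
proof -
  have "(uminus has_vector_derivative - 1) (at s)" by (auto intro!: derivative_eq_intros)
  from vector_diff_chain_at[OF this assms] show ?thesis by (simp add: o_def)
qed

lemma curve_stays:
  fixes M :: "('a::{t2_space,second_countable_topology}, 'e::euclidean_space) mfd"
  assumes M: "smooth_manifold M" and U: "(U, \<phi>) \<in> atlas M"
    and g: "continuous_on UNIV \<gamma>" "range \<gamma> \<subseteq> points M"
    and R: "cball c0 R \<inter> model M \<subseteq> \<phi> ` U" and K: "K > 0"
    and g0: "\<gamma> 0 \<in> U" "norm (\<phi> (\<gamma> 0) - c0) < R / 2"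
    and D: "\<And>s. \<gamma> s \<in> U \<Longrightarrow> \<phi> (\<gamma> s) \<in> cball c0 R \<Longrightarrow>
      ((\<lambda>s. \<phi> (\<gamma> s)) has_vector_derivative d s) (at s) \<and> norm (d s) \<le> K"
    and t: "\<bar>t\<bar> < R / (2 * K)"
  shows "\<gamma> t \<in> U \<and> \<phi> (\<gamma> t) \<in> ball c0 R"
proof (cases "0 \<le> t")
  case True
  then show ?thesis using curve_stays_nonneg[OF M U g R K g0 D, of t] t by auto
next
  case False
  have "\<gamma> (- (- t)) \<in> U \<and> \<phi> (\<gamma> (- (- t))) \<in> ball c0 R"
  proof (rule curve_stays_nonneg[where \<gamma>="\<lambda>s. \<gamma> (- s)" and d="\<lambda>s. - d (- s)" and t="- t", OF M U _ _ R K])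
    show "continuous_on UNIV (\<lambda>s. \<gamma> (- s))"
      by (rule continuous_on_compose2[OF g(1)]) (auto intro: continuous_intros)
    show "((\<lambda>s. \<phi> (\<gamma> (- s))) has_vector_derivative - d (- s)) (at s) \<and> norm (- d (- s)) \<le> K"
      if "\<gamma> (- s) \<in> U" "\<phi> (\<gamma> (- s)) \<in> cball c0 R" for s
      using D[OF that] has_vector_derivative_reflect[of "\<lambda>s. \<phi> (\<gamma> s)" "d (- s)" s] by simp
  qed (use g(2) g0 t False in auto)
  then show ?thesis by simp
qed

section \<open>Uniqueness of integral curves\<close>

lemma integral_curve_shift:
  assumes "integral_curve M X \<gamma>" shows "integral_curve M X (\<lambda>s. \<gamma> (s + t))"
  unfolding integral_curve_def
proof (intro conjI allI impI)
  show "range (\<lambda>s. \<gamma> (s + t)) \<subseteq> points M" using assms by (auto simp: integral_curve_def)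
  have "continuous_on UNIV \<gamma>" using assms by (simp add: integral_curve_def)
  then show "continuous_on UNIV (\<lambda>s. \<gamma> (s + t))"
    by (rule continuous_on_compose2) (auto intro: continuous_intros)
  fix s f assume "smooth_fun_near M (\<gamma> (s + t)) f"
  then have "((\<lambda>s. f (\<gamma> s)) has_real_derivative X (\<gamma> (s + t)) f) (at (s + t))"
    using assms unfolding integral_curve_def by blast
  then show "((\<lambda>s. f (\<gamma> (s + t))) has_real_derivative X (\<gamma> (s + t)) f) (at s)"
    by (simp add: DERIV_shift)
qed

text \<open>Both curves stay in one coordinate ball for a common time. Gronwall's inequality with
  zero initial difference and zero error forces their coordinates to agree.\<close>

lemma integral_curve_locally_unique:
  fixes M :: "('a::{t2_space,second_countable_topology}, 'e::euclidean_space) mfd"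
  assumes M: "smooth_manifold M" and X: "vector_field M X"
    and g: "integral_curve M X \<gamma>" and g2: "integral_curve M X \<gamma>'" and eq: "\<gamma> 0 = \<gamma>' 0"
  shows "\<exists>\<epsilon>>0. \<forall>t. \<bar>t\<bar> < \<epsilon> \<longrightarrow> \<gamma> t = \<gamma>' t"
proof -
  have "\<gamma> 0 \<in> points M" using g by (auto simp: integral_curve_def)
  then obtain U \<phi> where U: "(U, \<phi>) \<in> atlas M" "\<gamma> 0 \<in> U" by (rule pointsE)
  define c0 where "c0 = \<phi> (\<gamma> 0)"
  obtain R K L g where R: "R > 0" "K > 0" "L \<ge> 0" "cball c0 R \<inter> model M \<subseteq> \<phi> ` U"
    and gK: "\<And>c. c \<in> cball c0 R \<Longrightarrow> norm (g c) \<le> K"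
    and gL: "\<And>c c'. c \<in> cball c0 R \<Longrightarrow> c' \<in> cball c0 R \<Longrightarrow> norm (g c - g c') \<le> L * norm (c - c')"
    and D: "\<And>\<gamma> t. integral_curve M X \<gamma> \<Longrightarrow> \<gamma> t \<in> U \<Longrightarrow> \<phi> (\<gamma> t) \<in> cball c0 R \<Longrightarrow>
      ((\<lambda>s. \<phi> (\<gamma> s)) has_vector_derivative g (\<phi> (\<gamma> t))) (at t)"
    using local_chart_field[OF M X U] unfolding c0_def by metis
  have stay: "\<beta> t \<in> U \<and> \<phi> (\<beta> t) \<in> ball c0 R"
    if "integral_curve M X \<beta>" "\<beta> 0 = \<gamma> 0" "\<bar>t\<bar> < R / (2 * K)" for \<beta> t
  proof (rule curve_stays[where d="\<lambda>s. g (\<phi> (\<beta> s))", OF M U(1) _ _ R(4,2) _ _ _ that(3)])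
    show "continuous_on UNIV \<beta>" "range \<beta> \<subseteq> points M" using that(1) by (auto simp: integral_curve_def)
    show "((\<lambda>s. \<phi> (\<beta> s)) has_vector_derivative g (\<phi> (\<beta> s))) (at s) \<and> norm (g (\<phi> (\<beta> s))) \<le> K"
      if "\<beta> s \<in> U" "\<phi> (\<beta> s) \<in> cball c0 R" for s
      using D[OF \<open>integral_curve M X \<beta>\<close> that] gK that by auto
  qed (use U that R(1) in \<open>auto simp: c0_def\<close>)
  have "\<gamma> t = \<gamma>' t" if t: "\<bar>t\<bar> < R / (2 * K)" for t
  proof -
    have seg: "\<bar>s\<bar> < R / (2 * K)" if "s \<in> closed_segment 0 t" for s
      using that t by (auto simp: closed_segment_eq_real_ivl split: if_splits)
    have "(norm (\<phi> (\<gamma> t) - \<phi> (\<gamma>' t)))\<^sup>2 \<le> exp ((2 * L + 1) * \<bar>t\<bar>) *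
        ((norm (\<phi> (\<gamma> 0) - \<phi> (\<gamma>' 0)))\<^sup>2 + 0\<^sup>2 * \<bar>t\<bar>)"
    proof (rule gronwall[where u="\<lambda>s. \<phi> (\<gamma> s) - \<phi> (\<gamma>' s)" and u'="\<lambda>s. g (\<phi> (\<gamma> s)) - g (\<phi> (\<gamma>' s))"])
      fix s assume s: "s \<in> closed_segment 0 t"
      note st = stay[OF g refl seg[OF s]] stay[OF g2 eq[symmetric] seg[OF s]]
      show "((\<lambda>s. \<phi> (\<gamma> s) - \<phi> (\<gamma>' s)) has_vector_derivative g (\<phi> (\<gamma> s)) - g (\<phi> (\<gamma>' s))) (at s)"
        using st by (intro has_vector_derivative_diff D assms) auto
      show "norm (g (\<phi> (\<gamma> s)) - g (\<phi> (\<gamma>' s))) \<le> L * norm (\<phi> (\<gamma> s) - \<phi> (\<gamma>' s)) + 0"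
        using st gL[of "\<phi> (\<gamma> s)" "\<phi> (\<gamma>' s)"] by auto
    qed (use R in auto)
    then have "\<phi> (\<gamma> t) = \<phi> (\<gamma>' t)" by (simp add: eq)
    then show ?thesis
      using stay[OF g refl t] stay[OF g2 eq[symmetric] t] chart_inj[OF M U(1)] by (auto dest: inj_onD)
  qed
  then show ?thesis using R by (intro exI[of _ "R / (2 * K)"]) auto
qed

text \<open>The set of times of agreement is closed by the Hausdorff property, and open by local
  uniqueness of the shifted curves; the line is connected.\<close>

lemma integral_curve_unique:
  fixes M :: "('a::{t2_space,second_countable_topology}, 'e::euclidean_space) mfd"
  assumes M: "smooth_manifold M" and X: "vector_field M X"
    and g: "integral_curve M X \<gamma>" and g2: "integral_curve M X \<gamma>'" and eq: "\<gamma> 0 = \<gamma>' 0"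
  shows "\<gamma> t = \<gamma>' t"
proof -
  define E where "E = {t. \<gamma> t = \<gamma>' t}"
  have "closed E"
    unfolding E_def using g g2 by (intro closed_Collect_eq) (auto simp: integral_curve_def)
  moreover have "open E"
    unfolding open_dist
  proof
    fix t assume "t \<in> E"
    then obtain \<epsilon> where \<epsilon>: "\<epsilon> > 0" "\<And>s. \<bar>s\<bar> < \<epsilon> \<Longrightarrow> \<gamma> (s + t) = \<gamma>' (s + t)"
      using integral_curve_locally_unique[OF M X integral_curve_shift[OF g, of t] integral_curve_shift[OF g2, of t]]
      by (auto simp: E_def)
    have "y \<in> E" if "dist y t < \<epsilon>" for y
      using \<epsilon>(2)[of "y - t"] that by (simp add: E_def dist_real_def)
    then show "\<exists>e>0. \<forall>y. dist y t < e \<longrightarrow> y \<in> E" using \<epsilon>(1) by blast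
  qed
  ultimately have "E = UNIV" using clopen[of E] eq by (auto simp: E_def)
  then show ?thesis by (auto simp: E_def)
qed

section \<open>The flow as a smooth one-parameter group\<close>

locale complete_vector_field =
  fixes M :: "('a::{t2_space,second_countable_topology}, 'e::euclidean_space) mfd" and X :: "'a \<Rightarrow> 'a tvec"
  assumes M: "smooth_manifold M" and X: "vector_field M X" and complete: "complete_field M X"
begin

abbreviation "fl \<equiv> flow M X"

text \<open>Uniqueness turns the definite description in \<open>flow\<close> into a computation
  rule: an identity such as \<open>flow_add\<close> or \<open>flow_homothety\<close> is proved by
  exhibiting an integral curve with the right initial value.\<close>

lemma flow_unique:
  assumes "integral_curve M X \<gamma>" shows "fl t (\<gamma> 0) = \<gamma> t"
  unfolding flow_def
proof (rule the_equality)
  show "\<exists>\<gamma>'. integral_curve M X \<gamma>' \<and> \<gamma>' 0 = \<gamma> 0 \<and> \<gamma>' t = \<gamma> t" using assms by blast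
  show "q = \<gamma> t" if "\<exists>\<gamma>'. integral_curve M X \<gamma>' \<and> \<gamma>' 0 = \<gamma> 0 \<and> \<gamma>' t = q" for q
    using that integral_curve_unique[OF M X _ assms] by metis
qed

lemma
  assumes "p \<in> points M"
  shows flow_integral_curve: "integral_curve M X (\<lambda>t. fl t p)"
    and flow_0: "fl 0 p = p"
    and flow_in_points: "fl t p \<in> points M"
proof -
  obtain \<gamma> where \<gamma>: "integral_curve M X \<gamma>" "\<gamma> 0 = p"
    using complete assms unfolding complete_field_def by blast
  have eq: "fl t p = \<gamma> t" for t using flow_unique[OF \<gamma>(1), of t] \<gamma>(2) by simp
  show "integral_curve M X (\<lambda>t. fl t p)" "fl 0 p = p" using \<gamma> by (simp_all add: eq)
  show "fl t p \<in> points M" unfolding eq using \<gamma>(1) by (auto simp: integral_curve_def)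
qed

lemma flow_add: "p \<in> points M \<Longrightarrow> fl (s + t) p = fl s (fl t p)"
  using flow_unique[OF integral_curve_shift[OF flow_integral_curve[of p], of t], of s] by simp

text \<open>Chart coordinates are extended from the model space to the ambient Euclidean space by a linear
  projection \<open>\<pi>\<close>, so that the initial values range over an open set.\<close>

lemma flow_smooth_near:
  assumes p0: "p0 \<in> points M"
  obtains \<epsilon> N where "\<epsilon> > 0" "open_in M N" "p0 \<in> N"
    "\<And>t q. \<bar>t\<bar> < \<epsilon> \<Longrightarrow> q \<in> N \<Longrightarrow> smooth_at (prod_mfd eucl M) M (\<lambda>z. fl (fst z) (snd z)) (t, q)"
proof -
  obtain U \<phi> where U: "(U, \<phi>) \<in> atlas M" "p0 \<in> U" using p0 by (rule pointsE)
  define c0 where "c0 = \<phi> p0"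
  have model: "\<phi> ` U \<subseteq> model M" using openin_subset[OF chart_image_open[OF M U(1)]] by simp
  obtain R K L g where R: "R > 0" "K > 0" "L \<ge> 0" "cball c0 R \<inter> model M \<subseteq> \<phi> ` U"
    and gCk: "\<And>k. Ck_on k (ball c0 R) g"
    and gK: "\<And>c. c \<in> cball c0 R \<Longrightarrow> norm (g c) \<le> K"
    and gL: "\<And>c c'. c \<in> cball c0 R \<Longrightarrow> c' \<in> cball c0 R \<Longrightarrow> norm (g c - g c') \<le> L * norm (c - c')"
    and D: "\<And>\<gamma> t. integral_curve M X \<gamma> \<Longrightarrow> \<gamma> t \<in> U \<Longrightarrow> \<phi> (\<gamma> t) \<in> cball c0 R \<Longrightarrow>
      ((\<lambda>s. \<phi> (\<gamma> s)) has_vector_derivative g (\<phi> (\<gamma> t))) (at t)"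
    using local_chart_field[OF M X U] unfolding c0_def by metis
  have "subspace (model M)" using M by (simp add: smooth_manifold_def)
  then obtain \<pi> where \<pi>: "range \<pi> \<subseteq> model M" "linear \<pi>" "\<And>v. v \<in> model M \<Longrightarrow> \<pi> v = v"
    using linear_exists_left_inverse_on[of "\<lambda>v. v" "model M"] by (auto simp: linear_id[unfolded id_def])
  obtain B where B: "B > 0" "\<And>v. norm (\<pi> v) \<le> B * norm v"
    using linear_bounded_pos[OF \<pi>(2)] by metis
  have \<pi>c0: "\<pi> c0 = c0" using \<pi>(3) model U(2) by (auto simp: c0_def)
  have \<pi>diff: "norm (\<pi> x - \<pi> x') \<le> B * norm (x - x')" for x x'
    using B(2)[of "x - x'"] linear_diff[OF \<pi>(2)] by simp
  \<comment> \<open>Division by \<open>2 * B\<close> compensates for the stretching by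
    \<open>\<pi>\<close>: points of \<open>P\<close> project to within \<open>R / 2\<close> of
    \<open>c0\<close>, as \<open>curve_stays\<close> requires.\<close>
  define P where "P = ball c0 (R / (2 * B))"
  define \<epsilon> where "\<epsilon> = R / (2 * K)"
  have \<epsilon>: "\<epsilon> > 0" using R by (simp add: \<epsilon>_def)
  have \<pi>P: "norm (\<pi> x - c0) < R / 2" if "x \<in> P" for x
  proof -
    have "norm (x - c0) < R / (2 * B)" using that by (simp add: P_def dist_norm norm_minus_commute)
    then have "B * norm (x - c0) < B * (R / (2 * B))" using B(1) by (intro mult_strict_left_mono)
    also have "\<dots> = R / 2" using B(1) by simp
    finally show ?thesis using \<pi>diff[of x c0] \<pi>c0 by simp
  qed
  have \<pi>U: "\<pi> x \<in> \<phi> ` U" if "x \<in> P" for x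
  proof -
    have "\<pi> x \<in> cball c0 R" using \<pi>P[OF that] R(1) by (simp add: dist_norm norm_minus_commute)
    then show ?thesis using R(4) \<pi>(1) by blast
  qed
  define q where "q x = inv_into U \<phi> (\<pi> x)" for x
  have q: "q x \<in> U" "\<phi> (q x) = \<pi> x" "q x \<in> points M" if "x \<in> P" for x
    using \<pi>U[OF that] chart_subset[OF M U(1)] by (auto simp: q_def inv_into_into f_inv_into_f)
  define y where "y z = \<phi> (fl (fst z) (q (snd z)))" for z
  have stay: "fl t (q x) \<in> U \<and> \<phi> (fl t (q x)) \<in> ball c0 R" if "\<bar>t\<bar> < \<epsilon>" "x \<in> P" for t x
  proof (rule curve_stays[where \<gamma>="\<lambda>s. fl s (q x)" and d="\<lambda>s. g (\<phi> (fl s (q x)))", OF M U(1) _ _ R(4,2)])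
    note ic = flow_integral_curve[OF q(3)[OF that(2)]]
    show "continuous_on UNIV (\<lambda>s. fl s (q x))" "range (\<lambda>s. fl s (q x)) \<subseteq> points M"
      using ic by (auto simp: integral_curve_def)
    show "fl 0 (q x) \<in> U" "norm (\<phi> (fl 0 (q x)) - c0) < R / 2"
      using q[OF that(2)] \<pi>P[OF that(2)] by (simp_all add: flow_0)
    show "((\<lambda>s. \<phi> (fl s (q x))) has_vector_derivative g (\<phi> (fl s (q x)))) (at s) \<and>
        norm (g (\<phi> (fl s (q x)))) \<le> K"
      if "fl s (q x) \<in> U" "\<phi> (fl s (q x)) \<in> cball c0 R" for s
      using D[OF ic that] gK[OF that(2)] by simp
    show "\<bar>t\<bar> < R / (2 * K)" using that by (simp add: \<epsilon>_def)
  qed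
  have ode: "((\<lambda>s. y (s, x)) has_vector_derivative g (y (t, x))) (at t)" if "\<bar>t\<bar> < \<epsilon>" "x \<in> P" for t x
    unfolding y_def fst_conv snd_conv
    using stay[OF that] by (intro D[OF flow_integral_curve[OF q(3)[OF that(2)]]]) auto
  have seg: "\<bar>r\<bar> < \<epsilon>" if "r \<in> closed_segment s t" "\<bar>s\<bar> < \<epsilon>" "\<bar>t\<bar> < \<epsilon>" for r s t :: real
    using that by (auto simp: closed_segment_eq_real_ivl split: if_splits)
  have lip_t: "norm (y (t, x) - y (s, x)) \<le> K * norm (t - s)"
    if "\<bar>t\<bar> < \<epsilon>" "\<bar>s\<bar> < \<epsilon>" "x \<in> P" for t s x
  proof (rule differentiable_bound[where S="closed_segment s t" and f="\<lambda>s. y (s, x)"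
        and f'="\<lambda>r h. h *\<^sub>R g (y (r, x))"])
    fix r assume r: "r \<in> closed_segment s t"
    have rs: "\<bar>r\<bar> < \<epsilon>" using seg[OF r] that by auto
    show "((\<lambda>s. y (s, x)) has_derivative (\<lambda>h. h *\<^sub>R g (y (r, x)))) (at r within closed_segment s t)"
      by (rule has_derivative_at_withinI) (use ode[OF rs that(3)] in \<open>simp add: has_vector_derivative_def\<close>)
    show "onorm (\<lambda>h. h *\<^sub>R g (y (r, x))) \<le> K"
    proof (rule onorm_le)
      fix h :: real
      have "norm (g (y (r, x))) \<le> K" using stay[OF rs that(3)] by (intro gK) (auto simp: y_def)
      then have "\<bar>h\<bar> * norm (g (y (r, x))) \<le> \<bar>h\<bar> * K" by (intro mult_left_mono) auto
      then show "norm (h *\<^sub>R g (y (r, x))) \<le> K * norm h" by (simp add: mult.commute)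
    qed
  qed auto
  define E where "E = exp ((2 * L + 1) * \<epsilon>)"
  have lip_x: "norm (y (t, x) - y (t, x')) \<le> sqrt E * B * norm (x - x')"
    if "\<bar>t\<bar> < \<epsilon>" "x \<in> P" "x' \<in> P" for t x x'
  proof -
    have "(norm (y (t, x) - y (t, x')))\<^sup>2 \<le> exp ((2 * L + 1) * \<bar>t\<bar>) *
        ((norm (y (0, x) - y (0, x')))\<^sup>2 + 0\<^sup>2 * \<bar>t\<bar>)"
    proof (rule gronwall[where u="\<lambda>s. y (s, x) - y (s, x')" and u'="\<lambda>s. g (y (s, x)) - g (y (s, x'))"])
      fix s assume "s \<in> closed_segment 0 t"
      then have s: "\<bar>s\<bar> < \<epsilon>" using seg[of s 0 t] that(1) \<epsilon> by auto
      show "((\<lambda>s. y (s, x) - y (s, x')) has_vector_derivative g (y (s, x)) - g (y (s, x'))) (at s)"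
        by (intro has_vector_derivative_diff ode s that)
      show "norm (g (y (s, x)) - g (y (s, x'))) \<le> L * norm (y (s, x) - y (s, x')) + 0"
        using stay[OF s that(2)] stay[OF s that(3)] gL[of "y (s, x)" "y (s, x')"] by (simp add: y_def)
    qed (use R in auto)
    also have "\<dots> = exp ((2 * L + 1) * \<bar>t\<bar>) * (norm (\<pi> x - \<pi> x'))\<^sup>2"
      using q that by (simp add: y_def flow_0)
    also have "\<dots> \<le> E * (norm (\<pi> x - \<pi> x'))\<^sup>2"
      unfolding E_def using R(3) that(1) by (intro mult_right_mono) auto
    finally have "norm (y (t, x) - y (t, x')) \<le> sqrt (E * (norm (\<pi> x - \<pi> x'))\<^sup>2)" by (rule real_le_rsqrt)
    also have "\<dots> = sqrt E * norm (\<pi> x - \<pi> x')" by (simp add: real_sqrt_mult)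
    also have "\<dots> \<le> sqrt E * (B * norm (x - x'))"
      by (intro mult_left_mono \<pi>diff) (simp add: E_def)
    finally show ?thesis by (simp add: mult.assoc)
  qed
  \<comment> \<open>Joint continuity is a hypothesis of \<open>Ck_on_param_ode\<close>. It follows
    from Lipschitz estimates, in time by the speed bound and in the initial value by Gronwall's
    inequality.\<close>
  have cont: "continuous_on ({-\<epsilon><..<\<epsilon>} \<times> P) y"
  proof (rule lipschitz_on_continuous_on[where L="K + sqrt E * B"], rule lipschitz_onI)
    show "0 \<le> K + sqrt E * B" using R(2) B(1) by (simp add: E_def)
    fix z z' assume z: "z \<in> {-\<epsilon><..<\<epsilon>} \<times> P" "z' \<in> {-\<epsilon><..<\<epsilon>} \<times> P"
    obtain t x t' x' where tx: "z = (t, x)" "z' = (t', x')" by (cases z, cases z')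
    have 1: "\<bar>t\<bar> < \<epsilon>" "\<bar>t'\<bar> < \<epsilon>" "x \<in> P" "x' \<in> P" using z tx by auto
    have "norm (y (t, x) - y (t', x')) \<le> norm (y (t, x) - y (t', x)) + norm (y (t', x) - y (t', x'))"
      using norm_triangle_ineq[of "y (t, x) - y (t', x)" "y (t', x) - y (t', x')"] by simp
    also have "\<dots> \<le> K * norm (t - t') + sqrt E * B * norm (x - x')"
      using lip_t[OF 1(1,2,3)] lip_x[OF 1(2,3,4)] by linarith
    also have "\<dots> \<le> K * dist z z' + sqrt E * B * dist z z'"
      using dist_fst_le[of z z'] dist_snd_le[of z z'] R(2) B(1)
      by (intro add_mono mult_left_mono) (auto simp: tx dist_norm E_def)
    finally show "dist (y z) (y z') \<le> (K + sqrt E * B) * dist z z'"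
      by (simp add: tx dist_norm algebra_simps)
  qed
  \<comment> \<open>The equation is autonomous; the parameter enters only through the initial value
    \<open>\<pi> x\<close>, which is linear in \<open>x\<close>.\<close>
  have "Ck_on k ({-\<epsilon><..<\<epsilon>} \<times> P) y" for k
  proof (rule Ck_on_param_ode[where F="\<lambda>z. g (snd (snd z))" and W="UNIV \<times> UNIV \<times> ball c0 R"])
    show "Ck_on k (UNIV \<times> UNIV \<times> ball c0 R) (\<lambda>z :: real \<times> 'e \<times> 'e. g (snd (snd z)))"
      by (rule Ck_on_compose[OF Ck_on_linear[OF bounded_linear_compose[OF bounded_linear_snd bounded_linear_snd]]
            gCk]) (auto intro!: open_Times)
    show "Ck_on k P (\<lambda>x. y (0, x))"
      by (rule Ck_on_cong[OF Ck_on_linear[of \<pi>]])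
        (use \<pi>(2) q in \<open>auto simp: y_def flow_0 P_def linear_conv_bounded_linear\<close>)
    show "(t, x, y (t, x)) \<in> UNIV \<times> UNIV \<times> ball c0 R" if "t \<in> {-\<epsilon><..<\<epsilon>}" "x \<in> P" for t x
    proof -
      have "\<bar>t\<bar> < \<epsilon>" using that by auto
      then show ?thesis using stay[of t x] that by (simp add: y_def)
    qed
    show "((\<lambda>s. y (s, x)) has_vector_derivative g (snd (snd (t, x, y (t, x))))) (at t)"
      if "t \<in> {-\<epsilon><..<\<epsilon>}" "x \<in> P" for t x
    proof -
      have "\<bar>t\<bar> < \<epsilon>" using that by auto
      then show ?thesis using ode[of t x] that by simp
    qed
  qed (use \<epsilon> cont in \<open>auto simp: P_def intro!: open_Times\<close>)
  then have ysm: "smooth_on ({-\<epsilon><..<\<epsilon>} \<times> P) y"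
    by (intro smooth_onI[where W="{-\<epsilon><..<\<epsilon>} \<times> P"]) (auto simp: P_def intro!: open_Times)
  define N where "N = U \<inter> \<phi> -` P"
  have N: "open_in M N" unfolding N_def P_def by (rule chart_open_preimage[OF M U(1) open_ball])
  \<comment> \<open>The projection fixes the coordinates of actual points, so on \<open>N\<close>
    the extended \<open>y\<close> is the coordinate expression of the flow.\<close>
  have qN: "q (\<phi> r) = r" if "r \<in> N" for r
    using that model \<pi>(3) chart_inv[OF M U(1)] by (auto simp: N_def q_def)
  have E1: "(UNIV, \<lambda>x. x) \<in> atlas (eucl :: (real, real) mfd)" by (rule atlas_eucl_mfd)
  show ?thesis
  proof (rule that[OF \<epsilon> N])
    show "p0 \<in> N" using U(2) R(1) B(1) by (simp add: N_def P_def c0_def)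
    fix t r assume t: "\<bar>t\<bar> < \<epsilon>" and r: "r \<in> N"
    show "smooth_at (prod_mfd eucl M) M (\<lambda>z. fl (fst z) (snd z)) (t, r)"
    proof (rule smooth_atI_local[OF atlas_prod_mfd[OF E1 U(1)] U(1), of "{-\<epsilon><..<\<epsilon>} \<times> N"])
      show "open_in (prod_mfd eucl M) ({-\<epsilon><..<\<epsilon>} \<times> N)"
        unfolding points_prod_mfd points_eucl_mfd by (rule openin_Times[OF _ N]) simp
      show "(\<lambda>z. fl (fst z) (snd z)) ` ({-\<epsilon><..<\<epsilon>} \<times> N) \<subseteq> U"
      proof clarsimp
        fix s r' assume s: "- \<epsilon> < s" "s < \<epsilon>" and r': "r' \<in> N"
        then show "fl s r' \<in> U" using stay[of s "\<phi> r'"] qN[OF r'] by (simp add: N_def)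
      qed
      show "smooth_on (map_prod (\<lambda>x. x) \<phi> ` ({-\<epsilon><..<\<epsilon>} \<times> N))
          (\<lambda>z. \<phi> (fl (fst (inv_into (UNIV \<times> U) (map_prod (\<lambda>x. x) \<phi>) z)) (snd (inv_into (UNIV \<times> U) (map_prod (\<lambda>x. x) \<phi>) z))))"
      proof (rule smooth_on_subset_cong[OF ysm])
        show "map_prod (\<lambda>x. x) \<phi> ` ({-\<epsilon><..<\<epsilon>} \<times> N) \<subseteq> {-\<epsilon><..<\<epsilon>} \<times> P" by (auto simp: N_def)
        fix z assume "z \<in> map_prod (\<lambda>x. x) \<phi> ` ({-\<epsilon><..<\<epsilon>} \<times> N)"
        then obtain s r' where z: "z = (s, \<phi> r')" "r' \<in> N" by auto
        have "inv_into (UNIV \<times> U) (map_prod (\<lambda>x. x) \<phi>) (s, \<phi> r') = (s, r')"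
          by (rule inv_into_map_prod[OF _ chart_inj[OF M U(1)]]) (use z(2) in \<open>auto simp: N_def\<close>)
        then show "y z = \<phi> (fl (fst (inv_into (UNIV \<times> U) (map_prod (\<lambda>x. x) \<phi>) z))
            (snd (inv_into (UNIV \<times> U) (map_prod (\<lambda>x. x) \<phi>) z)))"
          by (simp add: z(1) y_def qN[OF z(2)])
      qed
    qed (use t r in \<open>auto simp: N_def\<close>)
  qed
qed

text \<open>For fixed \<open>p\<close> the set of good times is open, and it is closed by the group
  property: near a limit time \<open>s\<close> the flow factors into \<open>fl s'\<close> followed
  by \<open>fl (t - s')\<close>, with \<open>s'\<close> a good time close to \<open>s\<close>. The
  outer factor is covered by the local result around \<open>fl s p\<close>.\<close>

theorem flow_smooth:
  assumes p: "p \<in> points M"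
  shows "smooth_at (prod_mfd eucl M) M (\<lambda>z. fl (fst z) (snd z)) (t, p)"
proof -
  have eu: "smooth_manifold (eucl :: (real, real) mfd)" by (rule smooth_manifold_eucl)
  have PM: "smooth_manifold (prod_mfd (eucl :: (real, real) mfd) M)"
    by (rule smooth_manifold_prod_mfd[OF eu M])
  define Fl where "Fl z = fl (fst z) (snd z)" for z
  define A where "A = {t. smooth_at (prod_mfd eucl M) M Fl (t, p)}"
  have "open A"
    unfolding open_contains_ball
  proof
    fix t assume "t \<in> A"
    then have "smooth_at (prod_mfd eucl M) M Fl (t, p)" by (simp add: A_def)
    then obtain S where S: "open_in (prod_mfd eucl M) S" "(t, p) \<in> S"
      "\<And>q. q \<in> S \<Longrightarrow> smooth_at (prod_mfd eucl M) M Fl q"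
      using smooth_atD[OF PM M] by metis
    obtain W where W: "open W" "S = (UNIV \<times> points M) \<inter> W"
      using S(1) unfolding points_prod_mfd points_eucl_mfd by (auto simp: openin_open)
    have "open ((\<lambda>s. (s, p)) -` W)"
      using W(1) by (intro open_vimage) (auto intro: continuous_intros)
    moreover have "t \<in> (\<lambda>s. (s, p)) -` W" using S(2) W(2) by auto
    ultimately obtain e where "e > 0" "ball t e \<subseteq> (\<lambda>s. (s, p)) -` W" by (meson openE)
    then show "\<exists>e>0. ball t e \<subseteq> A"
      using S(3) W(2) p by (intro exI[of _ e]) (auto simp: A_def subset_eq)
  qed
  moreover have "closed A"
    unfolding closed_sequential_limits
  proof (intro allI impI, elim conjE)
    fix u s assume uA: "\<forall>n. u n \<in> A" and lim: "u \<longlonglongrightarrow> s"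
    \<comment> \<open>The local result is applied at the limit point, so the time radius
      \<open>\<epsilon>\<close> is fixed before the good time \<open>u n\<close> is chosen within
      it.\<close>
    obtain \<epsilon> N where \<epsilon>: "\<epsilon> > 0" and N: "open_in M N" "fl s p \<in> N"
      "\<And>t q. \<bar>t\<bar> < \<epsilon> \<Longrightarrow> q \<in> N \<Longrightarrow> smooth_at (prod_mfd eucl M) M (\<lambda>z. fl (fst z) (snd z)) (t, q)"
      using flow_smooth_near[OF flow_in_points[OF p], of s] by metis
    have cont: "continuous_on UNIV (\<lambda>t. fl t p)"
      using flow_integral_curve[OF p] by (simp add: integral_curve_def)
    have "openin (top_of_set UNIV) (UNIV \<inter> (\<lambda>t. fl t p) -` N)"
      by (rule continuous_openin_preimage[OF cont _ N(1)]) (use flow_in_points[OF p] in auto)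
    then have "open ((\<lambda>t. fl t p) -` N)" by simp
    then have "\<forall>\<^sub>F n in sequentially. u n \<in> (\<lambda>t. fl t p) -` N"
      by (rule topological_tendstoD[OF lim]) (use N(2) in simp)
    moreover have "\<forall>\<^sub>F n in sequentially. dist (u n) s < \<epsilon>" by (rule tendstoD[OF lim \<epsilon>])
    ultimately have "\<forall>\<^sub>F n in sequentially. u n \<in> (\<lambda>t. fl t p) -` N \<and> dist (u n) s < \<epsilon>"
      by (rule eventually_conj)
    then obtain n where n: "fl (u n) p \<in> N" "dist (u n) s < \<epsilon>"
      using eventually_happens'[OF sequentially_bot] by auto
    define s' where "s' = u n"
    have s': "smooth_at (prod_mfd eucl M) M Fl (s', p)" using uA by (simp add: A_def s'_def)
    have sp: "(s, p) \<in> points (prod_mfd eucl M)" using p by (simp add: points_prod_mfd points_eucl_mfd)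
    have f1: "smooth_at (prod_mfd eucl M) eucl fst (s, p)"
      and f2: "smooth_at (prod_mfd eucl M) M snd (s, p)"
      using smooth_at_fst[OF eu M] smooth_at_snd[OF eu M] p by (auto simp: points_eucl_mfd)
    have f3: "smooth_at (prod_mfd eucl M) eucl (\<lambda>z. fst z - s') (s, p)"
    proof (rule smooth_at_eucl_compose[OF PM f1, where g="\<lambda>r. r - s'" and W=UNIV])
      show "smooth_on UNIV (\<lambda>r::real. r - s')"
        using smooth_on_add[OF smooth_on_id smooth_on_const[of UNIV "- s'"]] by simp
    qed auto
    have "smooth_at (prod_mfd eucl M) (prod_mfd eucl M) (\<lambda>z. (s', snd z)) (s, p)"
      by (intro smooth_at_Pair[OF eu M PM] f2 smooth_at_const[OF PM eu sp]) (simp add: points_eucl_mfd)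
    then have "smooth_at (prod_mfd eucl M) M (\<lambda>z. Fl (s', snd z)) (s, p)"
      by (rule smooth_at_compose[OF PM PM M]) (simp add: s')
    then have "smooth_at (prod_mfd eucl M) (prod_mfd eucl M) (\<lambda>z. (fst z - s', Fl (s', snd z))) (s, p)"
      by (rule smooth_at_Pair[OF eu M PM f3])
    then have "smooth_at (prod_mfd eucl M) M (\<lambda>z. Fl (fst z - s', Fl (s', snd z))) (s, p)"
    proof (rule smooth_at_compose[OF PM PM M])
      show "smooth_at (prod_mfd eucl M) M Fl (fst (s, p) - s', Fl (s', snd (s, p)))"
        using N(3)[of "s - s'" "fl s' p"] n by (simp add: s'_def Fl_def[abs_def] dist_real_def abs_minus_commute)
    qed
    then have "smooth_at (prod_mfd eucl M) M Fl (s, p)"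
    proof (rule smooth_at_cong[OF PM, where T="points (prod_mfd eucl M)"])
      fix z assume "z \<in> points (prod_mfd (eucl :: (real, real) mfd) M)"
      then have "snd z \<in> points M" by (auto simp: points_prod_mfd)
      then show "Fl (fst z - s', Fl (s', snd z)) = Fl z"
        using flow_add[of "snd z" "fst z - s'" s'] by (simp add: Fl_def)
    qed (use sp in auto)
    then show "s \<in> A" by (simp add: A_def)
  qed
  moreover have "0 \<in> A"
    using flow_smooth_near[OF p] unfolding A_def Fl_def[abs_def] by (metis abs_zero mem_Collect_eq)
  ultimately have "A = UNIV" using clopen[of A] by blast
  then show ?thesis by (auto simp: A_def Fl_def[abs_def])
qed

end

section \<open>Homotheties of a graded bundle\<close>

lemma subspace_graded_space: "subspace (graded_space w)"
  by (auto simp: subspace_def graded_space_def)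

lemma smooth_manifold_graded_mfd: "smooth_manifold (graded_mfd w)"
  by (rule smooth_manifold_eucl_mfd[OF subspace_graded_space]) simp

lemma dilation_in_graded_space: "y \<in> graded_space w \<Longrightarrow> dilation w t y \<in> graded_space w"
  by (simp add: graded_space_def dilation_def)

lemma dilation_dilation: "dilation w s (dilation w t y) = dilation w (s * t) y"
  by (simp add: dilation_def vec_eq_iff power_mult_distrib)

lemma dilation_1: "dilation w 1 y = y"
  by (simp add: dilation_def vec_eq_iff)

text \<open>A monomial with exponents \<open>\<mu>\<close> picks up \<open>t\<close> to the power of
  the sum of all \<open>\<mu> \<beta> * w \<beta>\<close>, which is the weight of the component.
  Indices of weight zero carry the coordinate 0 on both sides.\<close>

lemma graded_map_dilation:
  assumes g: "graded_map w g" and y: "y \<in> graded_space w"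
  shows "g (dilation w t y) = dilation w t (g y)"
proof -
  have gy: "g y \<in> graded_space w" "g (dilation w t y) \<in> graded_space w"
    using g y dilation_in_graded_space[OF y] by (auto simp: graded_map_def)
  have "g (dilation w t y) $ \<alpha> = dilation w t (g y) $ \<alpha>" for \<alpha>
  proof (cases "w \<alpha> = 0")
    case True
    then show ?thesis using gy by (simp add: graded_space_def dilation_def)
  next
    case False
    then obtain c where c: "\<And>y. y \<in> graded_space w \<Longrightarrow>
        g y $ \<alpha> = (\<Sum>\<mu>\<in>exponents w (w \<alpha>). c \<mu> * (\<Prod>\<beta>\<in>UNIV. (y $ \<beta>) ^ \<mu> \<beta>))"
      using g unfolding graded_map_def poly_of_weight_def by (metis gr0I)
    have "(\<Prod>\<beta>\<in>UNIV. (dilation w t y $ \<beta>) ^ \<mu> \<beta>) = t ^ w \<alpha> * (\<Prod>\<beta>\<in>UNIV. (y $ \<beta>) ^ \<mu> \<beta>)"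
      if "\<mu> \<in> exponents w (w \<alpha>)" for \<mu>
    proof -
      have "(\<Prod>\<beta>\<in>UNIV. (dilation w t y $ \<beta>) ^ \<mu> \<beta>) = (\<Prod>\<beta>\<in>UNIV. t ^ (\<mu> \<beta> * w \<beta>) * (y $ \<beta>) ^ \<mu> \<beta>)"
        by (intro prod.cong refl) (simp add: dilation_def power_mult_distrib mult.commute flip: power_mult)
      also have "\<dots> = t ^ (\<Sum>\<beta>\<in>UNIV. \<mu> \<beta> * w \<beta>) * (\<Prod>\<beta>\<in>UNIV. (y $ \<beta>) ^ \<mu> \<beta>)"
        by (simp add: prod.distrib power_sum)
      finally show ?thesis using that by (simp add: exponents_def)
    qed
    then have "g (dilation w t y) $ \<alpha> = t ^ w \<alpha> * g y $ \<alpha>"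
      unfolding c[OF y] c[OF dilation_in_graded_space[OF y]] sum_distrib_left
      by (intro sum.cong refl) simp
    then show ?thesis by (simp add: dilation_def)
  qed
  then show ?thesis by (simp add: vec_eq_iff)
qed

lemma smooth_at_dilation:
  assumes "y \<in> graded_space w"
  shows "smooth_at (prod_mfd eucl (graded_mfd w)) (graded_mfd w) (\<lambda>z. dilation w (fst z) (snd z)) (t, y)"
proof -
  define S where "S = (UNIV :: real set) \<times> graded_space w"
  have 1: "(S, map_prod (\<lambda>x. x) (\<lambda>x. x)) \<in> atlas (prod_mfd eucl (graded_mfd w))"
    unfolding S_def by (rule atlas_prod_mfd[OF atlas_eucl_mfd atlas_eucl_mfd])
  have pt: "points (prod_mfd (eucl :: (real, real) mfd) (graded_mfd w)) = S"
    by (simp add: points_prod_mfd points_eucl_mfd S_def)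
  have id: "map_prod (\<lambda>x. x) (\<lambda>x. x) = (\<lambda>z. z)" by (auto simp: map_prod_def)
  have "smooth_on S (\<lambda>z. dilation w (fst z) (snd z))"
  proof (rule smooth_on_componentwise)
    fix i :: "real^'a" assume "i \<in> Basis"
    then obtain \<alpha> where \<alpha>: "i = axis \<alpha> 1" by (auto simp: Basis_vec_def)
    have "smooth_on S (\<lambda>z. fst z ^ w \<alpha> * (snd z \<bullet> axis \<alpha> 1))"
      by (intro smooth_on_mult smooth_on_power smooth_on_linear[OF bounded_linear_fst]
          smooth_on_linear_compose[OF bounded_linear_inner_left smooth_on_linear[OF bounded_linear_snd]])
    then show "smooth_on S (\<lambda>z. dilation w (fst z) (snd z) \<bullet> i)"
      by (simp add: \<alpha> dilation_def inner_axis)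
  qed
  then have sm: "smooth_on (map_prod (\<lambda>x. x) (\<lambda>x. x) ` S)
      (\<lambda>z. dilation w (fst (inv_into S (map_prod (\<lambda>x. x) (\<lambda>x. x)) z))
        (snd (inv_into S (map_prod (\<lambda>x. x) (\<lambda>x. x)) z)))"
    unfolding id by (rule smooth_on_subset_cong) (auto simp: inv_into_ident)
  show ?thesis
    by (rule smooth_atI_local[OF 1 atlas_eucl_mfd _ _ _ _ sm])
      (use assms in \<open>auto simp: pt S_def dilation_in_graded_space\<close>)
qed

locale graded_bundle_locale =
  fixes M :: "('a::{t2_space,second_countable_topology}, 'e::euclidean_space) mfd"
    and M0 :: "('b::{t2_space,second_countable_topology}, 'c::euclidean_space) mfd"
    and w :: "'i::finite \<Rightarrow> nat"
    and \<tau> :: "'a \<Rightarrow> 'b"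
    and \<Psi> :: "('a, 'b, real^'i) triv set"
  assumes graded: "graded_bundle M M0 w \<tau> \<Psi>"
begin

abbreviation "h \<equiv> homothety M w \<tau> \<Psi>"

lemma M: "smooth_manifold M" and M0: "smooth_manifold M0" and \<tau>: "smooth_map M M0 \<tau>"
  using graded by (auto simp: graded_bundle_def fiber_bundle_def)

lemma \<tau>_points: "p \<in> points M \<Longrightarrow> \<tau> p \<in> points M0"
  using \<tau> by (auto simp: smooth_map_def)

lemma smooth_at_\<tau>: "p \<in> points M \<Longrightarrow> smooth_at M M0 \<tau> p"
  using \<tau> smooth_map_iff[OF M M0] by blast

lemma trivE:
  assumes "p \<in> points M" obtains U \<psi> where "(U, \<psi>) \<in> \<Psi>" "\<tau> p \<in> U"
proof -
  have "\<tau> p \<in> (\<Union>(U, \<psi>)\<in>\<Psi>. U)"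
    using graded \<tau>_points[OF assms] by (simp add: graded_bundle_def fiber_bundle_def)
  then show ?thesis using that by auto
qed

lemma over_open: "open_in M0 U \<Longrightarrow> open_in M (over M \<tau> U)"
  unfolding over_def using \<tau> by (intro continuous_openin_preimage[of _ _ "points M0"]) (auto simp: smooth_map_def)

lemma
  assumes "(U, \<psi>) \<in> \<Psi>"
  shows triv_open: "open_in M0 U"
    and triv_bij: "bij_betw \<psi> (over M \<tau> U) (U \<times> graded_space w)"
    and triv_fst: "\<And>p. p \<in> over M \<tau> U \<Longrightarrow> fst (\<psi> p) = \<tau> p"
    and triv_smooth: "\<And>p. p \<in> over M \<tau> U \<Longrightarrow>
      smooth_at M (prod_mfd (sub_mfd M0 U) (graded_mfd w)) \<psi> p"
    and triv_inv_smooth: "\<And>z. z \<in> U \<times> graded_space w \<Longrightarrow>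
      smooth_at (prod_mfd (sub_mfd M0 U) (graded_mfd w)) M (inv_into (over M \<tau> U) \<psi>) z"
proof -
  let ?O = "over M \<tau> U" and ?P = "prod_mfd (sub_mfd M0 U) (graded_mfd w)"
  have 1: "open_in M0 U" "diffeo (sub_mfd M ?O) ?P \<psi>" "\<forall>p\<in>?O. fst (\<psi> p) = \<tau> p"
    using graded assms unfolding graded_bundle_def fiber_bundle_def by blast+
  show "open_in M0 U" "\<And>p. p \<in> ?O \<Longrightarrow> fst (\<psi> p) = \<tau> p" using 1 by auto
  have O: "open_in M ?O" by (rule over_open[OF 1(1)])
  have pt: "points (sub_mfd M ?O) = ?O" "points ?P = U \<times> graded_space w"
    using openin_subset[OF 1(1)] by (auto simp: points_sub_mfd points_prod_mfd points_eucl_mfd over_def)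
  show "bij_betw \<psi> ?O (U \<times> graded_space w)" using 1(2) unfolding diffeo_def pt by blast
  have sP: "smooth_manifold ?P"
    by (rule smooth_manifold_prod_mfd[OF smooth_manifold_sub_mfd[OF M0 1(1)] smooth_manifold_graded_mfd])
  have sO: "smooth_manifold (sub_mfd M ?O)" by (rule smooth_manifold_sub_mfd[OF M O])
  have 2: "smooth_map (sub_mfd M ?O) ?P \<psi>" "smooth_map ?P (sub_mfd M ?O) (inv_into ?O \<psi>)"
    using 1(2) unfolding diffeo_def pt by blast+
  show "smooth_at M ?P \<psi> p" if "p \<in> ?O" for p
    using 2(1) that unfolding smooth_map_iff[OF sO sP] pt smooth_at_sub_domain[OF M sP O that, symmetric]
    by blast
  show "smooth_at ?P M (inv_into ?O \<psi>) z" if "z \<in> U \<times> graded_space w" for z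
  proof -
    have s: "smooth_at ?P (sub_mfd M ?O) (inv_into ?O \<psi>) z"
      using 2(2) that unfolding smooth_map_iff[OF sP sO] pt by blast
    have "inv_into ?O \<psi> z \<in> ?O" using smooth_at_points[OF sP sO s] pt by auto
    then show ?thesis using s smooth_at_sub_range[OF sP M O] by blast
  qed
qed

lemma triv_eq: "(U, \<psi>) \<in> \<Psi> \<Longrightarrow> p \<in> over M \<tau> U \<Longrightarrow> \<psi> p = (\<tau> p, snd (\<psi> p))"
  using triv_fst by (metis prod.collapse)

lemma triv_graded: "(U, \<psi>) \<in> \<Psi> \<Longrightarrow> p \<in> over M \<tau> U \<Longrightarrow> snd (\<psi> p) \<in> graded_space w"
  using bij_betwE[OF triv_bij] by fastforce

lemma triv_inv: "(U, \<psi>) \<in> \<Psi> \<Longrightarrow> p \<in> over M \<tau> U \<Longrightarrow> inv_into (over M \<tau> U) \<psi> (\<psi> p) = p"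
  using triv_bij by (auto simp: bij_betw_def)

lemma triv_inv_in:
  assumes "(U, \<psi>) \<in> \<Psi>" "x \<in> U" "y \<in> graded_space w"
  shows "inv_into (over M \<tau> U) \<psi> (x, y) \<in> over M \<tau> U"
    and "\<psi> (inv_into (over M \<tau> U) \<psi> (x, y)) = (x, y)"
proof -
  have "(x, y) \<in> \<psi> ` over M \<tau> U"
    using triv_bij[OF assms(1)] assms(2,3) by (simp add: bij_betw_def)
  then show "inv_into (over M \<tau> U) \<psi> (x, y) \<in> over M \<tau> U"
    "\<psi> (inv_into (over M \<tau> U) \<psi> (x, y)) = (x, y)"
    by (auto intro: inv_into_into f_inv_into_f)
qed

text \<open>Existence amounts to independence of the trivialization: the dilated point built in one
  of them satisfies the formula in all others, since the transition maps are graded and so commute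
  with dilations.\<close>

lemma homothety_char:
  assumes p: "p \<in> points M"
  shows "h t p \<in> points M \<and> \<tau> (h t p) = \<tau> p \<and>
    (\<forall>(U, \<psi>)\<in>\<Psi>. \<tau> p \<in> U \<longrightarrow> snd (\<psi> (h t p)) = dilation w t (snd (\<psi> p)))"
  unfolding homothety_def
proof (rule theI')
  obtain U \<psi> where U: "(U, \<psi>) \<in> \<Psi>" "\<tau> p \<in> U" using p by (rule trivE)
  have pO: "p \<in> over M \<tau> U" using p U by (simp add: over_def)
  define q where "q = inv_into (over M \<tau> U) \<psi> (\<tau> p, dilation w t (snd (\<psi> p)))"
  have q: "q \<in> over M \<tau> U" "\<psi> q = (\<tau> p, dilation w t (snd (\<psi> p)))"
    unfolding q_def by (rule triv_inv_in[OF U dilation_in_graded_space[OF triv_graded[OF U(1) pO]]])+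
  have \<tau>q: "\<tau> q = \<tau> p" using triv_fst[OF U(1) q(1)] q(2) by simp
  show "\<exists>!q. q \<in> points M \<and> \<tau> q = \<tau> p \<and>
      (\<forall>(U, \<psi>)\<in>\<Psi>. \<tau> p \<in> U \<longrightarrow> snd (\<psi> q) = dilation w t (snd (\<psi> p)))"
  proof (rule ex1I[of _ q])
    have "snd (\<psi>' q) = dilation w t (snd (\<psi>' p))" if V: "(V, \<psi>') \<in> \<Psi>" "\<tau> p \<in> V" for V \<psi>'
    proof -
      define g where "g y = snd (\<psi>' (inv_into (over M \<tau> U) \<psi> (\<tau> p, y)))" for y
      have "graded_iso w g"
        using graded U V unfolding graded_bundle_def g_def[abs_def] by blast
      then have "graded_map w g" by (simp add: graded_iso_def)
      then have "g (dilation w t (snd (\<psi> p))) = dilation w t (g (snd (\<psi> p)))"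
        by (rule graded_map_dilation) (rule triv_graded[OF U(1) pO])
      moreover have "g (snd (\<psi> p)) = snd (\<psi>' p)"
        using triv_inv[OF U(1) pO] triv_eq[OF U(1) pO] by (simp add: g_def)
      ultimately show ?thesis by (simp add: g_def q_def)
    qed
    then show "q \<in> points M \<and> \<tau> q = \<tau> p \<and>
        (\<forall>(U, \<psi>)\<in>\<Psi>. \<tau> p \<in> U \<longrightarrow> snd (\<psi> q) = dilation w t (snd (\<psi> p)))"
      using q(1) \<tau>q by (auto simp: over_def)
    fix r assume r: "r \<in> points M \<and> \<tau> r = \<tau> p \<and>
        (\<forall>(U, \<psi>)\<in>\<Psi>. \<tau> p \<in> U \<longrightarrow> snd (\<psi> r) = dilation w t (snd (\<psi> p)))"
    then have rO: "r \<in> over M \<tau> U" using U by (simp add: over_def)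
    have "snd (\<psi> r) = dilation w t (snd (\<psi> p))" using r U by blast
    then have "\<psi> r = \<psi> q" using triv_eq[OF U(1) rO] r q(2) by metis
    then show "r = q" using triv_inv[OF U(1) rO] triv_inv[OF U(1) q(1)] by metis
  qed
qed

lemma
  assumes "p \<in> points M"
  shows homothety_points: "h t p \<in> points M"
    and homothety_base: "\<tau> (h t p) = \<tau> p"
    and homothety_triv: "\<And>U \<psi>. (U, \<psi>) \<in> \<Psi> \<Longrightarrow> \<tau> p \<in> U \<Longrightarrow> snd (\<psi> (h t p)) = dilation w t (snd (\<psi> p))"
  using homothety_char[OF assms, of t] by auto

lemma homothety_over: "p \<in> over M \<tau> U \<Longrightarrow> h t p \<in> over M \<tau> U"
  by (simp add: over_def homothety_points homothety_base)

lemma homothety_eqI: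
  assumes "p \<in> points M" "q \<in> points M" "\<tau> p = \<tau> q"
    and "\<And>U \<psi>. (U, \<psi>) \<in> \<Psi> \<Longrightarrow> \<tau> p \<in> U \<Longrightarrow> snd (\<psi> p) = snd (\<psi> q)"
  shows "p = q"
proof -
  obtain U \<psi> where U: "(U, \<psi>) \<in> \<Psi>" "\<tau> p \<in> U" using assms(1) by (rule trivE)
  have O: "p \<in> over M \<tau> U" "q \<in> over M \<tau> U" using assms U by (auto simp: over_def)
  have "\<psi> p = \<psi> q" using triv_eq[OF U(1) O(1)] triv_eq[OF U(1) O(2)] assms(3) assms(4)[OF U] by simp
  then show ?thesis using triv_inv[OF U(1) O(1)] triv_inv[OF U(1) O(2)] by metis
qed

lemma homothety_homothety: "p \<in> points M \<Longrightarrow> h s (h t p) = h (s * t) p"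
  by (rule homothety_eqI) (simp_all add: homothety_points homothety_base homothety_triv dilation_dilation)

lemma homothety_1: "p \<in> points M \<Longrightarrow> h 1 p = p"
  by (rule homothety_eqI) (simp_all add: homothety_points homothety_base homothety_triv dilation_1)

lemma homothety_smooth:
  assumes p: "p \<in> points M"
  shows "smooth_at (prod_mfd eucl M) M (\<lambda>z. h (fst z) (snd z)) (t, p)"
proof -
  obtain U \<psi> where U: "(U, \<psi>) \<in> \<Psi>" "\<tau> p \<in> U" using p by (rule trivE)
  define V where "V = over M \<tau> U"
  have pV: "p \<in> V" using p U by (simp add: over_def V_def)
  have V: "open_in M V" unfolding V_def by (rule over_open[OF triv_open[OF U(1)]])
  let ?E = "eucl :: (real, real) mfd" and ?G = "graded_mfd w" and ?B = "sub_mfd M0 U"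
  have eu: "smooth_manifold ?E" by (rule smooth_manifold_eucl)
  have G: "smooth_manifold ?G" by (rule smooth_manifold_graded_mfd)
  have B: "smooth_manifold ?B" by (rule smooth_manifold_sub_mfd[OF M0 triv_open[OF U(1)]])
  have EM: "smooth_manifold (prod_mfd ?E M)" by (rule smooth_manifold_prod_mfd[OF eu M])
  have EG: "smooth_manifold (prod_mfd ?E ?G)" by (rule smooth_manifold_prod_mfd[OF eu G])
  have BG: "smooth_manifold (prod_mfd ?B ?G)" by (rule smooth_manifold_prod_mfd[OF B G])
  have f1: "smooth_at (prod_mfd ?E M) ?E fst (t, p)" and f2: "smooth_at (prod_mfd ?E M) M snd (t, p)"
    using smooth_at_fst[OF eu M] smooth_at_snd[OF eu M] p by (auto simp: points_eucl_mfd)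
  have \<psi>p: "\<psi> p = (\<tau> p, snd (\<psi> p))" using triv_eq[OF U(1)] pV by (simp add: V_def)
  have gr: "snd (\<psi> p) \<in> graded_space w" using triv_graded[OF U(1)] pV by (simp add: V_def)
  have pts: "\<tau> p \<in> points ?B" "snd (\<psi> p) \<in> points ?G"
    using U(2) \<tau>_points[OF p] gr by (auto simp: points_sub_mfd points_eucl_mfd)
  have "smooth_at M (prod_mfd ?B ?G) \<psi> (snd (t, p))" using triv_smooth[OF U(1)] pV by (simp add: V_def)
  from smooth_at_compose[OF EM M BG f2 this]
  have f3: "smooth_at (prod_mfd ?E M) (prod_mfd ?B ?G) (\<lambda>z. \<psi> (snd z)) (t, p)" .
  have "smooth_at (prod_mfd ?B ?G) ?B fst (\<psi> (snd (t, p)))"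
    using smooth_at_fst[OF B G pts] \<psi>p by simp
  from smooth_at_compose[OF EM BG B f3 this]
  have f4: "smooth_at (prod_mfd ?E M) ?B (\<lambda>z. fst (\<psi> (snd z))) (t, p)" .
  have "smooth_at (prod_mfd ?B ?G) ?G snd (\<psi> (snd (t, p)))"
    using smooth_at_snd[OF B G pts] \<psi>p by simp
  from smooth_at_compose[OF EM BG G f3 this]
  have f5: "smooth_at (prod_mfd ?E M) ?G (\<lambda>z. snd (\<psi> (snd z))) (t, p)" .
  have f6: "smooth_at (prod_mfd ?E M) (prod_mfd ?E ?G) (\<lambda>z. (fst z, snd (\<psi> (snd z)))) (t, p)"
    by (rule smooth_at_Pair[OF eu G EM f1 f5])
  have "smooth_at (prod_mfd ?E ?G) ?G (\<lambda>z. dilation w (fst z) (snd z)) (fst (t, p), snd (\<psi> (snd (t, p))))"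
    using smooth_at_dilation[OF gr] by simp
  from smooth_at_compose[OF EM EG G f6 this]
  have f7: "smooth_at (prod_mfd ?E M) ?G (\<lambda>z. dilation w (fst z) (snd (\<psi> (snd z)))) (t, p)" by simp
  have f8: "smooth_at (prod_mfd ?E M) (prod_mfd ?B ?G)
      (\<lambda>z. (fst (\<psi> (snd z)), dilation w (fst z) (snd (\<psi> (snd z))))) (t, p)"
    by (rule smooth_at_Pair[OF B G EM f4 f7])
  have "smooth_at (prod_mfd ?B ?G) M (inv_into (over M \<tau> U) \<psi>)
      (fst (\<psi> (snd (t, p))), dilation w (fst (t, p)) (snd (\<psi> (snd (t, p)))))"
    using \<psi>p U(2) dilation_in_graded_space[OF gr] by (intro triv_inv_smooth[OF U(1)]) (simp add: mem_Times_iff, metis fst_conv)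
  from smooth_at_compose[OF EM BG M f8 this]
  have f9: "smooth_at (prod_mfd ?E M) M
      (\<lambda>z. inv_into V \<psi> (fst (\<psi> (snd z)), dilation w (fst z) (snd (\<psi> (snd z))))) (t, p)"
    by (simp add: V_def)
  show ?thesis
  proof (rule smooth_at_cong[OF EM f9])
    show "open_in (prod_mfd ?E M) (UNIV \<times> V)"
      unfolding points_prod_mfd points_eucl_mfd by (rule openin_Times[OF _ V]) simp
    show "(t, p) \<in> UNIV \<times> V" using pV by simp
    fix z assume "z \<in> (UNIV :: real set) \<times> V"
    then have z: "snd z \<in> over M \<tau> U" by (auto simp: V_def)
    have hz: "h (fst z) (snd z) \<in> over M \<tau> U" by (rule homothety_over[OF z])
    have "\<psi> (h (fst z) (snd z)) = (\<tau> (snd z), dilation w (fst z) (snd (\<psi> (snd z))))"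
      using triv_eq[OF U(1) hz] z homothety_triv[OF _ U(1)] homothety_base by (simp add: over_def)
    then show "inv_into V \<psi> (fst (\<psi> (snd z)), dilation w (fst z) (snd (\<psi> (snd z)))) = h (fst z) (snd z)"
      using triv_inv[OF U(1) hz] triv_fst[OF U(1) z] by (simp add: V_def)
  qed
qed

lemma
  assumes p: "p \<in> points M"
  shows homothety_smooth_point: "smooth_at M M (h t) p"
    and homothety_smooth_param: "smooth_at eucl M (\<lambda>t. h t p) t"
proof -
  have eu: "smooth_manifold (eucl :: (real, real) mfd)" by (rule smooth_manifold_eucl)
  note EM = smooth_manifold_prod_mfd[OF eu M]
  have t: "t \<in> points (eucl :: (real, real) mfd)" by (simp add: points_eucl_mfd)
  have 1: "smooth_at M (prod_mfd eucl M) (\<lambda>q. (t, q)) p"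
    by (rule smooth_at_Pair[OF eu M M smooth_at_const[OF M eu p t] smooth_at_ident[OF M p]])
  show "smooth_at M M (h t) p"
    using smooth_at_compose[OF M EM M 1 homothety_smooth[OF p]] by simp
  have 2: "smooth_at eucl (prod_mfd eucl M) (\<lambda>s. (s, p)) t"
    by (rule smooth_at_Pair[OF eu M eu smooth_at_ident[OF eu t] smooth_at_const[OF eu M t p]])
  show "smooth_at eucl M (\<lambda>t. h t p) t"
    using smooth_at_compose[OF eu EM M 2 homothety_smooth[OF p]] by simp
qed

end

section \<open>Homogeneity for negative parameters\<close>

text \<open>The one-sided derivatives of order \<open>n\<close> at zero relate the two coefficients.\<close>

lemma smooth_homogeneous_parity_nat:
  fixes u :: "real \<Rightarrow> real"
  assumes "\<And>k. Ck_on k UNIV u" "\<And>t. t > 0 \<Longrightarrow> u t = c * t ^ n" "\<And>t. t > 0 \<Longrightarrow> u (- t) = d * t ^ n"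
  shows "d = (- 1) ^ n * c"
  using assms
proof (induction n arbitrary: u c d)
  case 0
  have "isCont u 0" using Ck_on_imp_continuous_on[OF 0(1)] by (simp add: continuous_on_eq_continuous_at)
  then have lim: "(u \<longlongrightarrow> u 0) (at_right 0)" "(u \<longlongrightarrow> u 0) (at_left 0)"
    by (auto simp: isCont_def filterlim_at_split)
  have "\<forall>\<^sub>F t in at_right 0. u t = c"
    using 0(2) by (auto simp: eventually_at_right_field intro: exI[of _ 1])
  then have "u 0 = c" by (intro tendsto_unique[OF _ lim(1)] tendsto_eventually) simp_all
  have "u t = d" if "t < 0" for t using 0(3)[of "- t"] that by simp
  then have "\<forall>\<^sub>F t in at_left 0. u t = d"
    by (auto simp: eventually_at_left_field intro: exI[of _ "-1"])
  then have "u 0 = d" by (intro tendsto_unique[OF _ lim(2)] tendsto_eventually) simp_all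
  with \<open>u 0 = c\<close> show ?case by simp
next
  case (Suc n)
  define u' where "u' t = frechet_derivative u (at t) 1" for t
  have D: "(u has_real_derivative u' t) (at t)" for t
  proof -
    have "u differentiable (at t)" using Suc.prems(1)[of 1] by simp
    then have d: "(u has_derivative frechet_derivative u (at t)) (at t)" by (simp add: frechet_derivative_works)
    have "frechet_derivative u (at t) = (*) (u' t)"
    proof
      fix x
      show "frechet_derivative u (at t) x = u' t * x"
        using linear_scale[OF has_derivative_linear[OF d], of x 1] by (simp add: u'_def mult.commute)
    qed
    then show ?thesis using d by (simp add: has_field_derivative_def)
  qed
  have pow: "((\<lambda>t. c * t ^ Suc n) has_real_derivative real (Suc n) * c * t ^ n) (at t)" for c t :: real
    using DERIV_cmult[OF DERIV_pow[of "Suc n" t], of c] by (simp add: ac_simps del: power_Suc)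
  \<comment> \<open>Differentiation lowers the degree by one and reverses the sign of the
    coefficient on the negative half-line; the induction hypothesis is used for \<open>u'\<close>
    with these new coefficients.\<close>
  have "- (real (Suc n) * d) = (- 1) ^ n * (real (Suc n) * c)"
  proof (rule Suc.IH[of u'])
    show "Ck_on k UNIV u'" for k using Suc.prems(1)[of "Suc k"] by (simp add: u'_def[abs_def])
    fix t :: real assume t: "t > 0"
    note pow[of c t]
    moreover have "((\<lambda>t. c * t ^ Suc n) has_real_derivative u' t) (at t)"
      by (rule has_field_derivative_transform_within_open[OF D, of "{0<..}"]) (use t Suc.prems(2) in auto)
    ultimately show "u' t = real (Suc n) * c * t ^ n" by (rule DERIV_unique[rotated])
    have "((\<lambda>t. d * (- t) ^ Suc n) has_real_derivative - (real (Suc n) * d) * t ^ n) (at (- t))"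
      using DERIV_chain2[OF pow[of d "- (- t)"] DERIV_minus[OF DERIV_ident]] by (simp del: power_Suc)
    moreover have "((\<lambda>t. d * (- t) ^ Suc n) has_real_derivative u' (- t)) (at (- t))"
    proof (rule has_field_derivative_transform_within_open[OF D, of "{..<0}"])
      show "u x = d * (- x) ^ Suc n" if "x \<in> {..<0}" for x using Suc.prems(3)[of "- x"] that by simp
    qed (use t in auto)
    ultimately show "u' (- t) = - (real (Suc n) * d) * t ^ n" by (rule DERIV_unique[rotated])
  qed
  then have "real (Suc n) * d = real (Suc n) * ((- 1) ^ Suc n * c)" by (simp add: algebra_simps)
  then show ?case by (subst (asm) mult_left_cancel) simp_all
qed

text \<open>Negative exponents do occur: a field of weight -1 applied to a base coordinate has
  degree -1. Continuity at 0 then forces both coefficients to vanish.\<close>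

lemma smooth_homogeneous_parity:
  fixes u :: "real \<Rightarrow> real"
  assumes u: "\<And>k. Ck_on k UNIV u"
    and c: "\<And>t. t > 0 \<Longrightarrow> u t = t powi n * c" and d: "\<And>t. t > 0 \<Longrightarrow> u (- t) = t powi n * d"
  shows "d = (- 1) powi n * c"
proof (cases "n \<ge> 0")
  case True
  then obtain m where m: "n = int m" using nonneg_int_cases by blast
  show ?thesis
    using smooth_homogeneous_parity_nat[OF u, of c m d] c d by (simp add: m mult.commute)
next
  case False
  define m where "m = nat (- n)"
  have m: "n = - int m" "m > 0" using False by (auto simp: m_def)
  have cont: "isCont u 0" using Ck_on_imp_continuous_on[OF u] by (simp add: continuous_on_eq_continuous_at)
  have zero: "e = 0" if e: "\<And>t. t > 0 \<Longrightarrow> v t = t powi n * e" and v: "isCont v 0" for v :: "real \<Rightarrow> real" and e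
  proof -
    have "isCont (\<lambda>t. t ^ m * v t) 0" using v by (intro continuous_intros)
    then have lim: "((\<lambda>t. t ^ m * v t) \<longlongrightarrow> 0) (at_right 0)"
      using m(2) by (auto simp: isCont_def filterlim_at_split zero_power)
    have "t ^ m * v t = e" if "t > 0" for t
      using that e[OF that] m by (simp add: power_int_minus)
    then have "\<forall>\<^sub>F t in at_right 0. t ^ m * v t = e"
      by (auto simp: eventually_at_right_field intro: exI[of _ 1])
    then have "0 = e" by (intro tendsto_unique[OF _ lim] tendsto_eventually) simp_all
    then show ?thesis by simp
  qed
  have "isCont (\<lambda>t::real. - t) 0" by (rule continuous_minus[OF continuous_ident])
  from isCont_o2[OF this, of u] have "isCont (\<lambda>t. u (- t)) 0" using cont by simp
  then have "d = 0" using zero[of "\<lambda>t. u (- t)" d] d by blast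
  moreover have "c = 0" using zero[of u c] c cont by blast
  ultimately show ?thesis by simp
qed

text \<open>Linearity is not built into tangent vectors; it is read off from a representing curve.
  Along that curve the chain rule determines the value at \<open>f\<close> from the values at the
  components of \<open>\<Phi>\<close>. \<open>F\<close> lives on the ambient linear space, so that a
  smooth extension of a coordinate expression can be inserted.\<close>

lemma tangent_vector_chain:
  fixes \<Phi> :: "'a::{t2_space,second_countable_topology} \<Rightarrow> 'd::euclidean_space"
  assumes M: "smooth_manifold M" and v: "tangent_vector M p v"
    and \<Phi>: "\<And>i. i \<in> Basis \<Longrightarrow> smooth_at M eucl (\<lambda>q. \<Phi> q \<bullet> i) p"
    and f: "smooth_at M eucl f p" and T: "open_in M T" "p \<in> T" "\<And>q. q \<in> T \<Longrightarrow> f q = F (\<Phi> q)"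
    and F: "(F has_derivative F') (at (\<Phi> p))"
  shows "v f = (\<Sum>i\<in>Basis. v (\<lambda>q. \<Phi> q \<bullet> i) * F' i)"
proof -
  obtain \<epsilon> \<gamma> where \<epsilon>: "\<epsilon> > 0" and \<gamma>: "smooth_map (eucl_mfd UNIV {-\<epsilon><..<\<epsilon>}) M \<gamma>" "\<gamma> 0 = p"
    and D: "\<And>f. smooth_fun_near M p f \<Longrightarrow> ((\<lambda>t. f (\<gamma> t)) has_real_derivative v f) (at 0)"
    using v unfolding tangent_vector_def by blast
  have cont: "continuous_on {-\<epsilon><..<\<epsilon>} \<gamma>" "\<gamma> ` {-\<epsilon><..<\<epsilon>} \<subseteq> points M"
    using \<gamma>(1) by (auto simp: smooth_map_def points_eucl_mfd)
  have "openin (top_of_set {-\<epsilon><..<\<epsilon>}) ({-\<epsilon><..<\<epsilon>} \<inter> \<gamma> -` T)"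
    by (rule continuous_openin_preimage[OF cont(1) _ T(1)]) (use cont(2) in auto)
  then have op: "open ({-\<epsilon><..<\<epsilon>} \<inter> \<gamma> -` T)" by (rule openin_open_trans) simp
  have "((\<lambda>t. \<Phi> (\<gamma> t) \<bullet> i) has_vector_derivative v (\<lambda>q. \<Phi> q \<bullet> i)) (at 0)" if "i \<in> Basis" for i
    using D[of "\<lambda>q. \<Phi> q \<bullet> i"] \<Phi>[OF that]
    by (simp add: smooth_fun_near_iff[OF M] has_real_derivative_iff_has_vector_derivative)
  then have "((\<lambda>t. \<Sum>i\<in>Basis. (\<Phi> (\<gamma> t) \<bullet> i) *\<^sub>R i) has_vector_derivative
      (\<Sum>i\<in>Basis. v (\<lambda>q. \<Phi> q \<bullet> i) *\<^sub>R i)) (at 0)"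
    by (intro has_vector_derivative_sum bounded_linear.has_vector_derivative[OF bounded_linear_scaleR_left])
  then have "((\<lambda>t. \<Phi> (\<gamma> t)) has_vector_derivative (\<Sum>i\<in>Basis. v (\<lambda>q. \<Phi> q \<bullet> i) *\<^sub>R i)) (at 0)"
    by (simp add: euclidean_representation)
  then have "((\<lambda>t. F (\<Phi> (\<gamma> t))) has_vector_derivative F' (\<Sum>i\<in>Basis. v (\<lambda>q. \<Phi> q \<bullet> i) *\<^sub>R i)) (at 0)"
    using vector_derivative_diff_chain_within[of "\<lambda>t. \<Phi> (\<gamma> t)" _ 0 UNIV F F'] F \<gamma>(2)
    by (simp add: o_def has_derivative_at_withinI)
  then have "((\<lambda>t. F (\<Phi> (\<gamma> t))) has_real_derivative (\<Sum>i\<in>Basis. v (\<lambda>q. \<Phi> q \<bullet> i) * F' i)) (at 0)"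
    using has_derivative_linear[OF F]
    by (simp add: has_real_derivative_iff_has_vector_derivative linear_sum linear_scale)
  then have "((\<lambda>t. f (\<gamma> t)) has_real_derivative (\<Sum>i\<in>Basis. v (\<lambda>q. \<Phi> q \<bullet> i) * F' i)) (at 0)"
    by (rule has_field_derivative_transform_within_open[OF _ op]) (use \<epsilon> \<gamma>(2) T in auto)
  moreover have "((\<lambda>t. f (\<gamma> t)) has_real_derivative v f) (at 0)"
    by (rule D) (simp add: smooth_fun_near_iff[OF M] f)
  ultimately show ?thesis by (rule DERIV_unique[rotated])
qed

text \<open>Besides homogeneity this expresses locality: with \<open>c = 1\<close>, functions that
  agree near \<open>p\<close> receive the same value.\<close>

lemma tangent_vector_scale:
  assumes M: "smooth_manifold M" and v: "tangent_vector M p v"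
    and f: "smooth_at M eucl f p" and T: "open_in M T" "p \<in> T" "\<And>q. q \<in> T \<Longrightarrow> g q = c * f q"
  shows "v g = c * v f"
proof -
  have cf: "smooth_at M eucl (\<lambda>q. c * f q) p"
    by (rule smooth_at_eucl_compose[OF M f smooth_on_linear[OF bounded_linear_mult_right], of UNIV]) auto
  have g: "smooth_at M eucl g p"
    by (rule smooth_at_cong[OF M cf T(1,2)]) (simp add: T(3))
  have "v g = (\<Sum>i\<in>Basis. v (\<lambda>q. f q \<bullet> i) * (c * i))"
  proof (rule tangent_vector_chain[OF M v smooth_at_inner[OF M f] g T])
    show "((*) c has_derivative (*) c) (at (f p))" by (auto intro!: derivative_eq_intros)
  qed
  then show ?thesis by (simp add: mult.commute)
qed

locale weighted_field = graded_bundle_locale +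
  fixes X :: "'a \<Rightarrow> 'a tvec" and k :: int
  assumes X: "vector_field M X" and weight: "has_weight M h X k"
begin

lemma tangent: "p \<in> points M \<Longrightarrow> tangent_vector M p (X p)"
  using X by (simp add: vector_field_def)

lemma weight_pos:
  "p \<in> points M \<Longrightarrow> t > 0 \<Longrightarrow> smooth_at M eucl f (h t p) \<Longrightarrow>
    X p (\<lambda>q. f (h t q)) = t powi (- k) * X (h t p) f"
  using weight by (simp add: has_weight_def push_forward_def smooth_fun_near_iff[OF M])

lemma smooth_at_homothety_compose:
  assumes "p \<in> points M" "smooth_at M eucl f (h t p)"
  shows "smooth_at M eucl (\<lambda>q. f (h t q)) p"
  by (rule smooth_at_compose[OF M M smooth_manifold_eucl homothety_smooth_point[OF assms(1)] assms(2)])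

lemma weight_minus_one_homogeneous:
  assumes T: "open_in M T" "\<And>q t. q \<in> T \<Longrightarrow> h t q \<in> T"
    and f: "\<And>q. q \<in> T \<Longrightarrow> smooth_at M eucl f q" "\<And>q t. q \<in> T \<Longrightarrow> f (h t q) = t ^ m * f q"
    and p: "p \<in> T"
  shows "X p (\<lambda>q. f (h (- 1) q)) = (- 1) powi (- k) * X (h (- 1) p) f"
proof -
  have TM: "q \<in> points M" if "q \<in> T" for q using openin_subset[OF T(1)] that by auto
  have scale: "X q (\<lambda>r. f (h t r)) = t ^ m * X q f" if q: "q \<in> T" for q t
    by (rule tangent_vector_scale[OF M tangent[OF TM[OF q]] f(1)[OF q] T(1) q]) (rule f(2))
  have pos: "X (h t q) f = t powi (k + int m) * X q f" if q: "q \<in> T" and t: "t > 0" for q t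
  proof -
    have "t ^ m * X q f = t powi (- k) * X (h t q) f"
      using weight_pos[OF TM[OF q] t f(1)[OF T(2)[OF q]]] scale[OF q] by simp
    then have "t powi k * (t ^ m * X q f) = (t powi k * t powi (- k)) * X (h t q) f" by simp
    also have "t powi k * t powi (- k) = 1" using t by (simp flip: power_int_add)
    finally show ?thesis using t by (simp add: power_int_add)
  qed
  define u where "u t = X (h t p) f" for t
  have "smooth_fun_on M T f" using f(1) by (simp add: smooth_fun_on_iff[OF M T(1)])
  then have "smooth_fun_on M T (\<lambda>q. X q f)" using X T(1) by (simp add: vector_field_def)
  then have Xf: "smooth_at M eucl (\<lambda>q. X q f) q" if "q \<in> T" for q
    using that by (simp add: smooth_fun_on_iff[OF M T(1)])
  have "smooth_at eucl eucl u t" for t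
    unfolding u_def
    by (rule smooth_at_compose[OF smooth_manifold_eucl M smooth_manifold_eucl
          homothety_smooth_param[OF TM[OF p]] Xf[OF T(2)[OF p]]])
  then have "smooth_on UNIV u"
    by (intro smooth_at_eucl_mfd_imp_smooth_on[OF smooth_manifold_eucl smooth_manifold_eucl])
  then have uCk: "Ck_on j UNIV u" for j by (rule smooth_on_open_imp_Ck) simp
  have "u (- 1) = (- 1) powi (k + int m) * u 1"
  proof (rule smooth_homogeneous_parity[OF uCk])
    fix t :: real assume t: "t > 0"
    show "u t = t powi (k + int m) * u 1"
      using pos[OF p t] homothety_1[OF TM[OF p]] by (simp add: u_def)
    show "u (- t) = t powi (k + int m) * u (- 1)"
      using pos[OF T(2)[OF p] t, of "- 1"] homothety_homothety[OF TM[OF p], of t "- 1"] by (simp add: u_def)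
  qed
  then have "(- 1) powi (- k) * u (- 1) = ((- 1) powi (- k) * (- 1) powi (k + int m)) * u 1" by simp
  \<comment> \<open>The contributions of \<open>k\<close> cancel; what remains is the factor by
    which \<open>h (- 1)\<close> scales \<open>f\<close>.\<close>
  also have "(- 1 :: real) powi (- k) * (- 1) powi (k + int m) = (- 1) ^ m"
    by (simp flip: power_int_add)
  finally show ?thesis
    using scale[OF p, of "- 1"] homothety_1[OF TM[OF p]] by (simp add: u_def)
qed

text \<open>Near a point a function is expressed through adapted coordinates: base coordinates, which are
  homogeneous of degree zero, and fibre coordinates, which are homogeneous of degree equal to
  their weight.\<close>

lemma weight_minus_one:
  assumes p: "p \<in> points M" and f: "smooth_at M eucl f (h (- 1) p)"
  shows "X p (\<lambda>q. f (h (- 1) q)) = (- 1) powi (- k) * X (h (- 1) p) f"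
proof -
  define q where "q = h (- 1) p"
  have q: "q \<in> points M" "\<tau> q = \<tau> p"
    using p by (simp_all add: q_def homothety_points homothety_base)
  obtain U \<psi> where U: "(U, \<psi>) \<in> \<Psi>" "\<tau> p \<in> U" using p by (rule trivE)
  obtain B \<kappa> where B: "(B, \<kappa>) \<in> atlas M0" "\<tau> p \<in> B" using \<tau>_points[OF p] by (rule pointsE)
  let ?G = "graded_mfd w" and ?B = "sub_mfd M0 U"
  have UB: "open_in M0 (U \<inter> B)" using triv_open[OF U(1)] chart_open[OF M0 B(1)] by (rule openin_Int)
  \<comment> \<open>A full preimage under \<tau> is invariant under all homotheties, since these
    preserve fibres.\<close>
  define T where "T = over M \<tau> (U \<inter> B)"
  have T: "open_in M T" unfolding T_def by (rule over_open[OF UB])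
  have Th: "h t r \<in> T" if "r \<in> T" for r t using that unfolding T_def by (rule homothety_over)
  have pT: "p \<in> T" "q \<in> T" using p q U B by (auto simp: T_def over_def)
  have TU: "r \<in> points M" "\<tau> r \<in> U" "\<tau> r \<in> B" "r \<in> over M \<tau> U" if "r \<in> T" for r
    using that by (auto simp: T_def over_def)
  define \<Phi> where "\<Phi> r = (\<kappa> (\<tau> r), snd (\<psi> r))" for r
  have BG: "smooth_manifold (prod_mfd ?B ?G)"
    by (rule smooth_manifold_prod_mfd[OF smooth_manifold_sub_mfd[OF M0 triv_open[OF U(1)]] smooth_manifold_graded_mfd])
  have s1: "smooth_at M eucl (\<lambda>r. \<kappa> (\<tau> r)) r" if "r \<in> T" for r
    by (rule smooth_at_compose[OF M M0 smooth_manifold_eucl smooth_at_\<tau>[OF TU(1)[OF that]]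
          smooth_at_chart[OF M0 B(1) TU(3)[OF that]]])
  have s2: "smooth_at M eucl (\<lambda>r. snd (\<psi> r)) r" if r: "r \<in> T" for r
  proof -
    have \<psi>r: "\<psi> r = (\<tau> r, snd (\<psi> r))" by (rule triv_eq[OF U(1) TU(4)[OF r]])
    have "smooth_at (prod_mfd ?B ?G) ?G snd (\<tau> r, snd (\<psi> r))"
      using triv_graded[OF U(1) TU(4)[OF r]] \<tau>_points[OF TU(1)[OF r]] TU(2)[OF r]
      by (intro smooth_at_snd[OF smooth_manifold_sub_mfd[OF M0 triv_open[OF U(1)]] smooth_manifold_graded_mfd])
        (auto simp: points_sub_mfd points_eucl_mfd)
    then have "smooth_at (prod_mfd ?B ?G) ?G snd (\<psi> r)" using \<psi>r by simp
    from smooth_at_compose[OF M BG smooth_manifold_graded_mfd triv_smooth[OF U(1) TU(4)[OF r]] this]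
    show ?thesis by (rule smooth_at_imp_eucl[OF M _ TU(1)[OF r]])
  qed
  have \<Phi>s: "smooth_at M eucl \<Phi> r" if "r \<in> T" for r
    unfolding \<Phi>_def[abs_def] by (rule smooth_at_eucl_Pair[OF M s1[OF that] s2[OF that]])
  have \<Phi>i: "smooth_at M eucl (\<lambda>r. \<Phi> r \<bullet> i) r" if "r \<in> T" for r i
    by (rule smooth_at_inner[OF M \<Phi>s[OF that]])
  have \<Phi>w: "X p (\<lambda>r. \<Phi> (h (- 1) r) \<bullet> i) = (- 1) powi (- k) * X q (\<lambda>r. \<Phi> r \<bullet> i)"
    if i: "i \<in> Basis" for i
  proof -
    have "\<exists>m. \<forall>r\<in>T. \<forall>t. \<Phi> (h t r) \<bullet> i = t ^ m * (\<Phi> r \<bullet> i)"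
    proof (cases "snd i = 0")
      case True
      then have "\<Phi> (h t r) \<bullet> i = t ^ 0 * (\<Phi> r \<bullet> i)" if "r \<in> T" for r t
        using TU(1)[OF that] by (simp add: \<Phi>_def inner_prod_def homothety_base)
      then show ?thesis by blast
    next
      case False
      then obtain \<alpha> where \<alpha>: "i = (0, axis \<alpha> 1)"
        using i by (auto simp: Basis_prod_def Basis_vec_def)
      have "\<Phi> (h t r) \<bullet> i = t ^ w \<alpha> * (\<Phi> r \<bullet> i)" if "r \<in> T" for r t
        using homothety_triv[OF TU(1)[OF that] U(1) TU(2)[OF that], of t]
        by (simp add: \<Phi>_def \<alpha> inner_axis dilation_def)
      then show ?thesis by blast
    qed
    then obtain m where m: "\<And>r t. r \<in> T \<Longrightarrow> \<Phi> (h t r) \<bullet> i = t ^ m * (\<Phi> r \<bullet> i)" by blast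
    show ?thesis
      unfolding q_def
      by (rule weight_minus_one_homogeneous[OF T Th \<Phi>i, where m=m]) (use m pT in auto)
  qed
  define D where "D = \<kappa> ` (U \<inter> B) \<times> graded_space w"
  have Dop: "openin (top_of_set (model M0 \<times> graded_space w)) D"
    unfolding D_def by (rule openin_Times[OF chart_open_image(1)[OF M0 B(1) UB]]) auto
  define E where "E = eucl_mfd (model M0 \<times> graded_space w) D"
  have E: "smooth_manifold E"
    unfolding E_def using M0 Dop
    by (intro smooth_manifold_eucl_mfd subspace_Times subspace_graded_space) (auto simp: smooth_manifold_def)
  \<comment> \<open>Inverse of the adapted coordinates. It turns \<open>f\<close> into a function of
    the coordinates, which is then extended to \<open>F\<close> on an open ambient set in order to
    have a derivative.\<close>
  define \<Xi> where "\<Xi> z = inv_into (over M \<tau> U) \<psi> (inv_into B \<kappa> (fst z), snd z)" for z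
  have \<Phi>D: "\<Phi> r \<in> D" if "r \<in> T" for r
    using TU[OF that] triv_graded[OF U(1)] by (auto simp: \<Phi>_def D_def)
  have \<Xi>\<Phi>: "\<Xi> (\<Phi> r) = r" if "r \<in> T" for r
    using TU[OF that] triv_inv[OF U(1), of r] triv_eq[OF U(1), of r] chart_inv[OF M0 B(1)]
    by (simp add: \<Xi>_def \<Phi>_def)
  have \<Xi>s: "smooth_at E M \<Xi> (\<Phi> r)" if r: "r \<in> T" for r
  proof -
    have KB: "smooth_manifold (eucl_mfd (model M0) (\<kappa> ` B))"
      using M0 chart_image_open[OF M0 B(1)] by (intro smooth_manifold_eucl_mfd) (auto simp: smooth_manifold_def)
    have 1: "smooth_at E (eucl_mfd (model M0) (\<kappa> ` B)) fst (\<Phi> r)"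
      unfolding E_def
      by (rule smooth_at_eucl_mfd[OF _ \<Phi>D[OF r] smooth_on_linear[OF bounded_linear_fst]]) (auto simp: D_def)
    have inv: "inv_into B \<kappa> (\<kappa> (\<tau> r)) = \<tau> r" by (rule chart_inv[OF M0 B(1) TU(3)[OF r]])
    have "smooth_at (eucl_mfd (model M0) (\<kappa> ` B)) M0 (inv_into B \<kappa>) (fst (\<Phi> r))"
      unfolding \<Phi>_def fst_conv by (rule smooth_at_chart_inv[OF M0 B(1) TU(3)[OF r]])
    from smooth_at_compose[OF E KB M0 1 this]
    have "smooth_at E M0 (\<lambda>z. inv_into B \<kappa> (fst z)) (\<Phi> r)" .
    then have 2: "smooth_at E ?B (\<lambda>z. inv_into B \<kappa> (fst z)) (\<Phi> r)"
      using smooth_at_sub_range[OF E M0 triv_open[OF U(1)], of "\<lambda>z. inv_into B \<kappa> (fst z)"] inv TU(2)[OF r]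
      by (simp add: \<Phi>_def)
    have 3: "smooth_at E ?G snd (\<Phi> r)"
      unfolding E_def
      by (rule smooth_at_eucl_mfd[OF _ \<Phi>D[OF r] smooth_on_linear[OF bounded_linear_snd]]) (auto simp: D_def)
    have 4: "smooth_at E (prod_mfd ?B ?G) (\<lambda>z. (inv_into B \<kappa> (fst z), snd z)) (\<Phi> r)"
      by (rule smooth_at_Pair[OF smooth_manifold_sub_mfd[OF M0 triv_open[OF U(1)]] smooth_manifold_graded_mfd E 2 3])
    have "smooth_at (prod_mfd ?B ?G) M (inv_into (over M \<tau> U) \<psi>) (inv_into B \<kappa> (fst (\<Phi> r)), snd (\<Phi> r))"
      by (rule triv_inv_smooth[OF U(1)])
        (use inv TU(2)[OF r] triv_graded[OF U(1) TU(4)[OF r]] in \<open>simp add: \<Phi>_def\<close>)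
    from smooth_at_compose[OF E BG M 4 this] show ?thesis by (simp add: \<Xi>_def[abs_def])
  qed
  have "smooth_at M eucl f (\<Xi> (\<Phi> q))" using f \<Xi>\<Phi>[OF pT(2)] by (simp add: q_def)
  from smooth_at_compose[OF E M smooth_manifold_eucl \<Xi>s[OF pT(2)] this]
  have "smooth_at E eucl (\<lambda>z. f (\<Xi> z)) (\<Phi> q)" .
  then obtain S where S: "open_in E S" "\<Phi> q \<in> S" "\<And>z. z \<in> S \<Longrightarrow> smooth_at E eucl (\<lambda>z. f (\<Xi> z)) z"
    using smooth_atD[OF E smooth_manifold_eucl] by metis
  have "smooth_on S (\<lambda>z. f (\<Xi> z))"
    using S(3) unfolding E_def
    by (rule smooth_at_eucl_mfd_imp_smooth_on[OF E[unfolded E_def] smooth_manifold_eucl])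
  then obtain W F where W: "open W" "\<Phi> q \<in> W" "\<And>k. Ck_on k W F" "\<And>z. z \<in> S \<Longrightarrow> z \<in> W \<Longrightarrow> f (\<Xi> z) = F z"
    using smooth_onE[OF _ S(2)] by metis
  obtain F' where F': "\<And>z. z \<in> W \<Longrightarrow> (F has_derivative F' z) (at z)"
    using Ck_on_SucE[OF W(3)[of 1, unfolded One_nat_def]] by metis
  have "continuous_on T \<Phi>"
    unfolding continuous_on_eq_continuous_within
  proof
    fix r assume r: "r \<in> T"
    obtain Y where Y: "open_in M Y" "r \<in> Y" "continuous_on Y \<Phi>"
      using smooth_atD[OF M smooth_manifold_eucl \<Phi>s[OF r]] by metis
    obtain Y' where Y': "open Y'" "Y = points M \<inter> Y'" using Y(1) by (auto simp: openin_open)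
    have "continuous (at r within Y) \<Phi>" using Y by (simp add: continuous_on_eq_continuous_within)
    then have "continuous (at r within T \<inter> Y') \<Phi>"
      by (rule continuous_within_subset) (use Y' TU(1) in auto)
    moreover have "at r within T \<inter> Y' = at r within T"
      by (rule at_within_nhd[of r Y']) (use Y' Y(2) in auto)
    ultimately show "continuous (at r within T) \<Phi>" by simp
  qed
  moreover have "openin (top_of_set D) (S \<inter> W)"
    using S(1) W(1) by (auto simp: E_def points_eucl_mfd openin_Int_open)
  ultimately have "openin (top_of_set T) (T \<inter> \<Phi> -` (S \<inter> W))"
    using \<Phi>D by (intro continuous_openin_preimage[where T=D]) auto
  then have op: "open_in M (T \<inter> \<Phi> -` (S \<inter> W))" using T by (rule openin_trans)
  define R where "R = T \<inter> \<Phi> -` (S \<inter> W)"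
  have R: "open_in M R" "q \<in> R" using op pT S(2) W(2) by (auto simp: R_def)
  have fF: "f r = F (\<Phi> r)" if "r \<in> R" for r
    using that W(4)[of "\<Phi> r"] \<Xi>\<Phi>[of r] by (simp add: R_def)
  have Xq: "X q f = (\<Sum>i\<in>Basis. X q (\<lambda>r. \<Phi> r \<bullet> i) * F' (\<Phi> q) i)"
    by (rule tangent_vector_chain[OF M tangent[OF q(1)] \<Phi>i[OF pT(2)] _ R fF F'[OF W(2)]])
      (use f in \<open>simp add: q_def\<close>)
  obtain Y where Y: "open_in M Y" "p \<in> Y" "h (- 1) ` Y \<subseteq> points M" "continuous_on Y (h (- 1))"
    using smooth_atD[OF M M homothety_smooth_point[OF p]] by metis
  have "openin (top_of_set Y) (Y \<inter> h (- 1) -` R)"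
    by (rule continuous_openin_preimage[OF Y(4) _ R(1)]) (use Y(3) in auto)
  then have Y': "open_in M (Y \<inter> h (- 1) -` R)" using Y(1) by (rule openin_trans)
  \<comment> \<open>Both sides are expanded with the same derivative of \<open>F\<close> at
    \<open>\<Phi> q\<close>. Only the coordinate functions differ, by composition with
    \<open>h (- 1)\<close>, and for these the claim is \<open>\<Phi>w\<close>.\<close>
  have "X p (\<lambda>r. f (h (- 1) r)) = (\<Sum>i\<in>Basis. X p (\<lambda>r. \<Phi> (h (- 1) r) \<bullet> i) * F' (\<Phi> q) i)"
  proof (rule tangent_vector_chain[OF M tangent[OF p] _ _ Y'])
    show "smooth_at M eucl (\<lambda>r. \<Phi> (h (- 1) r) \<bullet> i) p" for i
      using smooth_at_homothety_compose[OF p \<Phi>i[OF Th[OF pT(1)]]] .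
    show "smooth_at M eucl (\<lambda>r. f (h (- 1) r)) p" by (rule smooth_at_homothety_compose[OF p f])
    show "p \<in> Y \<inter> h (- 1) -` R" using Y(2) R(2) by (simp add: q_def)
    show "f (h (- 1) r) = F (\<Phi> (h (- 1) r))" if "r \<in> Y \<inter> h (- 1) -` R" for r using fF that by simp
    show "(F has_derivative F' (\<Phi> q)) (at (\<Phi> (h (- 1) p)))" using F'[OF W(2)] by (simp add: q_def)
  qed
  also have "\<dots> = (\<Sum>i\<in>Basis. (- 1) powi (- k) * (X q (\<lambda>r. \<Phi> r \<bullet> i) * F' (\<Phi> q) i))"
    by (intro sum.cong refl) (simp add: \<Phi>w)
  also have "\<dots> = (- 1) powi (- k) * X q f" by (simp add: Xq sum_distrib_left)
  finally show ?thesis by (simp add: q_def)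
qed

lemma weight_nonzero:
  assumes p: "p \<in> points M" and a: "a \<noteq> 0" and f: "smooth_at M eucl f (h a p)"
  shows "X p (\<lambda>q. f (h a q)) = a powi (- k) * X (h a p) f"
proof (cases "a > 0")
  case True
  then show ?thesis using weight_pos[OF p _ f] by simp
next
  case False
  define b where "b = - a"
  have b: "b > 0" "a = - 1 * b" using False a by (auto simp: b_def)
  have hb: "h b p \<in> points M" by (rule homothety_points[OF p])
  have f': "smooth_at M eucl f (h (- 1) (h b p))"
    using f homothety_homothety[OF p, of "- 1" b] b(2) by simp
  have fb: "smooth_at M eucl (\<lambda>q. f (h (- 1) q)) (h b p)" by (rule smooth_at_homothety_compose[OF hb f'])
  \<comment> \<open>The factorization of \<open>h a\<close> holds only on \<open>points M\<close>,
    so the two test functions are identified by locality, with scaling constant 1.\<close>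
  have "X p (\<lambda>q. f (h a q)) = 1 * X p (\<lambda>q. f (h (- 1) (h b q)))"
    by (rule tangent_vector_scale[OF M tangent[OF p] smooth_at_homothety_compose[OF p fb], of "points M"])
      (use p homothety_homothety[of _ "- 1" b] b(2) in auto)
  also have "\<dots> = b powi (- k) * X (h b p) (\<lambda>q. f (h (- 1) q))"
    using weight_pos[OF p b(1) fb] by simp
  also have "\<dots> = b powi (- k) * ((- 1) powi (- k) * X (h a p) f)"
    using weight_minus_one[OF hb f'] homothety_homothety[OF p, of "- 1" b] b(2) by simp
  also have "\<dots> = a powi (- k) * X (h a p) f"
    unfolding b(2) power_int_mult_distrib by simp
  finally show ?thesis .
qed

text \<open>A homothety scales velocities by \<open>a powi (- k)\<close>, and running through the
  curve at speed \<open>a powi k\<close> undoes this. For odd \<open>k\<close> and negative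
  \<open>a\<close> time is reversed.\<close>

lemma homothety_integral_curve:
  assumes g: "integral_curve M X \<gamma>" and a: "a \<noteq> 0"
  shows "integral_curve M X (\<lambda>s. h a (\<gamma> (a powi k * s)))"
  unfolding integral_curve_def
proof (intro conjI allI impI)
  have gM: "\<gamma> s \<in> points M" for s using g by (auto simp: integral_curve_def)
  then show "range (\<lambda>s. h a (\<gamma> (a powi k * s))) \<subseteq> points M" using homothety_points by auto
  have "smooth_map M M (h a)" unfolding smooth_map_iff[OF M M] using homothety_smooth_point by blast
  then have "continuous_on (points M) (h a)" by (simp add: smooth_map_def)
  moreover have "continuous_on UNIV \<gamma>" using g by (simp add: integral_curve_def)
  then have "continuous_on UNIV (\<lambda>s. \<gamma> (a powi k * s))"
    by (rule continuous_on_compose2) (auto intro: continuous_intros)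
  ultimately show "continuous_on UNIV (\<lambda>s. h a (\<gamma> (a powi k * s)))"
    by (rule continuous_on_compose2) (use gM in auto)
  fix t f assume "smooth_fun_near M (h a (\<gamma> (a powi k * t))) f"
  then have f: "smooth_at M eucl f (h a (\<gamma> (a powi k * t)))" by (simp add: smooth_fun_near_iff[OF M])
  have "smooth_fun_near M (\<gamma> (a powi k * t)) (\<lambda>q. f (h a q))"
    using smooth_at_homothety_compose[OF gM f] by (simp add: smooth_fun_near_iff[OF M])
  then have "((\<lambda>s. f (h a (\<gamma> s))) has_real_derivative X (\<gamma> (a powi k * t)) (\<lambda>q. f (h a q))) (at (a powi k * t))"
    using g unfolding integral_curve_def by blast
  then have "((\<lambda>s. f (h a (\<gamma> s))) has_real_derivative
      a powi (- k) * X (h a (\<gamma> (a powi k * t))) f) (at (a powi k * t))"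
    by (simp only: weight_nonzero[OF gM a f])
  moreover have "((\<lambda>s. a powi k * s) has_real_derivative a powi k) (at t)"
    by (auto intro!: derivative_eq_intros)
  ultimately have "((\<lambda>s. f (h a (\<gamma> (a powi k * s)))) has_real_derivative
      a powi (- k) * X (h a (\<gamma> (a powi k * t))) f * a powi k) (at t)"
    by (rule DERIV_chain2)
  moreover have "a powi (- k) * X (h a (\<gamma> (a powi k * t))) f * a powi k = X (h a (\<gamma> (a powi k * t))) f"
    using a by (simp add: power_int_minus)
  ultimately show "((\<lambda>s. f (h a (\<gamma> (a powi k * s)))) has_real_derivative
      X (h a (\<gamma> (a powi k * t))) f) (at t)" by simp
qed

lemma flow_homothety:
  assumes complete: "complete_field M X" and p: "p \<in> points M" and a: "a \<noteq> 0"
  shows "flow M X t (h a p) = h a (flow M X (a powi k * t) p)"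
proof -
  interpret complete_vector_field M X by unfold_locales (rule M, rule X, rule complete)
  show ?thesis
    using flow_unique[OF homothety_integral_curve[OF flow_integral_curve[OF p] a], of t] flow_0[OF p] by simp
qed

end

section \<open>The actions\<close>

lemma open_units_G2: "open (carrier (units_of G2))"
proof -
  have "carrier (units_of G2) = fst -` (- {0 :: real})" by (auto simp: carrier_units_G2)
  moreover have "open (fst -` (- {0 :: real}) :: (real \<times> real) set)" by (intro open_vimage_fst open_Compl closed_singleton)
  ultimately show ?thesis by simp
qed

lemma one_units_G2: "\<one>\<^bsub>units_of G2\<^esub> = (1, 0)"
  by (simp add: units_of_one G2_def)

lemma mult_units_G2: "(a, b) \<otimes>\<^bsub>units_of G2\<^esub> (A, B) = (a * A, a * B + b * A\<^sup>2)"
  by (simp add: units_of_mult G2_def)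

abbreviation units_G2_mfd :: "(real \<times> real, real \<times> real) mfd" where
  "units_G2_mfd \<equiv> eucl_mfd UNIV (carrier (units_of G2))"

lemma smooth_manifold_units_G2: "smooth_manifold units_G2_mfd"
  by (rule smooth_manifold_eucl_mfd) (simp_all add: open_units_G2)

lemma
  assumes "g \<in> carrier (units_of G2)"
  shows smooth_at_units_fst: "smooth_at units_G2_mfd eucl fst g"
    and smooth_at_units_quotient: "smooth_at units_G2_mfd eucl (\<lambda>g. snd g / fst g) g"
proof -
  show "smooth_at units_G2_mfd eucl fst g"
    by (rule smooth_at_eucl_mfd[OF openin_subtopology_self assms smooth_on_linear[OF bounded_linear_fst]]) simp
  show "smooth_at units_G2_mfd eucl (\<lambda>g. snd g / fst g) g"
    by (rule smooth_at_eucl_mfd[OF openin_subtopology_self assms smooth_on_divide[OF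
            smooth_on_linear[OF bounded_linear_snd] smooth_on_linear[OF bounded_linear_fst]]])
      (auto simp: carrier_units_G2)
qed

lemma (in graded_bundle_locale) smooth_at_homothety_family:
  assumes N: "smooth_manifold N" and t: "smooth_at N eucl t z" and f: "smooth_at N M f z"
  shows "smooth_at N M (\<lambda>z. h (t z) (f z)) z"
proof -
  have eu: "smooth_manifold (eucl :: (real, real) mfd)" by (rule smooth_manifold_eucl)
  have "f z \<in> points M" using smooth_at_points[OF N M f] by simp
  from smooth_at_compose[OF N smooth_manifold_prod_mfd[OF eu M] M smooth_at_Pair[OF eu M N t f]
      homothety_smooth[OF this]]
  show ?thesis by simp
qed

lemma (in complete_vector_field) smooth_at_flow_family:
  assumes N: "smooth_manifold N" and t: "smooth_at N eucl t z" and f: "smooth_at N M f z"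
  shows "smooth_at N M (\<lambda>z. flow M X (t z) (f z)) z"
proof -
  have eu: "smooth_manifold (eucl :: (real, real) mfd)" by (rule smooth_manifold_eucl)
  have "f z \<in> points M" using smooth_at_points[OF N M f] by simp
  from smooth_at_compose[OF N smooth_manifold_prod_mfd[OF eu M] M smooth_at_Pair[OF eu M N t f]
      flow_smooth[OF this]]
  show ?thesis by simp
qed

locale complete_weighted_field = weighted_field +
  assumes complete: "complete_field M X"
begin

sublocale complete_vector_field M X
  by unfold_locales (rule M, rule X, rule complete)

lemmas flow_homothety' = flow_homothety[OF complete]

text \<open>For \<open>k = -1\<close> the inner flow and \<open>h A\<close> are exchanged at the
  price of multiplying the time by \<open>A\<close>; then the two flows are adjacent and their times
  add, as do the homotheties, whose parameters multiply.\<close>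

lemma weight_minus_one_action:
  assumes k: "k = -1"
  shows "p \<in> points M \<Longrightarrow> a \<noteq> 0 \<Longrightarrow> flow M X (b / a) (h a p) = h a (flow M X (b / a\<^sup>2) p)"
    and "smooth_right_action (units_of G2) M (\<lambda>p (a, b). flow M X (b / a) (h a p))"
proof -
  show fh: "flow M X (b / a) (h a p) = h a (flow M X (b / a\<^sup>2) p)" if "p \<in> points M" "a \<noteq> 0" for p a b
    using flow_homothety'[OF that, of "b / a"] by (simp add: k power_int_minus power2_eq_square field_simps)
  define act where "act p g = (case g of (a, b) \<Rightarrow> flow M X (b / a) (h a p))" for p and g :: "real \<times> real"
  have "act p \<one>\<^bsub>units_of G2\<^esub> = p" if "p \<in> points M" for p
    by (simp add: act_def one_units_G2 homothety_1 flow_0 that)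
  moreover have "act (act p g) g' = act p (g \<otimes>\<^bsub>units_of G2\<^esub> g')"
    if p: "p \<in> points M" and g: "g \<in> carrier (units_of G2)" "g' \<in> carrier (units_of G2)" for p g g'
  proof -
    obtain a b A B where ab: "g = (a, b)" "g' = (A, B)" "a \<noteq> 0" "A \<noteq> 0"
      using g by (cases g, cases g') (auto simp: carrier_units_G2)
    have hp: "h a p \<in> points M" "h A (h a p) \<in> points M" using p homothety_points by auto
    \<comment> \<open>The commutation rule is read from right to left, so the time of the outer flow
      has to be chosen such that rescaling it returns \<open>b / a\<close>.\<close>
    have "A powi k * ((b / a) * A) = b / a" using ab(4) by (simp add: k power_int_minus)
    then have "h A (flow M X (b / a) (h a p)) = flow M X ((b / a) * A) (h A (h a p))"
      using flow_homothety'[OF hp(1) ab(4), of "(b / a) * A"] by (simp only:)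
    then have "act (act p g) g' = flow M X (B / A + (b / a) * A) (h A (h a p))"
      by (simp add: act_def ab flow_add[OF hp(2)])
    \<comment> \<open>The total time is the second component of the product in \<open>G2\<close>
      divided by the first; this is where the term \<open>b * A\<^sup>2\<close> of the group law
      appears.\<close>
    moreover have "B / A + (b / a) * A = (a * B + b * A\<^sup>2) / (a * A)"
      using ab(3,4) by (simp add: field_simps power2_eq_square)
    ultimately show ?thesis
      by (simp add: act_def ab mult_units_G2 homothety_homothety[OF p] mult.commute)
  qed
  moreover have "smooth_map (prod_mfd M units_G2_mfd) M (\<lambda>(p, g). act p g)"
  proof -
    let ?N = "prod_mfd M units_G2_mfd"
    have N: "smooth_manifold ?N" by (rule smooth_manifold_prod_mfd[OF M smooth_manifold_units_G2])
    have "smooth_at ?N M (\<lambda>z. flow M X (snd (snd z) / fst (snd z)) (h (fst (snd z)) (fst z))) z"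
      if zN: "z \<in> points ?N" for z
    proof -
      obtain p g where z: "z = (p, g)" "p \<in> points M" "g \<in> carrier (units_of G2)"
        using zN by (cases z) (simp add: points_prod_mfd points_eucl_mfd)
      have gp: "g \<in> points units_G2_mfd" using z(3) by (simp add: points_eucl_mfd)
      have 1: "smooth_at ?N M fst z" "smooth_at ?N units_G2_mfd snd z"
        unfolding z(1) by (rule smooth_at_fst[OF M smooth_manifold_units_G2 z(2) gp],
            rule smooth_at_snd[OF M smooth_manifold_units_G2 z(2) gp])
      have 2: "smooth_at ?N eucl (\<lambda>z. fst (snd z)) z"
        by (rule smooth_at_compose[OF N smooth_manifold_units_G2 smooth_manifold_eucl 1(2)])
          (simp add: z smooth_at_units_fst)
      have 3: "smooth_at ?N eucl (\<lambda>z. snd (snd z) / fst (snd z)) z"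
        by (rule smooth_at_compose[OF N smooth_manifold_units_G2 smooth_manifold_eucl 1(2)])
          (simp add: z smooth_at_units_quotient)
      show ?thesis by (rule smooth_at_flow_family[OF N 3 smooth_at_homothety_family[OF N 2 1(1)]])
    qed
    moreover have "(\<lambda>(p, g). act p g) = (\<lambda>z. flow M X (snd (snd z) / fst (snd z)) (h (fst (snd z)) (fst z)))"
      by (auto simp: act_def fun_eq_iff)
    ultimately show ?thesis by (simp add: smooth_map_iff[OF N M])
  qed
  ultimately have "smooth_right_action (units_of G2) M act" unfolding smooth_right_action_def by blast
  then show "smooth_right_action (units_of G2) M (\<lambda>p (a, b). flow M X (b / a) (h a p))"
    unfolding act_def[abs_def] .
qed

text \<open>For \<open>k = 1\<close> it is the homothety \<open>h A\<close> that is moved outward,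
  and this multiplies the time of the outer flow by \<open>A\<close>. The total time is the same as
  for weight -1, but the factors are now applied in the opposite order, hence a left action.\<close>

lemma weight_one_action:
  assumes k: "k = 1"
  shows "p \<in> points M \<Longrightarrow> a \<noteq> 0 \<Longrightarrow> h a (flow M X (b / a) p) = flow M X (b / a\<^sup>2) (h a p)"
    and "smooth_left_action (units_of G2) M (\<lambda>(a, b) p. h a (flow M X (b / a) p))"
proof -
  show fh: "h a (flow M X (b / a) p) = flow M X (b / a\<^sup>2) (h a p)" if "p \<in> points M" "a \<noteq> 0" for p a b
    using flow_homothety'[OF that, of "b / a\<^sup>2"] that by (simp add: k power2_eq_square)
  define act where "act g p = (case g of (a, b) \<Rightarrow> h a (flow M X (b / a) p))" for p and g :: "real \<times> real"
  have "act \<one>\<^bsub>units_of G2\<^esub> p = p" if "p \<in> points M" for p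
    by (simp add: act_def one_units_G2 homothety_1 flow_0 that)
  moreover have "act g (act g' p) = act (g \<otimes>\<^bsub>units_of G2\<^esub> g') p"
    if p: "p \<in> points M" and g: "g \<in> carrier (units_of G2)" "g' \<in> carrier (units_of G2)" for p g g'
  proof -
    obtain a b A B where ab: "g = (a, b)" "g' = (A, B)" "a \<noteq> 0" "A \<noteq> 0"
      using g by (cases g, cases g') (auto simp: carrier_units_G2)
    have fp: "flow M X (B / A) p \<in> points M" "flow M X (A * (b / a)) (flow M X (B / A) p) \<in> points M"
      using p flow_in_points by auto
    have "flow M X (b / a) (h A (flow M X (B / A) p)) = h A (flow M X (A * (b / a) + B / A) p)"
      using flow_homothety'[OF fp(1) ab(4), of "b / a"] by (simp add: k flow_add[OF p])
    then have "act g (act g' p) = h (a * A) (flow M X (A * (b / a) + B / A) p)"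
      by (simp add: act_def ab homothety_homothety flow_in_points[OF p])
    moreover have "A * (b / a) + B / A = (a * B + b * A\<^sup>2) / (a * A)"
      using ab(3,4) by (simp add: field_simps power2_eq_square)
    ultimately show ?thesis by (simp add: act_def ab mult_units_G2)
  qed
  moreover have "smooth_map (prod_mfd units_G2_mfd M) M (\<lambda>(g, p). act g p)"
  proof -
    let ?N = "prod_mfd units_G2_mfd M"
    have N: "smooth_manifold ?N" by (rule smooth_manifold_prod_mfd[OF smooth_manifold_units_G2 M])
    have "smooth_at ?N M (\<lambda>z. h (fst (fst z)) (flow M X (snd (fst z) / fst (fst z)) (snd z))) z"
      if zN: "z \<in> points ?N" for z
    proof -
      obtain p g where z: "z = (g, p)" "p \<in> points M" "g \<in> carrier (units_of G2)"
        using zN by (cases z) (simp add: points_prod_mfd points_eucl_mfd)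
      have gp: "g \<in> points units_G2_mfd" using z(3) by (simp add: points_eucl_mfd)
      have 1: "smooth_at ?N M snd z" "smooth_at ?N units_G2_mfd fst z"
        unfolding z(1) by (rule smooth_at_snd[OF smooth_manifold_units_G2 M gp z(2)],
            rule smooth_at_fst[OF smooth_manifold_units_G2 M gp z(2)])
      have 2: "smooth_at ?N eucl (\<lambda>z. fst (fst z)) z"
        by (rule smooth_at_compose[OF N smooth_manifold_units_G2 smooth_manifold_eucl 1(2)])
          (simp add: z smooth_at_units_fst)
      have 3: "smooth_at ?N eucl (\<lambda>z. snd (fst z) / fst (fst z)) z"
        by (rule smooth_at_compose[OF N smooth_manifold_units_G2 smooth_manifold_eucl 1(2)])
          (simp add: z smooth_at_units_quotient)
      show ?thesis by (rule smooth_at_homothety_family[OF N 2 smooth_at_flow_family[OF N 3 1(1)]])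
    qed
    moreover have "(\<lambda>(g, p). act g p) = (\<lambda>z. h (fst (fst z)) (flow M X (snd (fst z) / fst (fst z)) (snd z)))"
      by (auto simp: act_def fun_eq_iff)
    ultimately show ?thesis by (simp add: smooth_map_iff[OF N M])
  qed
  ultimately have "smooth_left_action (units_of G2) M act" unfolding smooth_left_action_def by blast
  moreover have "act = (\<lambda>(a, b) p. h a (flow M X (b / a) p))" by (auto simp: act_def fun_eq_iff)
  ultimately show "smooth_left_action (units_of G2) M (\<lambda>(a, b) p. h a (flow M X (b / a) p))" by simp
qed

end

theorem lemma4p4:
  fixes M :: "('a::{t2_space,second_countable_topology}, 'e::euclidean_space) mfd"
    and M0 :: "('b::{t2_space,second_countable_topology}, 'c::euclidean_space) mfd"
    and w :: "'i::finite \<Rightarrow> nat"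
    and \<tau> :: "'a \<Rightarrow> 'b"
    and \<Psi> :: "('a, 'b, real^'i) triv set"
    and h :: "real \<Rightarrow> 'a \<Rightarrow> 'a"
  assumes graded: "graded_bundle M M0 w \<tau> \<Psi>"
    and h: "h = homothety M w \<tau> \<Psi>"
  shows "(\<forall>X. vector_field M X \<and> complete_field M X \<and> has_weight M h X (-1) \<longrightarrow>
            (\<forall>p\<in>points M. \<forall>a b. a \<noteq> 0 \<longrightarrow>
               flow M X (b / a) (h a p) = h a (flow M X (b / a\<^sup>2) p)) \<and>
            smooth_right_action (units_of G2) M (\<lambda>p (a, b). flow M X (b / a) (h a p))) \<and>
         (\<forall>Y. vector_field M Y \<and> complete_field M Y \<and> has_weight M h Y 1 \<longrightarrow>
            (\<forall>p\<in>points M. \<forall>a b. a \<noteq> 0 \<longrightarrow>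
               h a (flow M Y (b / a) p) = flow M Y (b / a\<^sup>2) (h a p)) \<and>
            smooth_left_action (units_of G2) M (\<lambda>(a, b) p. h a (flow M Y (b / a) p)))"
proof (intro conjI allI impI, goal_cases)
  case (1 X)
  then interpret complete_weighted_field M M0 w \<tau> \<Psi> X "- 1"
    using graded h by unfold_locales auto
  show ?case using weight_minus_one_action(1) h by blast
next
  case (2 X)
  then interpret complete_weighted_field M M0 w \<tau> \<Psi> X "- 1"
    using graded h by unfold_locales auto
  show ?case using weight_minus_one_action(2) h by blast
next
  case (3 Y)
  then interpret complete_weighted_field M M0 w \<tau> \<Psi> Y 1
    using graded h by unfold_locales auto
  show ?case using weight_one_action(1) h by blast
next
  case (4 Y)
  then interpret complete_weighted_field M M0 w \<tau> \<Psi> Y 1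
    using graded h by unfold_locales auto
  show ?case using weight_one_action(2) h by blast
qed

end
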